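(* Let $S$ be a regular countably compact semitopological semigroup which is algebraically a primitive inverse semigroup, $S=\sum_{i\in\mathscr I}B_{\lambda_i}(G_i)$. Suppose that for every $i\in\mathscr I$ there is $\alpha_i\in\lambda_i$ such that at least one of the following holds: (1) the maximal subgroup $(G_i)_{\alpha_i,\alpha_i}$ (subspace topology) is left precompact; (2) $(G_i)_{\alpha_i,\alpha_i}$ is left $\omega$-precompact and pseudocompact; (3) the subsemigroup $(G_i)_{\alpha_i,\alpha_i}\cup\{0\}$ is a topological semigroup. Then $S$ is Tychonoff, and its Stone–Čech compactification $\beta S$ admits a structure of a primitive inverse semitopological semigroup with continuous inversion with respect to which the inclusion $S\hookrightarrow\beta S$ is a topological isomorphism onto its image. Moreover, $\beta S$ is topologically isomorphic to the orthogonal sum $\sum_{i\in\mathscr I}B_{\lambda_i}(\beta G_i)$, where each $\beta G_i$ (the Stone–Čech compactification of $G_i$, topologized as $(G_i)_{\alpha_i,\alpha_i}$) is a compact topological group and each $B_{\lambda_i}(\beta G_i)$ is a compact semitopological Brandt semigroup whose subspaces $(\beta G_i)_{\alpha,\alpha}$ are homeomorphic to $\beta G_i$ via $g\mapsto(\alpha,g,\alpha)$.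
   Context: All spaces are Hausdorff; a semitopological (topological) semigroup is a Hausdorff space with separately (jointly) continuous associative operation. For a group $G$ and cardinal $\lambda\ge1$, $B_\lambda(G)=(\lambda\times G\times\lambda)\cup\{0\}$ with $(\alpha,a,\beta)(\gamma,b,\delta)=(\alpha,ab,\delta)$ if $\beta=\gamma$ and $0$ otherwise. The orthogonal sum of semigroups $T_\iota$ with zeros is $\{0\}\cup\bigcup_\iota(T_\iota\setminus\{0_\iota\})$ with products computed in $T_\iota$ when both factors lie in the same $T_\iota$ and the product is non-zero, and $0$ otherwise. Primitive inverse semigroups are exactly orthogonal sums $\sum_{i\in\mathscr I}B_{\lambda_i}(G_i)$; we identify $B_{\lambda_i}(G_i)$ with a subsemigroup of $S$ and write $(G_i)_{\alpha,\beta}=\{(\alpha,g,\beta):g\in G_i\}$. A group with topology is left precompact (left $\omega$-precompact) if for every neighbourhood $U$ of the unit there is a finite (countable) $F$ with $FU=G$. Pseudocompact: every locally finite family of non-empty open sets is finite. *)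

theory Defs
  imports "HOL-Analysis.Analysis" "HOL-Algebra.Group"
begin

definition countably_compact_space :: "'a topology \<Rightarrow> bool" where
  "countably_compact_space X \<longleftrightarrow>
     (\<forall>\<U>. countable \<U> \<and> (\<forall>U\<in>\<U>. openin X U) \<and> topspace X \<subseteq> \<Union>\<U> \<longrightarrow>
        (\<exists>\<F>. finite \<F> \<and> \<F> \<subseteq> \<U> \<and> topspace X \<subseteq> \<Union>\<F>))"

definition locally_finite_family :: "'a topology \<Rightarrow> 'a set set \<Rightarrow> bool" where
  "locally_finite_family X \<A> \<longleftrightarrow>
     (\<forall>x\<in>topspace X. \<exists>V. openin X V \<and> x \<in> V \<and> finite {A\<in>\<A>. A \<inter> V \<noteq> {}})"

definition pseudocompact_space :: "'a topology \<Rightarrow> bool" where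
  "pseudocompact_space X \<longleftrightarrow>
     (\<forall>\<A>. (\<forall>A\<in>\<A>. openin X A \<and> A \<noteq> {}) \<and> locally_finite_family X \<A> \<longrightarrow> finite \<A>)"

definition tychonoff_space :: "'a topology \<Rightarrow> bool" where
  "tychonoff_space X \<longleftrightarrow> completely_regular_space X \<and> Hausdorff_space X"

definition stone_cech :: "'a topology \<Rightarrow> 'b topology \<Rightarrow> ('a \<Rightarrow> 'b) \<Rightarrow> bool" where
  "stone_cech X K e \<longleftrightarrow>
     compact_space K \<and> Hausdorff_space K \<and> embedding_map X K e \<and>
     K closure_of (e ` topspace X) = topspace K \<and>
     (\<forall>f. continuous_map X euclideanreal f \<and> bounded (f ` topspace X) \<longrightarrow>
        (\<exists>g. continuous_map K euclideanreal g \<and> (\<forall>x\<in>topspace X. g (e x) = f x)))"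

definition semigroup_on :: "'a set \<Rightarrow> ('a \<Rightarrow> 'a \<Rightarrow> 'a) \<Rightarrow> bool" where
  "semigroup_on A m \<longleftrightarrow> (\<forall>x\<in>A. \<forall>y\<in>A. m x y \<in> A) \<and>
     (\<forall>x\<in>A. \<forall>y\<in>A. \<forall>z\<in>A. m (m x y) z = m x (m y z))"

definition semitopological_semigroup :: "'a topology \<Rightarrow> ('a \<Rightarrow> 'a \<Rightarrow> 'a) \<Rightarrow> bool" where
  "semitopological_semigroup X m \<longleftrightarrow> Hausdorff_space X \<and> semigroup_on (topspace X) m \<and>
     (\<forall>a\<in>topspace X. continuous_map X X (\<lambda>x. m a x) \<and> continuous_map X X (\<lambda>x. m x a))"

definition topological_semigroup :: "'a topology \<Rightarrow> ('a \<Rightarrow> 'a \<Rightarrow> 'a) \<Rightarrow> bool" where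
  "topological_semigroup X m \<longleftrightarrow> Hausdorff_space X \<and> semigroup_on (topspace X) m \<and>
     continuous_map (prod_topology X X) X (\<lambda>(x, y). m x y)"

definition inverse_semigroup :: "'a set \<Rightarrow> ('a \<Rightarrow> 'a \<Rightarrow> 'a) \<Rightarrow> bool" where
  "inverse_semigroup A m \<longleftrightarrow> semigroup_on A m \<and>
     (\<forall>x\<in>A. \<exists>!y. y \<in> A \<and> m (m x y) x = x \<and> m (m y x) y = y)"

definition semigroup_inverse :: "'a set \<Rightarrow> ('a \<Rightarrow> 'a \<Rightarrow> 'a) \<Rightarrow> 'a \<Rightarrow> 'a" where
  "semigroup_inverse A m x = (THE y. y \<in> A \<and> m (m x y) x = x \<and> m (m y x) y = y)"

definition is_zero :: "'a set \<Rightarrow> ('a \<Rightarrow> 'a \<Rightarrow> 'a) \<Rightarrow> 'a \<Rightarrow> bool" where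
  "is_zero A m z \<longleftrightarrow> z \<in> A \<and> (\<forall>x\<in>A. m z x = z \<and> m x z = z)"

definition primitive_inverse_semigroup :: "'a set \<Rightarrow> ('a \<Rightarrow> 'a \<Rightarrow> 'a) \<Rightarrow> bool" where
  "primitive_inverse_semigroup A m \<longleftrightarrow> inverse_semigroup A m \<and>
     (\<exists>z. is_zero A m z \<and>
        (\<forall>e\<in>A. \<forall>f\<in>A. m e e = e \<and> e \<noteq> z \<and> m f f = f \<and> f \<noteq> z \<and> m e f = f \<and> m f e = f
            \<longrightarrow> f = e))"

text \<open>A set with a multiplication and a distinguished unit, carrying a topology T
  (carrier = topspace T): left (\<omega>-)precompactness.\<close>
definition left_precompact :: "'a topology \<Rightarrow> ('a \<Rightarrow> 'a \<Rightarrow> 'a) \<Rightarrow> 'a \<Rightarrow> bool" where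
  "left_precompact T m u \<longleftrightarrow>
     (\<forall>U. U \<subseteq> topspace T \<and> (\<exists>V. openin T V \<and> u \<in> V \<and> V \<subseteq> U) \<longrightarrow>
        (\<exists>F. finite F \<and> F \<subseteq> topspace T \<and> (\<Union>f\<in>F. m f ` U) = topspace T))"

definition left_omega_precompact :: "'a topology \<Rightarrow> ('a \<Rightarrow> 'a \<Rightarrow> 'a) \<Rightarrow> 'a \<Rightarrow> bool" where
  "left_omega_precompact T m u \<longleftrightarrow>
     (\<forall>U. U \<subseteq> topspace T \<and> (\<exists>V. openin T V \<and> u \<in> V \<and> V \<subseteq> U) \<longrightarrow>
        (\<exists>F. countable F \<and> F \<subseteq> topspace T \<and> (\<Union>f\<in>F. m f ` U) = topspace T))"

definition topological_group :: "'a topology \<Rightarrow> ('a, 'm) monoid_scheme \<Rightarrow> bool" where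
  "topological_group T G \<longleftrightarrow> group G \<and> topspace T = carrier G \<and> Hausdorff_space T \<and>
     continuous_map (prod_topology T T) T (\<lambda>(x, y). x \<otimes>\<^bsub>G\<^esub> y) \<and>
     continuous_map T T (\<lambda>x. inv\<^bsub>G\<^esub> x)"

text \<open>Concrete model of \<Sum>_{i\<in>I} B_{L i}(G i): None is the zero, Some (i,\<alpha>,g,\<beta>) is the
  element (\<alpha>,g,\<beta>) of B_{L i}(G i).\<close>
definition osum_carrier ::
  "'i set \<Rightarrow> ('i \<Rightarrow> 'l set) \<Rightarrow> ('i \<Rightarrow> ('g, 'm) monoid_scheme) \<Rightarrow> ('i \<times> 'l \<times> 'g \<times> 'l) option set" where
  "osum_carrier I L G = insert None
     {Some (i, a, g, b) | i a g b. i \<in> I \<and> a \<in> L i \<and> b \<in> L i \<and> g \<in> carrier (G i)}"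

definition osum_mult ::
  "('i \<Rightarrow> ('g, 'm) monoid_scheme) \<Rightarrow> ('i \<times> 'l \<times> 'g \<times> 'l) option \<Rightarrow> ('i \<times> 'l \<times> 'g \<times> 'l) option
     \<Rightarrow> ('i \<times> 'l \<times> 'g \<times> 'l) option" where
  "osum_mult G x y = (case (x, y) of
      (Some (i, a, g, b), Some (j, c, h, d)) \<Rightarrow>
        if i = j \<and> b = c then Some (i, a, g \<otimes>\<^bsub>G i\<^esub> h, d) else None
    | _ \<Rightarrow> None)"

definition brandt_part ::
  "'i \<Rightarrow> ('i \<Rightarrow> 'l set) \<Rightarrow> ('i \<Rightarrow> ('g, 'm) monoid_scheme) \<Rightarrow> ('i \<times> 'l \<times> 'g \<times> 'l) option set" where
  "brandt_part i L G = insert None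
     {Some (i, a, g, b) | a g b. a \<in> L i \<and> b \<in> L i \<and> g \<in> carrier (G i)}"

definition group_cell ::
  "'i \<Rightarrow> 'l \<Rightarrow> 'l \<Rightarrow> ('i \<Rightarrow> ('g, 'm) monoid_scheme) \<Rightarrow> ('i \<times> 'l \<times> 'g \<times> 'l) option set" where
  "group_cell i a b G = {Some (i, a, g, b) | g. g \<in> carrier (G i)}"

definition osum_map ::
  "('i \<Rightarrow> 'g \<Rightarrow> 'h) \<Rightarrow> ('i \<times> 'l \<times> 'g \<times> 'l) option \<Rightarrow> ('i \<times> 'l \<times> 'h \<times> 'l) option" where
  "osum_map j x = (case x of None \<Rightarrow> None | Some (i, a, g, b) \<Rightarrow> Some (i, a, j i g, b))"

end

theory Submission
  imports Defs
begin

text \<open>In a countably compact space no two sequences can have their products \<open>x n \<cdot> y m\<close> lie in one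
  closed set for \<open>n < m\<close> and in a disjoint closed set for \<open>n > m\<close> (Grothendieck's double limit
  argument). Playing this off against a topological game shows that every regular countably compact
  semitopological group is a topological group. Each of the three hypotheses on a maximal subgroup
  serves only to keep zero out of its closure; the cells \<open>(\<alpha>, G, \<beta>)\<close> are then clopen, and only
  finitely many of them leave a given neighbourhood of zero.

  On a countably compact group every continuous real function is uniformly continuous, so that
  \<open>(x, y) \<mapsto> f (x \<otimes> y)\<close> extends to the square of the Stone-Cech compactification, which thereby
  becomes a compact topological group. The compactification of the whole semigroup consists of zero
  and the closures of the cells, and a map permuting cells is automatically continuous at zero.\<close>

section \<open>Double limits in countably compact spaces\<close>

text \<open>Inversion is not known to be continuous at the outset, so the sets played in the double
  limit game need not be open: this admits \<open>inv\<close> images of open sets as one of the two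
  coordinates, and lets the game speak about inversion before its continuity is available. A product
  of two countably compact spaces need not be countably compact, so nothing can be quoted about the
  square of the group. The extension of \<open>f (x \<otimes> y)\<close> to two variables rests on
  precompactness and uniform continuity instead. In proving the latter, a sequence of neighbourhoods
  of the unit may have a non-trivial intersection, so cluster points are determined only up to that
  intersection and the function has to be made almost invariant under it. Countable compactness of a
  maximal subgroup needs its closedness, which is where zero interferes; products with corner units
  carry closedness from the one subgroup of each index to all cells. In the compactification these
  products are extended first and the multiplication is defined through them.\<close>

no_notation eq_closure_of (\<open>closure'_of\<index>\<close>)

lemma countably_compact_cluster_point:
  fixes s :: "nat \<Rightarrow> 'a"
  assumes "countably_compact_space X" "\<And>n. s n \<in> topspace X"
  shows "\<exists>x\<in>topspace X. \<forall>U. openin X U \<longrightarrow> x \<in> U \<longrightarrow> infinite {n. s n \<in> U}"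
proof (rule ccontr)
  assume "\<not> ?thesis"
  then have fin: "\<And>x. x \<in> topspace X \<Longrightarrow> \<exists>U. openin X U \<and> x \<in> U \<and> finite {n. s n \<in> U}"
    by blast
  \<comment> \<open>Points with a neighbourhood that misses the sequence from \<open>k\<close> on. A
    finite subcover uses indices at most some \<open>k\<close>, yet every \<open>O' j\<close> with
    \<open>j \<le> k\<close> misses \<open>s k\<close>.\<close>
  define O' where "O' k = \<Union>{U. openin X U \<and> (\<forall>n\<ge>k. s n \<notin> U)}" for k
  have opn: "openin X (O' k)" for k
    unfolding O'_def by (rule openin_Union) auto
  have cov: "topspace X \<subseteq> \<Union>(range O')"
  proof
    fix x assume "x \<in> topspace X"
    then obtain U where U: "openin X U" "x \<in> U" "finite {n. s n \<in> U}"
      using fin by blast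
    then obtain k where "\<And>n. s n \<in> U \<Longrightarrow> n < k"
      by (metis (mono_tags) finite_nat_set_iff_bounded mem_Collect_eq)
    then have "x \<in> O' k"
      unfolding O'_def using U by force
    then show "x \<in> \<Union>(range O')" by blast
  qed
  have "\<exists>\<F>. finite \<F> \<and> \<F> \<subseteq> range O' \<and> topspace X \<subseteq> \<Union>\<F>"
    using assms(1) opn cov unfolding countably_compact_space_def
    by (elim allE[of _ "range O'"] impE conjI) auto
  then obtain J where J: "finite J" "topspace X \<subseteq> \<Union>(O' ` J)"
    by (metis finite_subset_image)
  then obtain k where k: "\<And>j. j \<in> J \<Longrightarrow> j \<le> k"
    by (metis finite_nat_set_iff_bounded_le)
  obtain j where "j \<in> J" "s k \<in> O' j"
    using J assms(2) by blast
  then show False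
    using k unfolding O'_def by blast
qed

lemma infinite_natset_gt:
  assumes "infinite (S :: nat set)"
  obtains m where "m \<in> S" "n < m"
  using assms by (metis infinite_nat_iff_unbounded)

lemma cluster_point_in_closed:
  fixes s :: "nat \<Rightarrow> 'a"
  assumes cl: "\<And>U. openin X U \<Longrightarrow> x \<in> U \<Longrightarrow> infinite {n. s n \<in> U}" and x: "x \<in> topspace X"
    and f: "continuous_map X Z f" and A: "closedin Z A" and s: "\<And>n. N < n \<Longrightarrow> f (s n) \<in> A"
  shows "f x \<in> A"
proof (rule ccontr)
  assume "f x \<notin> A"
  then have "x \<in> {y \<in> topspace X. f y \<in> topspace Z - A}"
    using x f by (auto simp: continuous_map_def)
  moreover have "openin X {y \<in> topspace X. f y \<in> topspace Z - A}"
    using A by (intro openin_continuous_map_preimage[OF f]) auto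
  ultimately have "infinite {n. s n \<in> {y \<in> topspace X. f y \<in> topspace Z - A}}"
    by (intro cl)
  then obtain n where "n \<in> {n. s n \<in> {y \<in> topspace X. f y \<in> topspace Z - A}}" "N < n"
    by (rule infinite_natset_gt)
  then show False using s by auto
qed

text \<open>Grothendieck's double limit argument: cluster points \<open>x\<close>, \<open>y\<close> of the two sequences
  satisfy \<open>F x y \<in> A\<close> (let the second index grow first) and \<open>F x y \<in> B\<close> (let the first
  index grow first).\<close>

lemma double_limit_game:
  fixes F :: "'a \<Rightarrow> 'b \<Rightarrow> 'c"
  assumes X: "countably_compact_space X" and Y: "countably_compact_space Y"
    and F1: "\<And>x. x \<in> topspace X \<Longrightarrow> continuous_map Y Z (F x)"
    and F2: "\<And>y. y \<in> topspace Y \<Longrightarrow> continuous_map X Z (\<lambda>x. F x y)"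
    and A: "closedin Z A" and B: "closedin Z B"
    and init: "P U0 V0"
    and sub: "\<And>U V. P U V \<Longrightarrow> U \<subseteq> topspace X \<and> V \<subseteq> topspace Y"
    and step: "\<And>U V. P U V \<Longrightarrow> \<exists>U' V' x y. P U' V' \<and> U' \<subseteq> U \<and> V' \<subseteq> V \<and> x \<in> U \<and> y \<in> V
                 \<and> (\<forall>x'\<in>U'. F x' y \<in> B) \<and> (\<forall>y'\<in>V'. F x y' \<in> A)"
  shows "A \<inter> B \<noteq> {}"
proof -
  define Q where "Q = (\<lambda>(U, V, x :: 'a, y :: 'b) (U', V', x', y').
      U' \<subseteq> U \<and> V' \<subseteq> V \<and> x' \<in> U \<and> y' \<in> V \<and> (\<forall>z\<in>U'. F z y' \<in> B) \<and> (\<forall>z\<in>V'. F x' z \<in> A))"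
  have "\<exists>f. \<forall>n::nat. (case f n of (U, V, x, y) \<Rightarrow> P U V) \<and> Q (f n) (f (Suc n))"
  proof (rule dependent_nat_choice)
    show "\<exists>x. case x of (U, V, x, y) \<Rightarrow> P U V"
      using init by auto
  next
    fix s :: "'a set \<times> 'b set \<times> 'a \<times> 'b" and n
    assume "case s of (U, V, x, y) \<Rightarrow> P U V"
    then obtain U V x y where s: "s = (U, V, x, y)" "P U V"
      by (cases s) auto
    obtain U' V' x' y' where "P U' V'" "U' \<subseteq> U" "V' \<subseteq> V" "x' \<in> U" "y' \<in> V"
       "\<forall>x\<in>U'. F x y' \<in> B" "\<forall>y\<in>V'. F x' y \<in> A"
      using step[OF s(2)] by blast
    then show "\<exists>t. (case t of (U, V, x, y) \<Rightarrow> P U V) \<and> Q s t"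
      by (intro exI[of _ "(U', V', x', y')"]) (auto simp: Q_def s)
  qed
  then obtain f where f: "\<forall>n::nat. (case f n of (U, V, x, y) \<Rightarrow> P U V) \<and> Q (f n) (f (Suc n))"
    by (elim exE)
  have fP: "case f n of (U, V, x, y) \<Rightarrow> P U V" and fQ: "Q (f n) (f (Suc n))" for n
    using f by auto
  define U where "U n = fst (f n)" for n
  define V where "V n = fst (snd (f n))" for n
  \<comment> \<open>A state stores the points chosen on the way to it, hence the successor:
    \<open>x n\<close> and \<open>y n\<close> lie in \<open>U n\<close> and \<open>V n\<close> and
    constrain \<open>V (Suc n)\<close> and \<open>U (Suc n)\<close>.\<close>
  define x where "x n = fst (snd (snd (f (Suc n))))" for n
  define y where "y n = snd (snd (snd (f (Suc n))))" for n
  have feq: "f n = (U n, V n, fst (snd (snd (f n))), snd (snd (snd (f n))))" for n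
    by (simp add: U_def V_def)
  have PUV: "P (U n) (V n)" for n
    using fP[of n] by (simp add: U_def V_def case_prod_beta)
  have Q': "U (Suc n) \<subseteq> U n \<and> V (Suc n) \<subseteq> V n \<and> x n \<in> U n \<and> y n \<in> V n
     \<and> (\<forall>z\<in>U (Suc n). F z (y n) \<in> B) \<and> (\<forall>z\<in>V (Suc n). F (x n) z \<in> A)" for n
    using fQ[of n] by (auto simp: Q_def case_prod_beta x_def y_def U_def V_def)
  have decU: "m \<le> n \<Longrightarrow> U n \<subseteq> U m" for m n
    by (rule lift_Suc_antimono_le[of U]) (use Q' in auto)
  have decV: "m \<le> n \<Longrightarrow> V n \<subseteq> V m" for m n
    by (rule lift_Suc_antimono_le[of V]) (use Q' in auto)
  have inA: "F (x n) (y m) \<in> A" if "n < m" for n m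
    using Q'[of n] Q'[of m] decV[of "Suc n" m] that by auto
  have inB: "F (x m) (y n) \<in> B" if "n < m" for n m
    using Q'[of n] Q'[of m] decU[of "Suc n" m] that by auto
  have xX: "x n \<in> topspace X" and yY: "y n \<in> topspace Y" for n
    using Q'[of n] sub[OF PUV[of n]] by auto
  obtain a where a: "a \<in> topspace X" "\<And>U. openin X U \<Longrightarrow> a \<in> U \<Longrightarrow> infinite {n. x n \<in> U}"
    using countably_compact_cluster_point[of X x, OF X xX] by blast
  obtain b where b: "b \<in> topspace Y" "\<And>U. openin Y U \<Longrightarrow> b \<in> U \<Longrightarrow> infinite {n. y n \<in> U}"
    using countably_compact_cluster_point[of Y y, OF Y yY] by blast
  have xb: "F (x n) b \<in> A" for n
    by (rule cluster_point_in_closed[OF b(2) b(1) F1[OF xX] A inA])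
  have ay: "F a (y n) \<in> B" for n
    by (rule cluster_point_in_closed[OF a(2) a(1) F2[OF yY] B inB])
  have "F a b \<in> A"
    by (rule cluster_point_in_closed[OF a(2) a(1) F2[OF b(1)] A xb])
  moreover have "F a b \<in> B"
    by (rule cluster_point_in_closed[OF b(2) b(1) F1[OF a(1)] B ay])
  ultimately show ?thesis by blast
qed

section \<open>A weak form of joint continuity for separately continuous actions\<close>

lemma openin_subset_closure_of: "openin X U \<Longrightarrow> U \<subseteq> X closure_of U"
  by (simp add: closure_of_subset openin_subset)

lemma regular_space_shrink:
  assumes "regular_space X" "openin X U" "x \<in> U"
  obtains V where "openin X V" "x \<in> V" "X closure_of V \<subseteq> U"
  using assms unfolding neighbourhood_base_of_closedin[symmetric] neighbourhood_base_of
  by (metis closure_of_minimal subset_trans)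

text \<open>If every pair \<open>U'\<close>, \<open>V'\<close> contained a bad pair
  \<open>x\<close>, \<open>y\<close>, the game could be played with it: \<open>F x y\<close> lies
  outside \<open>U\<close>, while \<open>F x e = x\<close> lies in \<open>W0\<close>. Thus
  \<open>F x y'\<close> stays in \<open>W0\<close> for \<open>y'\<close> near \<open>e\<close>, and
  \<open>F x' y\<close> stays away from \<open>W\<close> for \<open>x'\<close> near
  \<open>x\<close>.\<close>

lemma separately_continuous_quasicontinuity:
  fixes F :: "'a \<Rightarrow> 'b \<Rightarrow> 'a"
  assumes X: "countably_compact_space X" "regular_space X" and Y: "countably_compact_space Y"
    and F1: "\<And>x. x \<in> topspace X \<Longrightarrow> continuous_map Y X (F x)"
    and F2: "\<And>y. y \<in> topspace Y \<Longrightarrow> continuous_map X X (\<lambda>x. F x y)"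
    and e: "e \<in> topspace Y" "\<And>x. x \<in> topspace X \<Longrightarrow> F x e = x"
    and U: "openin X U" "U \<noteq> {}"
  obtains U' V' where "openin X U'" "U' \<noteq> {}" "U' \<subseteq> U" "openin Y V'" "e \<in> V'"
    "\<And>x y. x \<in> U' \<Longrightarrow> y \<in> V' \<Longrightarrow> F x y \<in> U"
proof (rule ccontr)
  assume "\<not> thesis"
  with that have neg: "\<And>U' V'. openin X U' \<Longrightarrow> U' \<noteq> {} \<Longrightarrow> U' \<subseteq> U \<Longrightarrow> openin Y V' \<Longrightarrow> e \<in> V' \<Longrightarrow>
     \<exists>x\<in>U'. \<exists>y\<in>V'. F x y \<notin> U"
    by blast
  obtain u where u: "u \<in> U" using U by blast
  \<comment> \<open>Two shrinkings are needed: the conditions imposed during the game must be open,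
    while its targets, the closure of \<open>W0\<close> and the complement of \<open>W\<close>, must
    be closed and disjoint.\<close>
  obtain W where W: "openin X W" "u \<in> W" "X closure_of W \<subseteq> U"
    using regular_space_shrink X U u by metis
  obtain W0 where W0: "openin X W0" "u \<in> W0" "X closure_of W0 \<subseteq> W"
    using regular_space_shrink X W u by metis
  have W0W: "W0 \<subseteq> W" and WU: "W \<subseteq> U"
    using W W0 openin_subset_closure_of subset_trans by metis+
  define P where "P U' V' \<longleftrightarrow> openin X U' \<and> U' \<noteq> {} \<and> U' \<subseteq> W0 \<and> openin Y V' \<and> e \<in> V'" for U' V'
  have "X closure_of W0 \<inter> (topspace X - W) \<noteq> {}"
  proof (rule double_limit_game[of X Y X F _ _ P])
    show "P W0 (topspace Y)"
      using W0 e by (auto simp: P_def)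
    show "U' \<subseteq> topspace X \<and> V' \<subseteq> topspace Y" if "P U' V'" for U' V'
      using that by (simp add: P_def openin_subset)
  next
    fix U' V' assume P: "P U' V'"
    then obtain x y where xy: "x \<in> U'" "y \<in> V'" "F x y \<notin> U"
      using neg[of U' V'] W0W WU unfolding P_def by blast
    have tx: "x \<in> topspace X" and ty: "y \<in> topspace Y"
      using P xy by (auto simp: P_def dest: openin_subset)
    let ?U = "U' \<inter> {z \<in> topspace X. F z y \<in> topspace X - X closure_of W}"
    let ?V = "V' \<inter> {z \<in> topspace Y. F x z \<in> W0}"
    have "openin X ?U"
      using P F2[OF ty] by (intro openin_Int openin_continuous_map_preimage[of X X]) (auto simp: P_def)
    moreover have "x \<in> ?U"
      using xy tx W F2[OF ty] by (auto simp: continuous_map_def)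
    moreover have "openin Y ?V"
      using P F1[OF tx] W0 by (intro openin_Int openin_continuous_map_preimage[of Y X]) (auto simp: P_def)
    moreover have "e \<in> ?V"
      using P xy e tx by (auto simp: P_def)
    ultimately have "P ?U ?V"
      using P unfolding P_def by blast
    moreover have "\<forall>x'\<in>?U. F x' y \<in> topspace X - W"
      using openin_subset_closure_of[OF W(1)] by blast
    moreover have "\<forall>y'\<in>?V. F x y' \<in> X closure_of W0"
      using openin_subset_closure_of[OF W0(1)] by blast
    ultimately show "\<exists>U'' V'' x y. P U'' V'' \<and> U'' \<subseteq> U' \<and> V'' \<subseteq> V' \<and> x \<in> U' \<and> y \<in> V' \<and>
        (\<forall>x'\<in>U''. F x' y \<in> topspace X - W) \<and> (\<forall>y'\<in>V''. F x y' \<in> X closure_of W0)"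
      using xy by blast
  qed (use X Y F1 F2 W in \<open>auto intro: closedin_diff\<close>)
  then show False using W0 by blast
qed

section \<open>Countably compact semitopological groups\<close>

locale cc_semitopological_group = group G for G (structure) +
  fixes T :: "'a topology"
  assumes topspace_eq: "topspace T = carrier G"
    and regular: "regular_space T"
    and Hausdorff: "Hausdorff_space T"
    and countably_compact: "countably_compact_space T"
    and continuous_lmult: "a \<in> carrier G \<Longrightarrow> continuous_map T T (\<lambda>x. a \<otimes> x)"
    and continuous_rmult: "a \<in> carrier G \<Longrightarrow> continuous_map T T (\<lambda>x. x \<otimes> a)"
begin

lemma open_lmult: "openin T U \<Longrightarrow> a \<in> carrier G \<Longrightarrow> openin T {x \<in> carrier G. a \<otimes> x \<in> U}"
  using openin_continuous_map_preimage[OF continuous_lmult] by (simp add: topspace_eq)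

lemma open_rmult: "openin T U \<Longrightarrow> a \<in> carrier G \<Longrightarrow> openin T {x \<in> carrier G. x \<otimes> a \<in> U}"
  using openin_continuous_map_preimage[OF continuous_rmult] by (simp add: topspace_eq)

lemma open_carrier: "openin T U \<Longrightarrow> x \<in> U \<Longrightarrow> x \<in> carrier G"
  using openin_subset topspace_eq by blast

lemma inv_lmult_cancel: "a \<in> carrier G \<Longrightarrow> x \<in> carrier G \<Longrightarrow> inv a \<otimes> (a \<otimes> x) = x"
  by (simp add: m_assoc[symmetric])

lemma lmult_inv_cancel: "a \<in> carrier G \<Longrightarrow> x \<in> carrier G \<Longrightarrow> a \<otimes> (inv a \<otimes> x) = x"
  by (simp add: m_assoc[symmetric])

lemma mult_game:
  assumes A: "closedin T A" and B: "closedin T B"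
    and init: "openin T V0" "V0 \<noteq> {}"
    and step: "\<And>V. openin T V \<Longrightarrow> V \<noteq> {} \<Longrightarrow> \<exists>V' x y. openin T V' \<and> V' \<noteq> {} \<and> V' \<subseteq> V \<and> x \<in> V \<and> y \<in> V
                 \<and> (\<forall>z\<in>V'. inv x \<otimes> z \<in> A \<and> inv z \<otimes> y \<in> B)"
  shows "A \<inter> B \<noteq> {}"
proof (rule double_limit_game[of T T T "(\<otimes>)" A B "\<lambda>U V. openin T V \<and> V \<noteq> {} \<and> U = (\<lambda>x. inv x) ` V"])
  show "openin T V0 \<and> V0 \<noteq> {} \<and> (\<lambda>x. inv x) ` V0 = (\<lambda>x. inv x) ` V0"
    using init by simp
  show "U \<subseteq> topspace T \<and> V \<subseteq> topspace T" if "openin T V \<and> V \<noteq> {} \<and> U = (\<lambda>x. inv x) ` V" for U V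
    using that open_carrier by (auto simp: topspace_eq)
next
  fix U V
  assume UV: "openin T V \<and> V \<noteq> {} \<and> U = (\<lambda>x. inv x) ` V"
  then have V: "openin T V" "V \<noteq> {}" and U: "U = (\<lambda>x. inv x) ` V" by auto
  from step[OF V] obtain V' x y where *: "openin T V'" "V' \<noteq> {}" "V' \<subseteq> V" "x \<in> V" "y \<in> V"
     "\<forall>z\<in>V'. inv x \<otimes> z \<in> A \<and> inv z \<otimes> y \<in> B"
    by (elim exE conjE)
  show "\<exists>U' V' x y. (openin T V' \<and> V' \<noteq> {} \<and> U' = (\<lambda>x. inv x) ` V') \<and> U' \<subseteq> U \<and> V' \<subseteq> V
      \<and> x \<in> U \<and> y \<in> V \<and> (\<forall>x'\<in>U'. x' \<otimes> y \<in> B) \<and> (\<forall>y'\<in>V'. x \<otimes> y' \<in> A)"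
  proof (intro exI conjI)
    show "(\<lambda>x. inv x) ` V' \<subseteq> U" "inv x \<in> U" using * U by auto
    show "\<forall>x'\<in>(\<lambda>x. inv x) ` V'. x' \<otimes> y \<in> B" "\<forall>y'\<in>V'. inv x \<otimes> y' \<in> A" using * by auto
  qed (rule * refl)+
qed (simp_all add: A B countably_compact continuous_lmult continuous_rmult topspace_eq)

text \<open>If the elements with inverse in \<open>U\<close> were dense in no open part of
  \<open>N\<close>, each such part would contain an open \<open>D\<close> whose inverses all avoid
  \<open>U\<close>. Translates of such sets \<open>D\<close> are winning moves of the game:
  quotients are near the unit in one order and outside \<open>U\<close> in the other.\<close>

lemma inv_image_somewhere_dense:
  assumes U: "openin T U" "\<one> \<in> U" and N: "openin T N" "\<one> \<in> N"
  obtains P where "openin T P" "P \<noteq> {}" "P \<subseteq> N"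
    "\<And>D. openin T D \<Longrightarrow> D \<noteq> {} \<Longrightarrow> D \<subseteq> P \<Longrightarrow> \<exists>x\<in>D. inv x \<in> U"
proof (rule ccontr)
  assume "\<not> thesis"
  with that have neg: "\<And>P. openin T P \<Longrightarrow> P \<noteq> {} \<Longrightarrow> P \<subseteq> N \<Longrightarrow>
      \<exists>D. openin T D \<and> D \<noteq> {} \<and> D \<subseteq> P \<and> (\<forall>x\<in>D. inv x \<notin> U)"
    by metis
  obtain N1 where N1: "openin T N1" "\<one> \<in> N1" "T closure_of N1 \<subseteq> U"
    using regular_space_shrink[OF regular U] by metis
  define N0 where "N0 = N1 \<inter> N"
  have N0: "openin T N0" "\<one> \<in> N0" "N0 \<subseteq> N" "N0 \<subseteq> T closure_of N1"
    using N1 N openin_subset_closure_of[of T N1] by (auto simp: N0_def)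
  have "T closure_of N1 \<inter> (topspace T - U) \<noteq> {}"
  proof (rule mult_game[OF _ _ N0(1)])
    fix V assume V: "openin T V" "V \<noteq> {}"
    then obtain x where x: "x \<in> V" "x \<in> carrier G" using open_carrier by blast
    \<comment> \<open>The next move is the translate \<open>x \<otimes> D\<close>; taking
      \<open>D\<close> inside \<open>S\<close> keeps it in \<open>V\<close>. The same
      \<open>x\<close> serves on both sides, because for \<open>z\<close> in the translate
      \<open>inv z \<otimes> x\<close> is the inverse of
      \<open>inv x \<otimes> z \<in> D\<close>.\<close>
    define S where "S = {z \<in> carrier G. x \<otimes> z \<in> V} \<inter> N0"
    have "openin T S" "S \<noteq> {}" "S \<subseteq> N"
      using N0 x V open_lmult[OF V(1) x(2)] by (auto simp: S_def)
    then obtain D where D: "openin T D" "D \<noteq> {}" "D \<subseteq> S" "\<forall>x\<in>D. inv x \<notin> U"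
      using neg by metis
    then obtain d where d: "d \<in> D" "d \<in> carrier G" using open_carrier by blast
    let ?V = "{y \<in> carrier G. inv x \<otimes> y \<in> D}"
    have "x \<otimes> d \<in> ?V" using x d by (simp add: inv_lmult_cancel)
    moreover have "?V \<subseteq> V"
    proof
      fix y assume "y \<in> ?V"
      then have "x \<otimes> (inv x \<otimes> y) \<in> V" "y \<in> carrier G" using D by (auto simp: S_def)
      then show "y \<in> V" using x by (simp add: lmult_inv_cancel)
    qed
    moreover have "openin T ?V" using open_lmult D x by simp
    moreover have "inv x \<otimes> z \<in> T closure_of N1 \<and> inv z \<otimes> x \<in> topspace T - U" if "z \<in> ?V" for z
    proof -
      have "inv x \<otimes> z \<in> D" "z \<in> carrier G" using that by auto
      then show ?thesis
        using D(3,4) N0(4) x by (force simp: S_def topspace_eq inv_mult_group)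
    qed
    ultimately show "\<exists>V' x y. openin T V' \<and> V' \<noteq> {} \<and> V' \<subseteq> V \<and> x \<in> V \<and> y \<in> V
        \<and> (\<forall>z\<in>V'. inv x \<otimes> z \<in> T closure_of N1 \<and> inv z \<otimes> y \<in> topspace T - U)"
      using x by blast
  qed (use N0 U in auto)
  then show False using N1 by blast
qed

text \<open>Density is upgraded to a whole open set. An arbitrary \<open>q\<close> is compared with
  a nearby \<open>x\<close> whose inverse is under control, and the error is absorbed by the
  quasicontinuity of multiplication.\<close>

lemma inv_image_interior:
  assumes W: "openin T W" "\<one> \<in> W" and N: "openin T N" "\<one> \<in> N"
  obtains P where "openin T P" "P \<noteq> {}" "P \<subseteq> N" "\<And>x. x \<in> P \<Longrightarrow> inv x \<in> W"
proof -
  obtain U1 where U1: "openin T U1" "U1 \<noteq> {}" "U1 \<subseteq> W"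
    "\<And>D. openin T D \<Longrightarrow> D \<noteq> {} \<Longrightarrow> D \<subseteq> U1 \<Longrightarrow> \<exists>x\<in>D. inv x \<in> N"
    using inv_image_somewhere_dense[OF N W] by metis
  obtain U2 V where U2: "openin T U2" "U2 \<noteq> {}" "U2 \<subseteq> U1" and V: "openin T V" "\<one> \<in> V"
    and U2V: "\<And>x y. x \<in> U2 \<Longrightarrow> y \<in> V \<Longrightarrow> y \<otimes> x \<in> U1"
    by (rule separately_continuous_quasicontinuity[of T T "\<lambda>x y. y \<otimes> x" \<one> U1])
       (use countably_compact regular continuous_lmult continuous_rmult U1 in \<open>auto simp: topspace_eq\<close>)
  obtain u where u: "u \<in> U2" "inv u \<in> N" using U1(4) U2 by blast
  then have uc: "u \<in> carrier G" using U2 open_carrier by blast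
  define A where "A = {x \<in> carrier G. x \<otimes> u \<in> U2}"
  have A: "openin T A" "\<one> \<in> A" using open_rmult[OF U2(1) uc] u uc by (auto simp: A_def)
  define N2 where "N2 = {x \<in> carrier G. inv u \<otimes> x \<in> N}"
  have N2: "openin T N2" "\<one> \<in> N2" using open_lmult[OF N(1)] u uc by (auto simp: N2_def)
  obtain P2 where P2: "openin T P2" "P2 \<noteq> {}" "P2 \<subseteq> N2"
    "\<And>D. openin T D \<Longrightarrow> D \<noteq> {} \<Longrightarrow> D \<subseteq> P2 \<Longrightarrow> \<exists>x\<in>D. inv x \<in> A"
    using inv_image_somewhere_dense[OF A N2] by metis
  define P where "P = {q \<in> carrier G. u \<otimes> q \<in> P2}"
  show thesis
  proof
    show "openin T P" unfolding P_def using open_lmult[OF P2(1) uc] .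
    obtain p where "p \<in> P2" "p \<in> carrier G" using P2(1,2) open_carrier by blast
    then have "inv u \<otimes> p \<in> P" using uc by (simp add: P_def lmult_inv_cancel)
    then show "P \<noteq> {}" by blast
    show "P \<subseteq> N"
    proof
      fix q assume "q \<in> P"
      then have "q \<in> carrier G" "inv u \<otimes> (u \<otimes> q) \<in> N"
        using P2(3) by (auto simp: P_def N2_def)
      then show "q \<in> N" using uc by (simp add: inv_lmult_cancel)
    qed
    fix q assume q: "q \<in> P"
    then have qc: "q \<in> carrier G" and uq: "u \<otimes> q \<in> P2" by (auto simp: P_def)
    \<comment> \<open>An open neighbourhood of \<open>u \<otimes> q\<close>, so it contains some
      \<open>x\<close> with \<open>inv x \<in> A\<close>. Then \<open>inv q\<close> is the product
      of \<open>inv q \<otimes> inv u \<otimes> x \<in> V\<close> and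
      \<open>inv x \<otimes> u \<in> U2\<close>, hence lies in
      \<open>U1 \<subseteq> W\<close>.\<close>
    define D where "D = {x \<in> carrier G. (inv q \<otimes> inv u) \<otimes> x \<in> V} \<inter> P2"
    have "openin T D" unfolding D_def
      using open_lmult[OF V(1), of "inv q \<otimes> inv u"] P2(1) qc uc by auto
    moreover have "u \<otimes> q \<in> D"
      unfolding D_def using uq qc uc V(2) by (simp add: m_assoc inv_lmult_cancel)
    ultimately obtain x where x: "x \<in> D" "inv x \<in> A" using P2(4)[of D] unfolding D_def by blast
    then have xc: "x \<in> carrier G" and "inv x \<otimes> u \<in> U2" "(inv q \<otimes> inv u) \<otimes> x \<in> V"
      by (auto simp: D_def A_def)
    then have "((inv q \<otimes> inv u) \<otimes> x) \<otimes> (inv x \<otimes> u) \<in> W"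
      using U2V U1(3) by blast
    then show "inv q \<in> W"
      using xc uc qc by (simp add: m_assoc lmult_inv_cancel)
  qed
qed

text \<open>If every non-empty open set had a quotient outside \<open>W\<close>, fixing that
  quotient would win one half of the game. The other half is won by staying in a translate of the
  set \<open>Q\<close> of elements whose inverses are safely small; \<open>Q\<close> accumulates at
  the unit by \<open>inv_image_interior\<close>.\<close>

lemma open_small_division:
  assumes W: "openin T W" "\<one> \<in> W"
  obtains R where "openin T R" "R \<noteq> {}" "\<And>x y. x \<in> R \<Longrightarrow> y \<in> R \<Longrightarrow> inv x \<otimes> y \<in> W"
proof (rule ccontr)
  assume "\<not> thesis"
  with that have neg: "\<And>R. openin T R \<Longrightarrow> R \<noteq> {} \<Longrightarrow> \<exists>x\<in>R. \<exists>y\<in>R. inv x \<otimes> y \<notin> W"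
    by metis
  obtain W' where W': "openin T W'" "\<one> \<in> W'" "T closure_of W' \<subseteq> W"
    using regular_space_shrink[OF regular W] by metis
  obtain W0 where W0: "openin T W0" "\<one> \<in> W0" "T closure_of W0 \<subseteq> W'"
    using regular_space_shrink[OF regular W'(1,2)] by metis
  define Q where "Q = T interior_of {x \<in> carrier G. inv x \<in> W0}"
  have Q: "openin T Q" "\<And>x. x \<in> Q \<Longrightarrow> inv x \<in> W0"
    using interior_of_subset[of T "{x \<in> carrier G. inv x \<in> W0}"] by (auto simp: Q_def)
  have QN: "Q \<inter> N \<noteq> {}" if N: "openin T N" "\<one> \<in> N" for N
  proof -
    obtain P where P: "openin T P" "P \<noteq> {}" "P \<subseteq> N" "\<And>x. x \<in> P \<Longrightarrow> inv x \<in> W0"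
      using inv_image_interior[OF W0(1,2) N] by metis
    then have "P \<subseteq> Q"
      unfolding Q_def using open_carrier by (intro interior_of_maximal) auto
    then show ?thesis using P by blast
  qed
  have "(topspace T - W') \<inter> T closure_of W0 \<noteq> {}"
  proof (rule mult_game[OF _ _ W(1)])
    fix V assume V: "openin T V" "V \<noteq> {}"
    then obtain z where z: "z \<in> V" "z \<in> carrier G" using open_carrier by blast
    obtain q where q: "q \<in> Q" "q \<in> carrier G" "z \<otimes> q \<in> V"
      using QN[OF open_lmult[OF V(1) z(2)]] z by auto
    \<comment> \<open>Inside the translate \<open>z \<otimes> Q\<close> every \<open>y\<close>
      satisfies \<open>inv y \<otimes> z \<in> W0\<close>, so \<open>z\<close> serves as the second
      point. The bad quotient is then sought inside this smaller set.\<close>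
    define V1 where "V1 = V \<inter> {y \<in> carrier G. inv z \<otimes> y \<in> Q}"
    have "openin T V1" "V1 \<noteq> {}"
      using V open_lmult[OF Q(1)] z q inv_lmult_cancel[of z q] by (auto simp: V1_def)
    then obtain x b where x: "x \<in> V1" "b \<in> V1" "inv x \<otimes> b \<notin> W"
      using neg by metis
    have xc: "x \<in> carrier G" "b \<in> carrier G" using x by (auto simp: V1_def)
    define V2 where "V2 = V1 \<inter> {y \<in> carrier G. inv x \<otimes> y \<in> topspace T - T closure_of W'}"
    have "openin T V2"
      unfolding V2_def using \<open>openin T V1\<close> xc
      by (intro openin_Int open_lmult) auto
    moreover have "b \<in> V2"
      using x xc W' by (auto simp: V2_def topspace_eq)
    moreover have "inv x \<otimes> y \<in> topspace T - W' \<and> inv y \<otimes> z \<in> T closure_of W0" if "y \<in> V2" for y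
    proof -
      have "y \<in> carrier G" "inv z \<otimes> y \<in> Q" using that by (auto simp: V2_def V1_def)
      then have "inv y \<otimes> z \<in> W0" using Q(2)[of "inv z \<otimes> y"] z by (simp add: inv_mult_group)
      then show ?thesis
        using that openin_subset_closure_of[OF W0(1)] openin_subset_closure_of[OF W'(1)]
        by (auto simp: V2_def)
    qed
    ultimately show "\<exists>V' x y. openin T V' \<and> V' \<noteq> {} \<and> V' \<subseteq> V \<and> x \<in> V \<and> y \<in> V
        \<and> (\<forall>w\<in>V'. inv x \<otimes> w \<in> topspace T - W' \<and> inv w \<otimes> y \<in> T closure_of W0)"
      using x z by (intro exI[of _ V2] exI[of _ x] exI[of _ z]) (auto simp: V2_def V1_def)
  qed (use W' W in auto)
  then show False using W0 by blast
qed

text \<open>Write \<open>x \<otimes> y = inv u \<otimes> ((u \<otimes> x) \<otimes> y)\<close> with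
  \<open>u\<close> in a set \<open>U\<close> for which \<open>U \<otimes> V \<subseteq> R\<close>:
  both \<open>u\<close> and the bracket lie in \<open>R\<close>, and quotients of \<open>R\<close>
  lie in \<open>W\<close>.\<close>

lemma mult_continuous_at_one:
  assumes W: "openin T W" "\<one> \<in> W"
  obtains V where "openin T V" "\<one> \<in> V" "\<And>x y. x \<in> V \<Longrightarrow> y \<in> V \<Longrightarrow> x \<otimes> y \<in> W"
proof -
  obtain R where R: "openin T R" "R \<noteq> {}" "\<And>x y. x \<in> R \<Longrightarrow> y \<in> R \<Longrightarrow> inv x \<otimes> y \<in> W"
    using open_small_division[OF W] by metis
  obtain U V where U: "openin T U" "U \<noteq> {}" "U \<subseteq> R" and V: "openin T V" "\<one> \<in> V"
    and UV: "\<And>x y. x \<in> U \<Longrightarrow> y \<in> V \<Longrightarrow> x \<otimes> y \<in> R"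
    by (rule separately_continuous_quasicontinuity[of T T "\<lambda>x y. x \<otimes> y" \<one> R])
       (use countably_compact regular continuous_lmult continuous_rmult R in \<open>auto simp: topspace_eq\<close>)
  obtain u where u: "u \<in> U" "u \<in> carrier G" using U open_carrier by blast
  show thesis
  proof
    show "openin T ({x \<in> carrier G. u \<otimes> x \<in> U} \<inter> V)"
      using open_lmult[OF U(1) u(2)] V by blast
    show "\<one> \<in> {x \<in> carrier G. u \<otimes> x \<in> U} \<inter> V" using u V by simp
    fix x y assume "x \<in> {x \<in> carrier G. u \<otimes> x \<in> U} \<inter> V" "y \<in> {x \<in> carrier G. u \<otimes> x \<in> U} \<inter> V"
    then have xy: "x \<in> carrier G" "y \<in> carrier G" and "(u \<otimes> x) \<otimes> y \<in> R" using UV by auto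
    then have "inv u \<otimes> ((u \<otimes> x) \<otimes> y) \<in> W" using R(3) u U by blast
    then show "x \<otimes> y \<in> W" using xy u by (simp add: m_assoc inv_lmult_cancel)
  qed
qed

text \<open>The open set with small inverses is moved to the unit by one of its elements
  \<open>p\<close>: \<open>inv x = inv (p \<otimes> x) \<otimes> p\<close> is a product of two
  elements of \<open>V\<close>.\<close>

lemma inv_continuous_at_one:
  assumes U: "openin T U" "\<one> \<in> U"
  obtains V where "openin T V" "\<one> \<in> V" "\<And>x. x \<in> V \<Longrightarrow> inv x \<in> U"
proof -
  obtain V where V: "openin T V" "\<one> \<in> V" "\<And>x y. x \<in> V \<Longrightarrow> y \<in> V \<Longrightarrow> x \<otimes> y \<in> U"
    using mult_continuous_at_one[OF U] by metis
  obtain P where P: "openin T P" "P \<noteq> {}" "P \<subseteq> V" "\<And>x. x \<in> P \<Longrightarrow> inv x \<in> V"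
    using inv_image_interior[OF V(1,2) V(1,2)] by metis
  obtain p where p: "p \<in> P" "p \<in> carrier G" using P open_carrier by blast
  show thesis
  proof
    show "openin T {x \<in> carrier G. p \<otimes> x \<in> P}" using open_lmult[OF P(1) p(2)] .
    show "\<one> \<in> {x \<in> carrier G. p \<otimes> x \<in> P}" using p by simp
    fix x assume "x \<in> {x \<in> carrier G. p \<otimes> x \<in> P}"
    then have x: "x \<in> carrier G" "p \<otimes> x \<in> P" by auto
    then have "inv (p \<otimes> x) \<otimes> p \<in> U" using P V(3) p by blast
    then show "inv x \<in> U" using x p by (simp add: inv_mult_group m_assoc)
  qed
qed

theorem topological_group: "topological_group T G"
proof -
  have "openin (prod_topology T T) {p \<in> topspace (prod_topology T T). (case p of (x, y) \<Rightarrow> x \<otimes> y) \<in> W}"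
    if W: "openin T W" for W
    unfolding openin_prod_topology_alt
  proof (intro allI impI)
    fix a b assume "(a, b) \<in> {p \<in> topspace (prod_topology T T). (case p of (x, y) \<Rightarrow> x \<otimes> y) \<in> W}"
    then have ab: "a \<in> topspace T" "b \<in> topspace T" "a \<otimes> b \<in> W" by auto
    then have c: "a \<in> carrier G" "b \<in> carrier G" by (auto simp: topspace_eq)
    \<comment> \<open>The set \<open>W\<close> translated to the unit on both sides, which reduces
      continuity at \<open>(a, b)\<close> to continuity at the unit.\<close>
    let ?W = "{x \<in> carrier G. a \<otimes> x \<in> {z \<in> carrier G. z \<otimes> b \<in> W}}"
    have "openin T ?W" "\<one> \<in> ?W"
      using open_lmult[OF open_rmult[OF W c(2)] c(1)] c ab by auto
    then obtain V where V: "openin T V" "\<one> \<in> V" "\<And>x y. x \<in> V \<Longrightarrow> y \<in> V \<Longrightarrow> x \<otimes> y \<in> ?W"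
      by (rule mult_continuous_at_one) (use that in blast)
    have "openin T {x \<in> carrier G. inv a \<otimes> x \<in> V}" "openin T {x \<in> carrier G. x \<otimes> inv b \<in> V}"
      using open_lmult open_rmult V c by auto
    moreover have "x \<otimes> y \<in> W" if "x \<in> carrier G" "inv a \<otimes> x \<in> V" "y \<in> carrier G" "y \<otimes> inv b \<in> V" for x y
    proof -
      have "a \<otimes> ((inv a \<otimes> x) \<otimes> (y \<otimes> inv b)) \<otimes> b \<in> W"
        using V(3) that by blast
      then show ?thesis using that c by (simp add: m_assoc lmult_inv_cancel)
    qed
    ultimately show "\<exists>U V. openin T U \<and> openin T V \<and> a \<in> U \<and> b \<in> V \<and>
        U \<times> V \<subseteq> {p \<in> topspace (prod_topology T T). (case p of (x, y) \<Rightarrow> x \<otimes> y) \<in> W}"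
      using c V(2)
      by (intro exI[of _ "{x \<in> carrier G. inv a \<otimes> x \<in> V}"] exI[of _ "{x \<in> carrier G. x \<otimes> inv b \<in> V}"] conjI)
         (auto simp: topspace_eq)
  qed
  then have "continuous_map (prod_topology T T) T (\<lambda>(x, y). x \<otimes> y)"
    unfolding continuous_map_def by (auto simp: topspace_eq)
  moreover have "openin T {x \<in> topspace T. inv x \<in> W}" if W: "openin T W" for W
  proof (subst openin_subopen, clarify)
    fix a assume a: "a \<in> topspace T" "inv a \<in> W"
    then have c: "a \<in> carrier G" by (auto simp: topspace_eq)
    have "openin T {x \<in> carrier G. x \<otimes> inv a \<in> W}" "\<one> \<in> {x \<in> carrier G. x \<otimes> inv a \<in> W}"
      using open_rmult[OF W, of "inv a"] c a by auto
    then obtain V where V: "openin T V" "\<one> \<in> V" "\<And>x. x \<in> V \<Longrightarrow> inv x \<in> {x \<in> carrier G. x \<otimes> inv a \<in> W}"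
      by (rule inv_continuous_at_one) (use that in blast)
    have "inv x \<in> W" if "x \<in> carrier G" "inv a \<otimes> x \<in> V" for x
      using V(3)[OF that(2)] that(1) c by (simp add: inv_mult_group m_assoc)
    then show "\<exists>O'. openin T O' \<and> a \<in> O' \<and> O' \<subseteq> {x \<in> topspace T. inv x \<in> W}"
      using open_lmult[OF V(1), of "inv a"] c V(2)
      by (intro exI[of _ "{x \<in> carrier G. inv a \<otimes> x \<in> V}"]) (auto simp: topspace_eq)
  qed
  then have "continuous_map T T (\<lambda>x. inv x)"
    unfolding continuous_map_def by (auto simp: topspace_eq)
  ultimately show ?thesis
    unfolding topological_group_def using topspace_eq Hausdorff is_group by blast
qed

end

section \<open>Complete regularity and uniform continuity\<close>

context cc_semitopological_group
begin

lemma continuous_inv: "continuous_map T T (\<lambda>x. inv x)"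
  using topological_group by (simp add: topological_group_def)

lemma open_inv: "openin T U \<Longrightarrow> openin T {x \<in> carrier G. inv x \<in> U}"
  using openin_continuous_map_preimage[OF continuous_inv] by (simp add: topspace_eq)

lemma cluster_point:
  assumes "\<And>n. s n \<in> carrier G"
  shows "\<exists>x\<in>carrier G. \<forall>U. openin T U \<longrightarrow> x \<in> U \<longrightarrow> infinite {n::nat. s n \<in> U}"
  using countably_compact_cluster_point[OF countably_compact, of s] assms by (simp add: topspace_eq)

lemma symmetric_nbhd:
  assumes "openin T U" "\<one> \<in> U"
  obtains V where "openin T V" "\<one> \<in> V" "V \<subseteq> U" "\<And>x. x \<in> V \<Longrightarrow> inv x \<in> V"
    "\<And>x y. x \<in> V \<Longrightarrow> y \<in> V \<Longrightarrow> x \<otimes> y \<in> U"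
proof -
  obtain W where W: "openin T W" "\<one> \<in> W" "\<And>x y. x \<in> W \<Longrightarrow> y \<in> W \<Longrightarrow> x \<otimes> y \<in> U"
    using mult_continuous_at_one[OF assms] by metis
  let ?V = "W \<inter> {x \<in> carrier G. inv x \<in> W}"
  show thesis
  proof (rule that[of ?V])
    show "openin T ?V" "\<one> \<in> ?V" using W open_inv by auto
    show "?V \<subseteq> U"
    proof
      fix x assume "x \<in> ?V"
      then show "x \<in> U" using W(3)[of x \<one>] W(2) by auto
    qed
  qed (use W in auto)
qed

text \<open>Countable compactness forces precompactness: otherwise a sequence has all quotients
  \<open>s n \<otimes> inv (s k)\<close> with \<open>k < n\<close> outside \<open>U\<close>,
  although two of its terms lie in a common small coset around a cluster point.\<close>

lemma left_translates_cover:
  assumes U: "openin T U" "\<one> \<in> U"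
  obtains F where "finite F" "F \<subseteq> carrier G" "\<And>x. x \<in> carrier G \<Longrightarrow> \<exists>f\<in>F. x \<otimes> inv f \<in> U"
proof (rule ccontr)
  assume "\<not> thesis"
  with that have neg: "\<And>F. finite F \<Longrightarrow> F \<subseteq> carrier G \<Longrightarrow> \<exists>x\<in>carrier G. \<forall>f\<in>F. x \<otimes> inv f \<notin> U"
    by metis
  have "\<exists>s. \<forall>n::nat. s n \<in> carrier G \<and> (\<forall>k<n. s n \<otimes> inv (s k) \<notin> U)"
  proof (rule dependent_wellorder_choice[of "\<lambda>s n r. r \<in> carrier G \<and> (\<forall>k<n. r \<otimes> inv (s k) \<notin> U)"])
    fix n :: nat and s assume "\<And>y. y < n \<Longrightarrow> s y \<in> carrier G \<and> (\<forall>k<y. s y \<otimes> inv (s k) \<notin> U)"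
    then have "finite (s ` {..<n})" "s ` {..<n} \<subseteq> carrier G" by auto
    from neg[OF this] show "\<exists>r. r \<in> carrier G \<and> (\<forall>k<n. r \<otimes> inv (s k) \<notin> U)"
      by auto
  qed auto
  then obtain s where s: "\<forall>n::nat. s n \<in> carrier G \<and> (\<forall>k<n. s n \<otimes> inv (s k) \<notin> U)" ..
  then have sc: "s n \<in> carrier G" for n by blast
  obtain x where x: "x \<in> carrier G" and cl: "\<And>U. openin T U \<Longrightarrow> x \<in> U \<Longrightarrow> infinite {n::nat. s n \<in> U}"
    using cluster_point[of s, OF sc] by blast
  obtain V where V: "openin T V" "\<one> \<in> V" "\<And>x. x \<in> V \<Longrightarrow> inv x \<in> V"
    "\<And>x y. x \<in> V \<Longrightarrow> y \<in> V \<Longrightarrow> x \<otimes> y \<in> U"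
    using symmetric_nbhd[OF U] by metis
  let ?N = "{y \<in> carrier G. y \<otimes> inv x \<in> V}"
  have inf: "infinite {n. s n \<in> ?N}"
    using cl[of ?N] open_rmult[OF V(1)] x V(2) by auto
  then obtain k where k: "k \<in> {n. s n \<in> ?N}" by (rule infinite_natset_gt)
  from inf obtain n where n: "n \<in> {n. s n \<in> ?N}" "k < n" by (rule infinite_natset_gt)
  have "(s n \<otimes> inv x) \<otimes> inv (s k \<otimes> inv x) \<in> U"
    using V k n by auto
  then have "s n \<otimes> inv (s k) \<in> U"
    using x sc by (simp add: inv_mult_group m_assoc inv_lmult_cancel)
  then show False using s n by blast
qed

lemma nbhd_sequence:
  assumes U: "openin T U" "\<one> \<in> U"
  obtains V :: "nat \<Rightarrow> 'a set" where "V 0 \<subseteq> U" "\<And>n. openin T (V n)" "\<And>n. \<one> \<in> V n"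
    "\<And>n x. x \<in> V n \<Longrightarrow> inv x \<in> V n"
    "\<And>n x y. x \<in> V (Suc n) \<Longrightarrow> y \<in> V (Suc n) \<Longrightarrow> x \<otimes> y \<in> V n"
proof -
  define P where "P V \<longleftrightarrow> openin T V \<and> \<one> \<in> V \<and> V \<subseteq> U \<and> (\<forall>x\<in>V. inv x \<in> V)" for V
  have "\<exists>V. \<forall>n::nat. P (V n) \<and> (\<forall>x\<in>V (Suc n). \<forall>y\<in>V (Suc n). x \<otimes> y \<in> V n)"
  proof (rule dependent_nat_choice)
    obtain V where "openin T V" "\<one> \<in> V" "V \<subseteq> U" "\<And>x. x \<in> V \<Longrightarrow> inv x \<in> V"
      using symmetric_nbhd[OF U] by metis
    then show "\<exists>V. P V" unfolding P_def by blast
  next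
    fix W assume W: "P W"
    obtain V where V: "openin T V" "\<one> \<in> V" "V \<subseteq> W" "\<And>x. x \<in> V \<Longrightarrow> inv x \<in> V"
      "\<And>x y. x \<in> V \<Longrightarrow> y \<in> V \<Longrightarrow> x \<otimes> y \<in> W"
      using symmetric_nbhd[of W] W unfolding P_def by metis
    have "P V" using W V(1,2,3,4) unfolding P_def by (simp add: subset_trans[OF V(3)])
    then show "\<exists>V. P V \<and> (\<forall>x\<in>V. \<forall>y\<in>V. x \<otimes> y \<in> W)" using V(5) by (intro exI[of _ V]) simp
  qed
  then obtain V where "\<forall>n::nat. P (V n) \<and> (\<forall>x\<in>V (Suc n). \<forall>y\<in>V (Suc n). x \<otimes> y \<in> V n)" ..
  then show thesis using that[of V] unfolding P_def by simp
qed

end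

text \<open>The right cosets \<open>V n \<otimes> x\<close> generate a coarser topology, which is regular and
  Lindelof, hence normal.\<close>

locale cc_group_nbhd_sequence = cc_semitopological_group +
  fixes V :: "nat \<Rightarrow> 'a set"
  assumes V_open: "openin T (V n)" and V_one: "\<one> \<in> V n"
    and V_inv: "x \<in> V n \<Longrightarrow> inv x \<in> V n"
    and V_mult: "x \<in> V (Suc n) \<Longrightarrow> y \<in> V (Suc n) \<Longrightarrow> x \<otimes> y \<in> V n"
begin

definition B :: "nat \<Rightarrow> 'a \<Rightarrow> 'a set" where
  "B n x = {y \<in> carrier G. y \<otimes> inv x \<in> V n}"

text \<open>The sets \<open>B n x\<close> act as balls, but they need not be open here, only
  neighbourhoods of their centres. The topology need not be Hausdorff, since the intersection of all
  \<open>V n\<close> may be non-trivial.\<close>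

definition coset_topology :: "'a topology" where
  "coset_topology = topology (\<lambda>S. S \<subseteq> carrier G \<and> (\<forall>x\<in>S. \<exists>n. B n x \<subseteq> S))"

lemma V_Suc: "V (Suc n) \<subseteq> V n"
proof
  fix x assume x: "x \<in> V (Suc n)"
  then have "x \<otimes> \<one> \<in> V n" by (rule V_mult[OF _ V_one])
  then show "x \<in> V n" using open_carrier[OF V_open x] by simp
qed

lemma V_mono: "m \<le> n \<Longrightarrow> V n \<subseteq> V m"
  by (rule lift_Suc_antimono_le[of V]) (rule V_Suc)

lemma B_mono: "m \<le> n \<Longrightarrow> B n x \<subseteq> B m x"
  using V_mono by (auto simp: B_def)

lemma B_self: "x \<in> carrier G \<Longrightarrow> x \<in> B n x"
  by (simp add: B_def V_one)

lemma B_sym: "x \<in> carrier G \<Longrightarrow> y \<in> B n x \<Longrightarrow> x \<in> B n y"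
  using V_inv[of "y \<otimes> inv x" n] by (auto simp: B_def inv_mult_group)

lemma B_trans: "x \<in> carrier G \<Longrightarrow> y \<in> B (Suc n) x \<Longrightarrow> z \<in> B (Suc n) y \<Longrightarrow> z \<in> B n x"
  using V_mult[of "z \<otimes> inv y" n "y \<otimes> inv x"]
  by (auto simp: B_def m_assoc inv_lmult_cancel)

lemma istopology_coset: "istopology (\<lambda>S. S \<subseteq> carrier G \<and> (\<forall>x\<in>S. \<exists>n. B n x \<subseteq> S))"
  unfolding istopology_def
proof (intro conjI allI impI ballI)
  fix S S' x
  assume "S \<subseteq> carrier G \<and> (\<forall>x\<in>S. \<exists>n. B n x \<subseteq> S)" "S' \<subseteq> carrier G \<and> (\<forall>x\<in>S'. \<exists>n. B n x \<subseteq> S')" "x \<in> S \<inter> S'"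
  then obtain n n' where "B n x \<subseteq> S" "B n' x \<subseteq> S'" by blast
  then have "B (max n n') x \<subseteq> S \<inter> S'"
    using B_mono[of n "max n n'" x] B_mono[of n' "max n n'" x] by auto
  then show "\<exists>n. B n x \<subseteq> S \<inter> S'" ..
next
  fix \<K> x assume "\<forall>K\<in>\<K>. K \<subseteq> carrier G \<and> (\<forall>x\<in>K. \<exists>n. B n x \<subseteq> K)" "x \<in> \<Union>\<K>"
  then obtain K n where "K \<in> \<K>" "B n x \<subseteq> K" by blast
  then show "\<exists>n. B n x \<subseteq> \<Union>\<K>" by blast
qed auto

lemma openin_coset_topology:
  "openin coset_topology S \<longleftrightarrow> S \<subseteq> carrier G \<and> (\<forall>x\<in>S. \<exists>n. B n x \<subseteq> S)"
  unfolding coset_topology_def using topology_inverse'[OF istopology_coset] by simp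

lemma openin_coset_topologyD:
  assumes "openin coset_topology S" "x \<in> S"
  obtains n where "x \<in> carrier G" "B n x \<subseteq> S"
  using assms unfolding openin_coset_topology by blast

lemma topspace_coset_topology: "topspace coset_topology = carrier G"
proof
  show "topspace coset_topology \<subseteq> carrier G"
    using openin_topspace[of coset_topology] unfolding openin_coset_topology by (rule conjunct1)
  have "openin coset_topology (carrier G)"
    by (auto simp: openin_coset_topology B_def)
  then show "carrier G \<subseteq> topspace coset_topology" by (rule openin_subset)
qed

lemma coset_topology_coarser: "openin coset_topology S \<Longrightarrow> openin T S"
proof (subst openin_subopen, clarify)
  fix x assume S: "openin coset_topology S" and x: "x \<in> S"
  from openin_coset_topologyD[OF this] obtain n where n: "x \<in> carrier G" "B n x \<subseteq> S" .
  then show "\<exists>O'. openin T O' \<and> x \<in> O' \<and> O' \<subseteq> S"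
    using B_self[of x n] open_rmult[OF V_open[of n], of "inv x"]
    by (intro exI[of _ "B n x"]) (auto simp: B_def)
qed

text \<open>The open set is the interior of the ball, namely the points around which some ball still
  fits. It is open because a ball of half the size, with index \<open>Suc m\<close>, around such a
  point consists of such points.\<close>

lemma open_nbhd_in_B:
  assumes "x \<in> carrier G"
  obtains W where "openin coset_topology W" "x \<in> W" "W \<subseteq> B n x"
proof
  let ?W = "{y \<in> carrier G. \<exists>m. B m y \<subseteq> B n x}"
  show "openin coset_topology ?W"
    unfolding openin_coset_topology
  proof (intro conjI ballI)
    fix y assume "y \<in> ?W"
    then obtain m where y: "y \<in> carrier G" "B m y \<subseteq> B n x" by blast
    have "B (Suc m) y \<subseteq> ?W"
    proof
      fix z assume z: "z \<in> B (Suc m) y"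
      then have "B (Suc m) z \<subseteq> B n x" using B_trans[OF y(1) z] y(2) by blast
      then show "z \<in> ?W" using z by (auto simp: B_def)
    qed
    then show "\<exists>m. B m y \<subseteq> ?W" ..
  qed auto
  show "x \<in> ?W" using assms by auto
  show "?W \<subseteq> B n x" using B_self by blast
qed

lemma regular_coset_topology: "regular_space coset_topology"
  unfolding neighbourhood_base_of_closedin[symmetric] neighbourhood_base_of
proof (intro allI impI)
  fix W x assume "openin coset_topology W \<and> x \<in> W"
  then have "openin coset_topology W" "x \<in> W" by auto
  from openin_coset_topologyD[OF this] obtain n where x: "x \<in> carrier G" and n: "B n x \<subseteq> W" .
  obtain O' where O': "openin coset_topology O'" "x \<in> O'" "O' \<subseteq> B (Suc n) x"
    by (rule open_nbhd_in_B[OF x, of "Suc n"])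
  \<comment> \<open>The closure of the ball with index \<open>Suc n\<close>; the halving condition
    on the \<open>V n\<close> keeps it inside the ball with index \<open>n\<close>.\<close>
  let ?C = "{y \<in> carrier G. \<forall>m. B m y \<inter> B (Suc n) x \<noteq> {}}"
  have "openin coset_topology (carrier G - ?C)"
    unfolding openin_coset_topology
  proof (intro conjI ballI)
    fix y assume "y \<in> carrier G - ?C"
    then obtain m where y: "y \<in> carrier G" "B m y \<inter> B (Suc n) x = {}" by blast
    have "B (Suc m) y \<subseteq> carrier G - ?C"
    proof
      fix z assume z: "z \<in> B (Suc m) y"
      then have "B (Suc m) z \<inter> B (Suc n) x = {}" using B_trans[OF y(1) z] y(2) by blast
      then show "z \<in> carrier G - ?C" using z by (auto simp: B_def)
    qed
    then show "\<exists>m. B m y \<subseteq> carrier G - ?C" ..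
  qed auto
  then have "closedin coset_topology ?C"
    unfolding closedin_def topspace_coset_topology by auto
  moreover have "?C \<subseteq> W"
  proof
    fix y assume "y \<in> ?C"
    then obtain w where w: "y \<in> carrier G" "w \<in> B (Suc n) y" "w \<in> B (Suc n) x" by blast
    then show "y \<in> W" using B_trans[OF x w(3)] B_sym[OF w(1,2)] n by blast
  qed
  moreover have "O' \<subseteq> ?C"
  proof
    fix y assume "y \<in> O'"
    then have "y \<in> carrier G" "y \<in> B (Suc n) x"
      using O' by (auto simp: openin_coset_topology)
    then show "y \<in> ?C" using B_self by blast
  qed
  ultimately show "\<exists>U V. openin coset_topology U \<and> closedin coset_topology V \<and> x \<in> U \<and> U \<subseteq> V \<and> V \<subseteq> W"
    using O' by blast
qed

text \<open>Precompactness supplies a finite net \<open>F n\<close> for every \<open>n\<close>. The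
  countably many balls around net points that fit into some member of the cover already cover the
  space.\<close>

lemma Lindelof_coset_topology: "Lindelof_space coset_topology"
  unfolding Lindelof_space_def
proof (intro allI impI)
  fix \<U> assume \<U>: "(\<forall>U\<in>\<U>. openin coset_topology U) \<and> \<Union>\<U> = topspace coset_topology"
  have "\<exists>F. finite F \<and> F \<subseteq> carrier G \<and> (\<forall>x\<in>carrier G. \<exists>f\<in>F. x \<otimes> inv f \<in> V n)" for n
    using left_translates_cover[OF V_open V_one, of n] by metis
  then obtain F where F: "\<And>n. finite (F n)" "\<And>n. F n \<subseteq> carrier G"
      "\<And>n x. x \<in> carrier G \<Longrightarrow> \<exists>f\<in>F n. x \<otimes> inv f \<in> V n"
    by metis
  define I where "I = {(n, f). f \<in> F n \<and> (\<exists>U\<in>\<U>. B n f \<subseteq> U)}"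
  have "\<exists>c. \<forall>i\<in>I. c i \<in> \<U> \<and> B (fst i) (snd i) \<subseteq> c i"
    by (rule bchoice) (auto simp: I_def)
  then obtain c where c: "\<And>i. i \<in> I \<Longrightarrow> c i \<in> \<U>" "\<And>i. i \<in> I \<Longrightarrow> B (fst i) (snd i) \<subseteq> c i" by blast
  have "countable (Sigma UNIV F)"
    using F(1) by (simp add: countable_finite)
  moreover have "I \<subseteq> Sigma UNIV F" by (auto simp: I_def)
  ultimately have "countable (c ` I)" using countable_subset by blast
  moreover have "\<Union>(c ` I) = topspace coset_topology"
  proof
    show "\<Union>(c ` I) \<subseteq> topspace coset_topology" using c(1) \<U> by blast
    show "topspace coset_topology \<subseteq> \<Union>(c ` I)"
    proof
      fix x assume x: "x \<in> topspace coset_topology"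
      then obtain U where U: "U \<in> \<U>" "x \<in> U" using \<U> by blast
      from \<U> U(1) have "openin coset_topology U" by blast
      from openin_coset_topologyD[OF this U(2)] obtain n where n: "B n x \<subseteq> U" .
      have xc: "x \<in> carrier G" using x by (simp add: topspace_coset_topology)
      obtain f where f: "f \<in> F (Suc n)" "x \<otimes> inv f \<in> V (Suc n)" using F(3) xc by blast
      have fc: "f \<in> carrier G" and xf: "x \<in> B (Suc n) f" using f F(2) xc by (auto simp: B_def)
      \<comment> \<open>The ball of index \<open>n\<close> around \<open>x\<close> fits into
        \<open>U\<close>, but a ball around the net point \<open>f\<close> is what must fit; taking
        the net one index further makes room for the change of centre.\<close>
      have "B (Suc n) f \<subseteq> U"
        using B_trans[OF xc B_sym[OF fc xf]] n by blast
      then have "(Suc n, f) \<in> I" using f U by (auto simp: I_def)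
      then show "x \<in> \<Union>(c ` I)" using c(2)[of "(Suc n, f)"] xf by auto
    qed
  qed
  ultimately show "\<exists>\<V>. countable \<V> \<and> \<V> \<subseteq> \<U> \<and> \<Union>\<V> = topspace coset_topology"
    using c(1) by (intro exI[of _ "c ` I"]) auto
qed

lemma completely_regular_coset_topology: "completely_regular_space coset_topology"
  by (simp add: Lindelof_coset_topology normal_imp_completely_regular_space_gen regular_Lindelof_imp_normal_space
      regular_coset_topology)

end

section \<open>Complete regularity of the group and uniform continuity of real functions\<close>

context cc_semitopological_group
begin

text \<open>Separating one point from one closed set involves only a sequence of neighbourhoods of
  the unit. The separating function is found in the coarser coset topology and stays continuous in
  the finer topology \<open>T\<close>.\<close>

lemma completely_regular: "completely_regular_space T"
  unfolding completely_regular_space_def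
proof (intro allI impI, elim conjE)
  fix S x assume S: "closedin T S" and "x \<in> topspace T - S"
  then have x: "x \<in> carrier G" "x \<notin> S" by (auto simp: topspace_eq)
  let ?U = "{y \<in> carrier G. y \<otimes> x \<in> topspace T - S}"
  have U: "openin T ?U" "\<one> \<in> ?U"
    using open_rmult[OF openin_diff[OF openin_topspace S] x(1)] x by (auto simp: topspace_eq)
  obtain V :: "nat \<Rightarrow> 'a set" where V: "V 0 \<subseteq> ?U" "\<And>n. openin T (V n)" "\<And>n. \<one> \<in> V n"
    "\<And>n x. x \<in> V n \<Longrightarrow> inv x \<in> V n"
    "\<And>n x y. x \<in> V (Suc n) \<Longrightarrow> y \<in> V (Suc n) \<Longrightarrow> x \<otimes> y \<in> V n"
    by (rule nbhd_sequence[OF U]) (use that in blast)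
  interpret N: cc_group_nbhd_sequence G T V
    by unfold_locales (fact V(2-5))+
  obtain W where W: "openin N.coset_topology W" "x \<in> W" "W \<subseteq> N.B 0 x"
    by (rule N.open_nbhd_in_B[OF x(1)])
  have SW: "S \<inter> W = {}"
  proof -
    have False if "y \<in> S" "y \<in> W" for y
    proof -
      have "y \<in> carrier G" "y \<otimes> inv x \<otimes> x \<in> topspace T - S"
        using that W(3) V(1) by (auto simp: N.B_def)
      then show False using that x by (simp add: m_assoc)
    qed
    then show ?thesis by blast
  qed
  have cl: "closedin N.coset_topology (carrier G - W)"
    using W(1) by (metis N.topspace_coset_topology openin_closedin_eq)
  then have "\<exists>f :: 'a \<Rightarrow> real. continuous_map N.coset_topology (top_of_set {0..1}) f \<and> f x = 0 \<and>
      f ` (carrier G - W) \<subseteq> {1}"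
    using N.completely_regular_coset_topology[unfolded completely_regular_space_def, rule_format, of "carrier G - W" x]
      x(1) W(2) by (simp add: N.topspace_coset_topology)
  then obtain f :: "'a \<Rightarrow> real" where f: "continuous_map N.coset_topology (top_of_set {0..1}) f" "f x = 0"
      "f ` (carrier G - W) \<subseteq> {1}"
    by (elim exE conjE)
  have "continuous_map T (top_of_set {0..1}) f"
    unfolding continuous_map_def
  proof (intro conjI allI impI)
    show "f \<in> topspace T \<rightarrow> topspace (top_of_set {0..1})"
      using f(1) by (simp add: continuous_map_def N.topspace_coset_topology topspace_eq)
    fix U :: "real set" assume "openin (top_of_set {0..1}) U"
    then have "openin N.coset_topology {x \<in> carrier G. f x \<in> U}"
      using f(1) by (simp add: continuous_map_def N.topspace_coset_topology)
    then show "openin T {x \<in> topspace T. f x \<in> U}"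
      unfolding topspace_eq by (rule N.coset_topology_coarser)
  qed
  moreover have "f ` S \<subseteq> {1}"
    using f(3) SW closedin_subset[OF S] topspace_eq by blast
  ultimately show "\<exists>f. continuous_map T (top_of_set {0..1}) f \<and> f x = (0::real) \<and> f ` S \<subseteq> {1}"
    using f(2) by blast
qed

text \<open>From a failure one obtains points \<open>x n\<close> and
  \<open>v n \<otimes> x n\<close> with \<open>v n\<close> in shrinking \<open>V n\<close> and
  values \<open>\<epsilon>\<close> apart. Their cluster points \<open>y\<close> and \<open>z\<close>
  need not agree, but \<open>z = n \<otimes> w \<otimes> y\<close> with \<open>w\<close> small and
  \<open>n\<close> in all \<open>V j\<close>; the contradiction comes from \<open>f\<close> being
  nearly unchanged by \<open>inv n\<close> at the points \<open>v n \<otimes> x n\<close>.\<close>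

lemma uniformly_continuous:
  fixes f :: "'a \<Rightarrow> real"
  assumes f: "continuous_map T euclideanreal f" and "\<epsilon> > 0"
  shows "\<exists>V. openin T V \<and> \<one> \<in> V \<and> (\<forall>v\<in>V. \<forall>x\<in>carrier G. \<bar>f (v \<otimes> x) - f x\<bar> < \<epsilon>)"
proof (rule ccontr)
  assume "\<not> ?thesis"
  then have neg: "\<exists>v\<in>V. \<exists>x\<in>carrier G. \<bar>f (v \<otimes> x) - f x\<bar> \<ge> \<epsilon>" if "openin T V" "\<one> \<in> V" for V
    using that by (meson not_less)
  have near: "openin T {z \<in> carrier G. \<bar>f z - f c\<bar> < \<epsilon> / 4}" for c
  proof -
    have "openin T {z \<in> topspace T. f z \<in> ball (f c) (\<epsilon> / 4)}"
      by (intro openin_continuous_map_preimage[OF f]) simp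
    then show ?thesis by (simp add: topspace_eq dist_real_def abs_minus_commute)
  qed
  define P where "P = (\<lambda>(V, v, x). openin T V \<and> \<one> \<in> V \<and> (\<forall>w\<in>V. inv w \<in> V) \<and> v \<in> V \<and> x \<in> carrier G
      \<and> \<bar>f (v \<otimes> x) - f x\<bar> \<ge> \<epsilon>)"
  \<comment> \<open>The second clause makes \<open>f\<close> nearly invariant, at the point just
    chosen, under all later neighbourhoods and hence under their intersection.\<close>
  define Q where "Q = (\<lambda>(V, v, x) (V', v' :: 'a, x' :: 'a). (\<forall>a\<in>V'. \<forall>b\<in>V'. a \<otimes> b \<in> V) \<and>
      (\<forall>w\<in>V'. \<bar>f (w \<otimes> (v \<otimes> x)) - f (v \<otimes> x)\<bar> < \<epsilon> / 4))"
  have start: "\<exists>s. P s \<and> fst s \<subseteq> U \<and> (\<forall>a\<in>fst s. \<forall>b\<in>fst s. a \<otimes> b \<in> U)" if U: "openin T U" "\<one> \<in> U" for U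
  proof -
    obtain V where V: "openin T V" "\<one> \<in> V" "V \<subseteq> U" "\<And>x. x \<in> V \<Longrightarrow> inv x \<in> V"
      "\<And>x y. x \<in> V \<Longrightarrow> y \<in> V \<Longrightarrow> x \<otimes> y \<in> U"
      using symmetric_nbhd[OF U] by metis
    obtain v x where "v \<in> V" "x \<in> carrier G" "\<bar>f (v \<otimes> x) - f x\<bar> \<ge> \<epsilon>"
      using neg[OF V(1,2)] by blast
    then show ?thesis
      using V by (intro exI[of _ "(V, v, x)"]) (simp add: P_def)
  qed
  have "\<exists>s. \<forall>n::nat. P (s n) \<and> Q (s n) (s (Suc n))"
  proof (rule dependent_nat_choice)
    show "\<exists>s. P s" using start[OF openin_topspace] by (auto simp: topspace_eq)
  next
    fix s :: "'a set \<times> 'a \<times> 'a" and n :: nat assume P: "P s"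
    obtain V v x where s: "s = (V, v, x)" by (cases s)
    have V: "openin T V" "\<one> \<in> V" and vx: "v \<otimes> x \<in> carrier G"
      using P open_carrier by (auto simp: P_def s)
    let ?U = "V \<inter> {w \<in> carrier G. w \<otimes> (v \<otimes> x) \<in> {z \<in> carrier G. \<bar>f z - f (v \<otimes> x)\<bar> < \<epsilon> / 4}}"
    have "openin T ?U" "\<one> \<in> ?U"
      using V vx open_rmult[OF near vx] \<open>\<epsilon> > 0\<close> by auto
    then obtain s' where "P s'" "fst s' \<subseteq> ?U" "\<forall>a\<in>fst s'. \<forall>b\<in>fst s'. a \<otimes> b \<in> ?U"
      using start by blast
    then show "\<exists>s'. P s' \<and> Q s s'"
      by (intro exI[of _ s']) (auto simp: Q_def s split: prod.splits)
  qed
  then obtain s where s: "\<forall>n::nat. P (s n) \<and> Q (s n) (s (Suc n))" ..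
  define V where "V n = fst (s n)" for n
  define v where "v n = fst (snd (s n))" for n
  define x where "x n = snd (snd (s n))" for n
  have sn: "s n = (V n, v n, x n)" for n by (simp add: V_def v_def x_def)
  have Pn: "openin T (V n)" "\<one> \<in> V n" "w \<in> V n \<Longrightarrow> inv w \<in> V n" "v n \<in> V n" "x n \<in> carrier G"
      "\<bar>f (v n \<otimes> x n) - f (x n)\<bar> \<ge> \<epsilon>" for n w
    using s[rule_format, of n] by (auto simp: sn P_def)
  have Qn: "a \<in> V (Suc n) \<Longrightarrow> b \<in> V (Suc n) \<Longrightarrow> a \<otimes> b \<in> V n"
      "w \<in> V (Suc n) \<Longrightarrow> \<bar>f (w \<otimes> (v n \<otimes> x n)) - f (v n \<otimes> x n)\<bar> < \<epsilon> / 4" for n a b w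
    using s[rule_format, of n] by (auto simp: sn Q_def)
  interpret N: cc_group_nbhd_sequence G T V
    by unfold_locales (fact Pn(1-3) Qn(1))+
  have Vc: "w \<in> V n \<Longrightarrow> w \<in> carrier G" for w n using open_carrier[OF Pn(1)] .
  have vc: "v n \<in> carrier G" for n using Vc[OF Pn(4)] .
  obtain y where y: "y \<in> carrier G" and ycl: "\<And>U. openin T U \<Longrightarrow> y \<in> U \<Longrightarrow> infinite {n. x n \<in> U}"
    using cluster_point[of x, OF Pn(5)] by blast
  define U where "U = {u \<in> carrier G. u \<otimes> y \<in> {z \<in> carrier G. \<bar>f z - f y\<bar> < \<epsilon> / 4}}"
  have U: "openin T U" "\<one> \<in> U"
    using open_rmult[OF near y] y \<open>\<epsilon> > 0\<close> by (auto simp: U_def)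
  obtain U' where U': "openin T U'" "\<one> \<in> U'" "T closure_of U' \<subseteq> U"
    using regular_space_shrink[OF regular U] by metis
  have U'U: "U' \<subseteq> U" using openin_subset_closure_of[OF U'(1)] U'(3) by blast
  define J where "J = {n. x n \<in> {z \<in> carrier G. z \<otimes> inv y \<in> U'}}"
  have J: "infinite J"
    unfolding J_def using U'(2) y by (intro ycl open_rmult U'(1)) auto
  define r where "r = enumerate J"
  have rJ: "r k \<in> J" for k unfolding r_def using enumerate_in_set[OF J] .
  have rge: "k \<le> r k" for k
    unfolding r_def using strict_mono_enumerate[OF J] strict_mono_imp_increasing by blast
  have zc: "v (r k) \<otimes> x (r k) \<in> carrier G" for k using vc Pn(5) by simp
  obtain z where z: "z \<in> carrier G"
    and zcl: "\<And>O'. openin T O' \<Longrightarrow> z \<in> O' \<Longrightarrow> infinite {k. v (r k) \<otimes> x (r k) \<in> O'}"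
    using cluster_point[of "\<lambda>k. v (r k) \<otimes> x (r k)", OF zc] by blast
  define g where "g = z \<otimes> inv y"
  have gc: "g \<in> carrier G" using z y by (simp add: g_def)
  \<comment> \<open>Up to \<open>V j\<close> the element \<open>g\<close> agrees with
    \<open>x (r k) \<otimes> inv y\<close> for a late \<open>k\<close>: first \<open>z\<close> is
    replaced by \<open>v (r k) \<otimes> x (r k)\<close>, then the factor \<open>v (r k)\<close> is
    dropped. Each replacement costs an element of \<open>V (Suc j)\<close>.\<close>
  have "\<exists>u\<in>U'. g \<otimes> inv u \<in> V j" for j
  proof -
    have "openin T (N.B (Suc j) z)"
      unfolding N.B_def using z by (intro open_rmult Pn(1)) auto
    then have "infinite {k. v (r k) \<otimes> x (r k) \<in> N.B (Suc j) z}"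
      using zcl N.B_self[OF z] by blast
    then obtain k where k: "k \<in> {k. v (r k) \<otimes> x (r k) \<in> N.B (Suc j) z}" "j < k"
      by (rule infinite_natset_gt)
    let ?v = "v (r k)" and ?x = "x (r k)"
    have xc: "?x \<in> carrier G" using Pn(5) .
    have "z \<in> N.B (Suc j) (?v \<otimes> ?x)" using k N.B_sym[OF z] by blast
    then have 1: "z \<otimes> inv (?v \<otimes> ?x) \<in> V (Suc j)" by (simp add: N.B_def)
    have "?v \<in> V (Suc j)"
      using N.V_mono[of "Suc j" "r k"] Pn(4)[of "r k"] rge[of k] k(2) by auto
    with 1 have "z \<otimes> inv (?v \<otimes> ?x) \<otimes> ?v \<in> V j" by (rule Qn(1))
    moreover have "z \<otimes> inv (?v \<otimes> ?x) \<otimes> ?v = g \<otimes> inv (?x \<otimes> inv y)"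
      using z y xc vc[of "r k"] by (simp add: g_def inv_mult_group m_assoc inv_lmult_cancel)
    moreover have "?x \<otimes> inv y \<in> U'" using rJ[of k] by (simp add: J_def)
    ultimately show ?thesis by auto
  qed
  then obtain u where u: "\<And>j. u j \<in> U'" "\<And>j. g \<otimes> inv (u j) \<in> V j" by metis
  have uc: "u j \<in> carrier G" for j using open_carrier[OF U'(1) u(1)] .
  obtain w where w: "w \<in> carrier G" and wcl: "\<And>U. openin T U \<Longrightarrow> w \<in> U \<Longrightarrow> infinite {j. u j \<in> U}"
    using cluster_point[of u, OF uc] by blast
  have "w \<in> T closure_of U'"
  proof -
    have "\<exists>y. y \<in> U' \<and> y \<in> O'" if O': "w \<in> O'" "openin T O'" for O'
    proof -
      obtain j where "j \<in> {j. u j \<in> O'}" using infinite_natset_gt[OF wcl[OF O'(2,1)]] by metis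
      then show ?thesis using u(1) by auto
    qed
    then show ?thesis using w by (auto simp: in_closure_of topspace_eq)
  qed
  then have wU: "w \<in> U" using U'(3) by blast
  \<comment> \<open>What remains of \<open>g\<close> after removing the limit \<open>w\<close> of
    the small factors; it lies in every \<open>V j\<close>, but need not be the unit.\<close>
  define n where "n = g \<otimes> inv w"
  have nc: "n \<in> carrier G" using gc w by (simp add: n_def)
  have nV: "n \<in> V j" for j
  proof -
    have "openin T (N.B (Suc j) w)"
      unfolding N.B_def using w by (intro open_rmult Pn(1)) auto
    from wcl[OF this N.B_self[OF w]] obtain i where i: "i \<in> {i. u i \<in> N.B (Suc j) w}" "j < i"
      by (rule infinite_natset_gt)
    then have 1: "u i \<otimes> inv w \<in> V (Suc j)" by (simp add: N.B_def)
    have "g \<otimes> inv (u i) \<in> V (Suc j)"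
      using N.V_mono[of "Suc j" i] u(2)[of i] i(2) by auto
    then have "(g \<otimes> inv (u i)) \<otimes> (u i \<otimes> inv w) \<in> V j" using 1 by (rule Qn(1))
    then show ?thesis using gc uc w by (simp add: n_def m_assoc inv_lmult_cancel)
  qed
  \<comment> \<open>The neighbourhood \<open>n \<otimes> U \<otimes> y\<close> of \<open>z\<close>.
    For \<open>a = v (r k) \<otimes> x (r k)\<close> in it, the chain \<open>f a\<close>,
    \<open>f (inv n \<otimes> a)\<close>, \<open>f y\<close>, \<open>f (x (r k))\<close> has three
    gaps below \<open>\<epsilon> / 4\<close>, against the gap of at least \<open>\<epsilon>\<close>
    chosen initially.\<close>
  define O' where "O' = {a \<in> carrier G. inv n \<otimes> a \<in> {b \<in> carrier G. b \<otimes> inv y \<in> U}}"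
  have "openin T O'" unfolding O'_def using nc y by (intro open_lmult open_rmult U(1)) auto
  moreover have "z \<in> O'"
  proof -
    have "inv n \<otimes> z \<otimes> inv y = w"
      using z y w nc gc by (simp add: n_def g_def inv_mult_group m_assoc inv_lmult_cancel)
    then show ?thesis using wU z nc by (simp add: O'_def)
  qed
  ultimately have "infinite {k. v (r k) \<otimes> x (r k) \<in> O'}" using zcl by blast
  then obtain k where k: "k \<in> {k. v (r k) \<otimes> x (r k) \<in> O'}" by (rule infinite_natset_gt)
  define a where "a = v (r k) \<otimes> x (r k)"
  have ac: "a \<in> carrier G" using zc by (simp add: a_def)
  have near_y: "\<bar>f b - f y\<bar> < \<epsilon> / 4" if "b \<in> carrier G" "b \<otimes> inv y \<in> U" for b
    using that y by (simp add: U_def m_assoc)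
  have "\<bar>f (inv n \<otimes> a) - f y\<bar> < \<epsilon> / 4"
    using k near_y by (simp add: O'_def a_def)
  moreover have "\<bar>f (inv n \<otimes> a) - f a\<bar> < \<epsilon> / 4"
    unfolding a_def by (rule Qn(2)) (rule Pn(3)[OF nV])
  moreover have "\<bar>f (x (r k)) - f y\<bar> < \<epsilon> / 4"
    using rJ[of k] U'U by (intro near_y) (auto simp: J_def)
  moreover have "\<bar>f a - f (x (r k))\<bar> \<ge> \<epsilon>"
    unfolding a_def by (rule Pn(6))
  ultimately show False by linarith
qed

end

section \<open>Stone-Cech compactification of a countably compact group\<close>

lemma closure_of_dense_le:
  fixes f g :: "'a \<Rightarrow> real"
  assumes "x \<in> X closure_of S" and f: "continuous_map X euclideanreal f"
    and "\<And>y. y \<in> S \<Longrightarrow> \<bar>f y - c\<bar> \<le> d"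
  shows "\<bar>f x - c\<bar> \<le> d"
proof (rule forall_in_closure_of[OF assms(1) assms(3)])
  have "closedin X {y \<in> topspace X. f y \<in> cball c d}"
    by (rule closedin_continuous_map_preimage[OF f]) simp
  then show "closedin X {y \<in> topspace X. \<bar>f y - c\<bar> \<le> d}"
    by (simp add: dist_real_def abs_minus_commute)
qed

lemma bounded_image_compact_space:
  fixes u :: "'a \<Rightarrow> real"
  assumes "compact_space X" "continuous_map X euclideanreal u"
  shows "bounded (u ` topspace X)"
proof -
  have "compactin euclideanreal (u ` topspace X)"
    by (rule image_compactin) (use assms in \<open>auto simp: compact_space_def\<close>)
  then show ?thesis by (simp add: compact_imp_bounded)
qed

lemma continuous_map_embedding: "embedding_map X Y f \<Longrightarrow> continuous_map X Y f"
  unfolding embedding_map_def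
  using homeomorphic_imp_continuous_map continuous_map_into_fulltopology by blast

text \<open>Real functions embed \<open>K\<close> into a cube. The coordinates extend by assumption,
  and since the image of \<open>K\<close> in the cube is closed and \<open>D\<close> is dense, the
  extended map still takes its values in that image.\<close>

lemma continuous_extension_compact_Hausdorff:
  fixes h :: "'z \<Rightarrow> 'k"
  assumes K: "compact_space K" "Hausdorff_space K"
    and dense: "Z closure_of D = topspace Z" and h: "h ` D \<subseteq> topspace K"
    and ext: "\<And>f. continuous_map K euclideanreal f \<Longrightarrow>
                 \<exists>g. continuous_map Z euclideanreal g \<and> (\<forall>x\<in>D. g x = f (h x))"
  shows "\<exists>H. continuous_map Z K H \<and> (\<forall>x\<in>D. H x = h x)"
proof -
  have cr: "completely_regular_space K"
    using K by (simp add: compact_Hausdorff_or_regular_imp_normal_space normal_imp_completely_regular_space_gen)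
  define M where "M = mspace (submetric (cfunspace K (euclidean_metric :: real metric)) {f. f \<in> topspace K \<rightarrow> {0..1}})"
  define P where "P = product_topology (\<lambda>f :: 'k \<Rightarrow> real. top_of_set {0..1::real}) M"
  define E where "E x = (\<lambda>f\<in>M. f x)" for x :: 'k
  have emb: "embedding_map K P E"
    using completely_regular_space_cube_embedding_explicit[OF cr K(2)] by (simp add: M_def P_def E_def[abs_def])
  have M: "continuous_map K euclideanreal f" "f \<in> topspace K \<rightarrow> {0..1}" if "f \<in> M" for f
    using that by (auto simp: M_def)
  obtain E' where E': "homeomorphic_maps K (subtopology P (E ` topspace K)) E E'"
    using emb by (auto simp: embedding_map_def homeomorphic_map_maps)
  have Pcl: "closedin P (E ` topspace K)"
  proof (rule compactin_imp_closedin)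
    show "Hausdorff_space P"
      by (auto simp: P_def Hausdorff_space_product_topology Hausdorff_space_subtopology)
    show "compactin P (E ` topspace K)"
      using image_compactin[OF _ continuous_map_embedding[OF emb]] K by (simp add: compact_space_def)
  qed
  obtain g where g: "\<And>f. f \<in> M \<Longrightarrow> continuous_map Z euclideanreal (g f)"
      "\<And>f x. f \<in> M \<Longrightarrow> x \<in> D \<Longrightarrow> g f x = f (h x)"
    using ext[OF M(1)] by metis
  \<comment> \<open>The extensions are clamped to the unit interval so that they map into the cube;
    on \<open>D\<close> the clamping changes nothing, because members of \<open>M\<close> have
    values there.\<close>
  define H0 where "H0 z = (\<lambda>f\<in>M. max 0 (min 1 (g f z)))" for z
  have H0: "continuous_map Z P H0"
    unfolding P_def continuous_map_componentwise
  proof (intro conjI ballI)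
    fix f assume f: "f \<in> M"
    have "continuous_map Z euclideanreal (\<lambda>z. max 0 (min 1 (g f z)))"
      by (intro continuous_map_real_max continuous_map_real_min g f) auto
    then have "continuous_map Z (top_of_set {0..1}) (\<lambda>z. max 0 (min 1 (g f z)))"
      by (simp add: continuous_map_in_subtopology image_subset_iff)
    then show "continuous_map Z (top_of_set {0..1}) (\<lambda>z. H0 z f)"
      using f by (simp add: H0_def)
  qed (auto simp: H0_def)
  have H0D: "H0 x = E (h x)" if "x \<in> D" for x
  proof
    fix f
    have "h x \<in> topspace K" using h that by blast
    then show "H0 x f = E (h x) f"
      using M(2)[of f] g(2)[of f x] that by (auto simp: H0_def E_def restrict_def Pi_iff)
  qed
  have H0K: "H0 z \<in> E ` topspace K" if "z \<in> topspace Z" for z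
  proof (rule forall_in_closure_of[of z Z D])
    show "z \<in> Z closure_of D" using that dense by simp
    show "H0 x \<in> E ` topspace K" if "x \<in> D" for x using H0D that h by auto
    show "closedin Z {x \<in> topspace Z. H0 x \<in> E ` topspace K}"
      by (rule closedin_continuous_map_preimage[OF H0 Pcl])
  qed
  have "continuous_map Z (subtopology P (E ` topspace K)) H0"
    using H0 H0K by (auto simp: continuous_map_in_subtopology)
  then have "continuous_map Z K (E' \<circ> H0)"
    using E' continuous_map_compose unfolding homeomorphic_maps_def by blast
  moreover have "(E' \<circ> H0) x = h x" if "x \<in> D" for x
    using E' h that H0D by (auto simp: homeomorphic_maps_def)
  ultimately show ?thesis by blast
qed

lemma stone_cechD:
  assumes "stone_cech X K e"
  shows "compact_space K" "Hausdorff_space K" "embedding_map X K e" "continuous_map X K e" "inj_on e (topspace X)"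
    "x \<in> topspace X \<Longrightarrow> e x \<in> topspace K" "K closure_of (e ` topspace X) = topspace K"
    "continuous_map X euclideanreal f \<Longrightarrow> bounded (f ` topspace X) \<Longrightarrow>
       \<exists>g. continuous_map K euclideanreal g \<and> (\<forall>x\<in>topspace X. g (e x) = f x)"
proof -
  show emb: "embedding_map X K e" using assms by (simp add: stone_cech_def)
  then show cont: "continuous_map X K e" by (rule continuous_map_embedding)
  show "inj_on e (topspace X)"
    using emb homeomorphic_imp_injective_map unfolding embedding_map_def by blast
  show "x \<in> topspace X \<Longrightarrow> e x \<in> topspace K"
    using cont by (auto simp: continuous_map_def)
qed (use assms in \<open>auto simp: stone_cech_def\<close>)

text \<open>The definition of \<open>stone_cech\<close> speaks of bounded real functions only. This
  recovers the universal property for all compact Hausdorff targets, since real functions pulled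
  back from a compact space are bounded.\<close>

lemma stone_cech_extension:
  assumes sc: "stone_cech X K e" and Y: "compact_space Y" "Hausdorff_space Y" and f: "continuous_map X Y f"
  shows "\<exists>F. continuous_map K Y F \<and> (\<forall>x\<in>topspace X. F (e x) = f x)"
proof -
  note sc' = stone_cechD[OF sc]
  let ?e' = "inv_into (topspace X) e"
  have e': "?e' (e x) = x" if "x \<in> topspace X" for x
    using that sc'(5) by simp
  have "\<exists>F. continuous_map K Y F \<and> (\<forall>x\<in>e ` topspace X. F x = (f \<circ> ?e') x)"
  proof (rule continuous_extension_compact_Hausdorff[OF Y sc'(7)])
    show "(f \<circ> ?e') ` e ` topspace X \<subseteq> topspace Y"
      using e' f by (auto simp: continuous_map_def Pi_iff)
    fix u :: "'c \<Rightarrow> real" assume u: "continuous_map Y euclideanreal u"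
    from bounded_image_compact_space[OF Y(1) u]
    have "bounded ((u \<circ> f) ` topspace X)"
      by (rule bounded_subset) (use f in \<open>auto simp: continuous_map_def\<close>)
    then have "\<exists>g. continuous_map K euclideanreal g \<and> (\<forall>x\<in>topspace X. g (e x) = (u \<circ> f) x)"
      by (intro sc'(8) continuous_map_compose[OF f u])
    then show "\<exists>g. continuous_map K euclideanreal g \<and> (\<forall>x\<in>e ` topspace X. g x = u ((f \<circ> ?e') x))"
      using e' by auto
  qed
  then show ?thesis using e' by auto
qed

lemma stone_cech_unique_extension:
  assumes sc: "stone_cech X K e" and Y: "Hausdorff_space Y"
    and f: "continuous_map K Y f" and g: "continuous_map K Y g"
    and eq: "\<And>x. x \<in> topspace X \<Longrightarrow> f (e x) = g (e x)" and p: "p \<in> topspace K"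
  shows "f p = g p"
proof (rule forall_in_closure_of_eq[OF _ Y f g])
  show "p \<in> K closure_of (e ` topspace X)" using stone_cechD(7)[OF sc] p by simp
qed (use eq in auto)

lemma continuous_map_pairwise1: 
  assumes "continuous_map (prod_topology X Y) Z (\<lambda>(x, y). f x y)" "y \<in> topspace Y"
  shows "continuous_map X Z (\<lambda>x. f x y)"
proof -
  have "continuous_map X (prod_topology X Y) (\<lambda>x. (x, y))"
    using assms(2) by (simp add: continuous_map_pairedI)
  from continuous_map_compose[OF this assms(1)] show ?thesis by (simp add: o_def)
qed

lemma continuous_map_pairwise2: 
  assumes "continuous_map (prod_topology X Y) Z (\<lambda>(x, y). f x y)" "x \<in> topspace X"
  shows "continuous_map Y Z (f x)"
proof -
  have "continuous_map Y (prod_topology X Y) (\<lambda>y. (x, y))"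
    using assms(2) by (simp add: continuous_map_pairedI)
  from continuous_map_compose[OF this assms(1)] show ?thesis by (simp add: o_def)
qed

lemma continuous_map_euclideanrealI:
  fixes f :: "'a \<Rightarrow> real"
  assumes "\<And>x d. x \<in> topspace X \<Longrightarrow> d > 0 \<Longrightarrow> \<exists>U. openin X U \<and> x \<in> U \<and> (\<forall>y\<in>U. \<bar>f y - f x\<bar> < d)"
  shows "continuous_map X euclideanreal f"
  unfolding continuous_map_def
proof (intro conjI allI impI)
  fix W :: "real set" assume "openin euclideanreal W"
  then have W: "open W" by simp
  show "openin X {x \<in> topspace X. f x \<in> W}"
  proof (subst openin_subopen, clarify)
    fix x assume x: "x \<in> topspace X" "f x \<in> W"
    then obtain d where d: "d > 0" "ball (f x) d \<subseteq> W" using W by (meson open_contains_ball)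
    obtain U where U: "openin X U" "x \<in> U" "\<forall>y\<in>U. \<bar>f y - f x\<bar> < d" using assms[OF x(1) d(1)] by blast
    have "U \<subseteq> {x \<in> topspace X. f x \<in> W}"
    proof
      fix y assume y: "y \<in> U"
      then have "f y \<in> ball (f x) d" using U(3) by (auto simp: dist_real_def abs_minus_commute)
      then show "y \<in> {x \<in> topspace X. f x \<in> W}" using d(2) openin_subset[OF U(1)] y by blast
    qed
    then show "\<exists>T. openin X T \<and> x \<in> T \<and> T \<subseteq> {x \<in> topspace X. f x \<in> W}" using U by blast
  qed
qed auto

section \<open>The group structure on the compactification\<close>

context cc_semitopological_group
begin

text \<open>The function is extended in one variable after the other. Joint continuity of the result
  needs control in one variable that is uniform in the other; uniform continuity of \<open>f\<close>
  together with a finite net provides it.\<close>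

lemma mult_function_extension:
  fixes f :: "'a \<Rightarrow> real" and K :: "'k topology"
  assumes sc: "stone_cech T K e" and f: "continuous_map T euclideanreal f" and bd: "bounded (f ` carrier G)"
  shows "\<exists>\<Phi>. continuous_map (prod_topology K K) euclideanreal \<Phi> \<and>
     (\<forall>x\<in>carrier G. \<forall>y\<in>carrier G. \<Phi> (e x, e y) = f (x \<otimes> y))"
proof -
  note sc' = stone_cechD[OF sc, unfolded topspace_eq]
  obtain M where M: "\<And>x. x \<in> carrier G \<Longrightarrow> \<bar>f x\<bar> \<le> M"
    using bd by (auto simp: bounded_real)
  have bounded: "bounded (g ` carrier G)" if "\<And>x. x \<in> carrier G \<Longrightarrow> \<bar>g x\<bar> \<le> M" for g :: "'a \<Rightarrow> real"
    using that by (auto simp: bounded_real)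
  have "\<exists>g. continuous_map K euclideanreal g \<and> (\<forall>y\<in>carrier G. g (e y) = f (x \<otimes> y))" if "x \<in> carrier G" for x
    by (rule sc'(8)) (use that M continuous_map_compose[OF continuous_lmult f] in \<open>auto simp: o_def intro!: bounded\<close>)
  then obtain L where L: "\<And>x. x \<in> carrier G \<Longrightarrow> continuous_map K euclideanreal (L x)"
    "\<And>x y. x \<in> carrier G \<Longrightarrow> y \<in> carrier G \<Longrightarrow> L x (e y) = f (x \<otimes> y)" by metis
  have "\<exists>g. continuous_map K euclideanreal g \<and> (\<forall>x\<in>carrier G. g (e x) = f (x \<otimes> y))" if "y \<in> carrier G" for y
    by (rule sc'(8)) (use that M continuous_map_compose[OF continuous_rmult f] in \<open>auto simp: o_def intro!: bounded\<close>)
  then obtain R where R: "\<And>y. y \<in> carrier G \<Longrightarrow> continuous_map K euclideanreal (R y)"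
    "\<And>x y. x \<in> carrier G \<Longrightarrow> y \<in> carrier G \<Longrightarrow> R y (e x) = f (x \<otimes> y)" by metis
  have Lclose: "\<bar>L a q - L b q\<bar> \<le> c" if "a \<in> carrier G" "b \<in> carrier G" "q \<in> topspace K"
      "\<And>y. y \<in> carrier G \<Longrightarrow> \<bar>f (a \<otimes> y) - f (b \<otimes> y)\<bar> \<le> c" for a b q c
  proof -
    have "\<bar>(L a q - L b q) - 0\<bar> \<le> c"
    proof (rule closure_of_dense_le[of q K "e ` carrier G" "\<lambda>q. L a q - L b q"])
      show "continuous_map K euclideanreal (\<lambda>q. L a q - L b q)"
        by (intro continuous_map_diff L that)
    qed (use that sc'(7) L(2) in auto)
    then show ?thesis by simp
  qed
  \<comment> \<open>Points of the group that map near \<open>p\<close> induce uniformly close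
    functions \<open>y \<mapsto> f (x \<otimes> y)\<close>, even if \<open>p\<close> itself is not
    the image of a group element.\<close>
  have osc: "\<exists>W. openin K W \<and> p \<in> W \<and> (\<forall>x\<in>carrier G. \<forall>x'\<in>carrier G. e x \<in> W \<longrightarrow> e x' \<in> W \<longrightarrow>
      (\<forall>y\<in>carrier G. \<bar>f (x \<otimes> y) - f (x' \<otimes> y)\<bar> \<le> d))" if p: "p \<in> topspace K" and "d > 0" for p d
  proof -
    obtain V where V: "openin T V" "\<one> \<in> V" "\<And>v x. v \<in> V \<Longrightarrow> x \<in> carrier G \<Longrightarrow> \<bar>f (v \<otimes> x) - f x\<bar> < d / 4"
      using uniformly_continuous[OF f, of "d / 4"] \<open>d > 0\<close> by auto
    obtain F where F: "finite F" "F \<subseteq> carrier G" "\<And>x. x \<in> carrier G \<Longrightarrow> \<exists>a\<in>F. x \<otimes> inv a \<in> V"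
      using left_translates_cover[OF V(1,2)] by metis
    define C where "C a = K closure_of (e ` {x \<in> carrier G. x \<otimes> inv a \<in> V})" for a
    \<comment> \<open>Deleting the finitely many \<open>C a\<close> that miss \<open>p\<close>
      leaves only net points \<open>a\<close> with \<open>p \<in> C a\<close>. Two such points may
      be far apart as group elements, but both induced functions are close to
      \<open>y \<mapsto> R y p\<close>; the resulting chain from \<open>x\<close> to
      \<open>x'\<close> has four links of size \<open>d / 4\<close>.\<close>
    define W where "W = topspace K - \<Union>(C ` {a \<in> F. p \<notin> C a})"
    have W: "openin K W"
      unfolding W_def using F(1) by (intro openin_diff closedin_Union) (auto simp: C_def)
    have near: "\<bar>f (x \<otimes> y) - f (a \<otimes> y)\<bar> \<le> d / 4"
      if "a \<in> F" "x \<in> carrier G" "x \<otimes> inv a \<in> V" "y \<in> carrier G" for a x y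
    proof -
      have "a \<in> carrier G" using F(2) that(1) by blast
      then show ?thesis
        using V(3)[of "x \<otimes> inv a" "a \<otimes> y"] that by (simp add: m_assoc inv_lmult_cancel)
    qed
    have Rp: "\<bar>R y p - f (a \<otimes> y)\<bar> \<le> d / 4" if "a \<in> F" "p \<in> C a" "y \<in> carrier G" for a y
      by (rule closure_of_dense_le[OF that(2)[unfolded C_def] R(1)])
         (use near R(2) that in auto)
    have pick: "\<exists>a\<in>F. p \<in> C a \<and> x \<otimes> inv a \<in> V" if x: "x \<in> carrier G" "e x \<in> W" for x
    proof -
      obtain a where a: "a \<in> F" "x \<otimes> inv a \<in> V" using F(3)[OF x(1)] by blast
      have "e ` {x \<in> carrier G. x \<otimes> inv a \<in> V} \<subseteq> C a"
        unfolding C_def by (rule closure_of_subset) (use sc'(6) in auto)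
      then have "e x \<in> C a" using x(1) a(2) by blast
      then show ?thesis using x(2) a by (auto simp: W_def)
    qed
    have "\<bar>f (x \<otimes> y) - f (x' \<otimes> y)\<bar> \<le> d"
      if x: "x \<in> carrier G" "e x \<in> W" and x': "x' \<in> carrier G" "e x' \<in> W" and y: "y \<in> carrier G" for x x' y
    proof -
      obtain a where a: "a \<in> F" "p \<in> C a" "x \<otimes> inv a \<in> V" using pick[OF x] by blast
      obtain a' where a': "a' \<in> F" "p \<in> C a'" "x' \<otimes> inv a' \<in> V" using pick[OF x'] by blast
      show ?thesis
        using near[OF a(1) x(1) a(3) y] near[OF a'(1) x'(1) a'(3) y] Rp[OF a(1,2) y] Rp[OF a'(1,2) y]
        by linarith
    qed
    moreover have "p \<in> W" using p by (auto simp: W_def)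
    ultimately show ?thesis using W by blast
  qed
  \<comment> \<open>Uniform continuity passes through \<open>L\<close> to all \<open>q\<close> of
    the compactification by density, so the function of the remaining variable is continuous and can
    be extended again.\<close>
  have "\<exists>g. continuous_map K euclideanreal g \<and> (\<forall>x\<in>carrier G. g (e x) = L x q)" if q: "q \<in> topspace K" for q
  proof (rule sc'(8))
    show "continuous_map T euclideanreal (\<lambda>x. L x q)"
    proof (rule continuous_map_euclideanrealI)
      fix x and d :: real assume "x \<in> topspace T" "d > 0"
      then have x: "x \<in> carrier G" by (simp add: topspace_eq)
      obtain V where V: "openin T V" "\<one> \<in> V" "\<And>v x. v \<in> V \<Longrightarrow> x \<in> carrier G \<Longrightarrow> \<bar>f (v \<otimes> x) - f x\<bar> < d / 2"
        using uniformly_continuous[OF f, of "d / 2"] \<open>d > 0\<close> by auto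
      have "\<bar>L z q - L x q\<bar> < d" if z: "z \<in> carrier G" "z \<otimes> inv x \<in> V" for z
      proof -
        have "\<bar>L z q - L x q\<bar> \<le> d / 2"
        proof (rule Lclose[OF z(1) x q])
          fix y assume "y \<in> carrier G"
          then show "\<bar>f (z \<otimes> y) - f (x \<otimes> y)\<bar> \<le> d / 2"
            using V(3)[OF z(2), of "x \<otimes> y"] x z by (simp add: m_assoc inv_lmult_cancel)
        qed
        then show ?thesis using \<open>d > 0\<close> by simp
      qed
      then show "\<exists>U. openin T U \<and> x \<in> U \<and> (\<forall>z\<in>U. \<bar>L z q - L x q\<bar> < d)"
        using open_rmult[OF V(1), of "inv x"] x V(2)
        by (intro exI[of _ "{z \<in> carrier G. z \<otimes> inv x \<in> V}"]) auto
    qed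
    have "\<bar>L x q - 0\<bar> \<le> M" if "x \<in> carrier G" for x
      by (rule closure_of_dense_le[of q K "e ` carrier G"]) (use that L M q sc'(7) in auto)
    then show "Elementary_Metric_Spaces.bounded ((\<lambda>x. L x q) ` carrier G)" by (intro bounded) auto
  qed
  then obtain \<Psi> where \<Psi>: "\<And>q. q \<in> topspace K \<Longrightarrow> continuous_map K euclideanreal (\<Psi> q)"
     "\<And>q x. q \<in> topspace K \<Longrightarrow> x \<in> carrier G \<Longrightarrow> \<Psi> q (e x) = L x q" by metis
  have "continuous_map (prod_topology K K) euclideanreal (\<lambda>(p, q). \<Psi> q p)"
  proof (rule continuous_map_euclideanrealI, clarsimp)
    fix p q and d :: real assume p: "p \<in> topspace K" and q: "q \<in> topspace K" and "d > 0"
    obtain W where W: "openin K W" "p \<in> W" "\<And>x x' y. x \<in> carrier G \<Longrightarrow> x' \<in> carrier G \<Longrightarrow> e x \<in> W \<Longrightarrow> e x' \<in> W \<Longrightarrow>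
       y \<in> carrier G \<Longrightarrow> \<bar>f (x \<otimes> y) - f (x' \<otimes> y)\<bar> \<le> d / 4"
      using osc[OF p, of "d / 4"] \<open>d > 0\<close> by auto
    obtain x where x: "x \<in> carrier G" "e x \<in> W"
    proof -
      have "p \<in> K closure_of (e ` carrier G)" using p sc'(7) by simp
      then have "\<exists>y. y \<in> e ` carrier G \<and> y \<in> W" using W(1,2) unfolding in_closure_of by blast
      then show thesis using that by blast
    qed
    \<comment> \<open>One group element \<open>x\<close> in \<open>W\<close> approximates all of
      \<open>W\<close> simultaneously for every \<open>q'\<close>, so that only the continuity of
      the single function \<open>L x\<close> is left to use in the second variable.\<close>
    have near: "\<bar>\<Psi> q' p' - L x q'\<bar> \<le> d / 4" if p': "p' \<in> W" and q': "q' \<in> topspace K" for p' q'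
    proof (rule closure_of_dense_le[of p' K "e ` carrier G \<inter> W" "\<Psi> q'", OF _ \<Psi>(1)[OF q']])
      show "p' \<in> K closure_of (e ` carrier G \<inter> W)"
        using openin_Int_closure_of_subset[OF W(1), of "e ` carrier G"] p' openin_subset[OF W(1)] sc'(7)
        by (auto simp: Int_commute)
    next
      fix y assume "y \<in> e ` carrier G \<inter> W"
      then obtain x' where x': "x' \<in> carrier G" "y = e x'" "e x' \<in> W" by auto
      show "\<bar>\<Psi> q' y - L x q'\<bar> \<le> d / 4"
        unfolding x'(2) \<Psi>(2)[OF q' x'(1)]
        by (rule Lclose[OF x'(1) x(1) q']) (rule W(3)[OF x'(1) x(1) x'(3) x(2)])
    qed
    define Q where "Q = {q' \<in> topspace K. L x q' \<in> ball (L x q) (d / 4)}"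
    have Q: "openin K Q" unfolding Q_def by (rule openin_continuous_map_preimage[OF L(1)[OF x(1)]]) simp
    have "q \<in> Q" using q \<open>d > 0\<close> by (simp add: Q_def)
    have "\<bar>\<Psi> q' p' - \<Psi> q p\<bar> < d" if "p' \<in> W" "q' \<in> Q" for p' q'
    proof -
      have "\<bar>L x q' - L x q\<bar> < d / 4" and q': "q' \<in> topspace K"
        using that(2) by (auto simp: Q_def dist_real_def abs_minus_commute)
      then show ?thesis using near[OF that(1) q'] near[OF W(2) q] \<open>d > 0\<close> by linarith
    qed
    then show "\<exists>U. openin (prod_topology K K) U \<and> (p, q) \<in> U \<and> (\<forall>y\<in>U. \<bar>(case y of (p, q) \<Rightarrow> \<Psi> q p) - \<Psi> q p\<bar> < d)"
      using W(1,2) Q \<open>q \<in> Q\<close> by (intro exI[of _ "W \<times> Q"]) (auto simp: openin_prod_Times_iff)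
  qed
  moreover have "(\<lambda>(p, q). \<Psi> q p) (e x, e y) = f (x \<otimes> y)" if "x \<in> carrier G" "y \<in> carrier G" for x y
    using that \<Psi>(2) L(2) sc'(6) by simp
  ultimately show ?thesis by blast
qed

text \<open>Each real function of the product extends to the square, hence so does the product as a
  map into \<open>K\<close>. The group laws then hold on a dense subset and pass to the
  closure.\<close>

lemma stone_cech_topological_group:
  fixes K :: "'k topology"
  assumes sc: "stone_cech T K e"
  shows "\<exists>H :: 'k monoid. topological_group K H \<and> e \<in> hom G H"
proof -
  note sc' = stone_cechD[OF sc, unfolded topspace_eq]
  let ?e' = "inv_into (carrier G) e"
  have e': "?e' (e x) = x" if "x \<in> carrier G" for x
    using that sc'(5) by simp
  have "\<exists>M. continuous_map (prod_topology K K) K M \<and>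
      (\<forall>z\<in>e ` carrier G \<times> e ` carrier G. M z = (case z of (p, q) \<Rightarrow> e (?e' p \<otimes> ?e' q)))"
  proof (rule continuous_extension_compact_Hausdorff[OF sc'(1,2)])
    show "prod_topology K K closure_of (e ` carrier G \<times> e ` carrier G) = topspace (prod_topology K K)"
      using sc'(7) by (simp add: closure_of_Times)
    show "(\<lambda>z. case z of (p, q) \<Rightarrow> e (?e' p \<otimes> ?e' q)) ` (e ` carrier G \<times> e ` carrier G) \<subseteq> topspace K"
      using e' sc'(6) by auto
    fix u :: "'k \<Rightarrow> real" assume u: "continuous_map K euclideanreal u"
    from bounded_image_compact_space[OF sc'(1) u]
    have "bounded ((u \<circ> e) ` carrier G)"
      by (rule bounded_subset) (use sc'(6) in auto)
    from mult_function_extension[OF sc continuous_map_compose[OF sc'(4) u] this]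
    show "\<exists>g. continuous_map (prod_topology K K) euclideanreal g \<and>
        (\<forall>z\<in>e ` carrier G \<times> e ` carrier G. g z = u (case z of (p, q) \<Rightarrow> e (?e' p \<otimes> ?e' q)))"
      using e' by auto
  qed
  then obtain M0 where M0: "continuous_map (prod_topology K K) K M0"
     "\<forall>z\<in>e ` carrier G \<times> e ` carrier G. M0 z = (case z of (p, q) \<Rightarrow> e (?e' p \<otimes> ?e' q))" by blast
  define M where "M p q = M0 (p, q)" for p q
  have M: "continuous_map (prod_topology K K) K (\<lambda>(p, q). M p q)" using M0(1) by (simp add: M_def)
  have Me: "M (e x) (e y) = e (x \<otimes> y)" if "x \<in> carrier G" "y \<in> carrier G" for x y
    using M0(2) e' that by (simp add: M_def)
  have Mc: "M p q \<in> topspace K" if "p \<in> topspace K" "q \<in> topspace K" for p q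
  proof -
    have "(\<lambda>(p, q). M p q) \<in> topspace K \<times> topspace K \<rightarrow> topspace K"
      using M by (simp add: continuous_map_def)
    from funcset_mem[OF this, of "(p, q)"] that show ?thesis by simp
  qed
  note Mr = continuous_map_pairwise2[OF M] and Ml = continuous_map_pairwise1[OF M]
  note uniq = stone_cech_unique_extension[OF sc sc'(2), unfolded topspace_eq]
  obtain \<iota> where \<iota>: "continuous_map K K \<iota>" "\<And>x. x \<in> carrier G \<Longrightarrow> \<iota> (e x) = e (inv x)"
    using stone_cech_extension[OF sc sc'(1,2) continuous_map_compose[OF continuous_inv sc'(4)]]
    by (auto simp: topspace_eq)
  have \<iota>c: "\<iota> p \<in> topspace K" if "p \<in> topspace K" for p
    using \<iota>(1) that by (auto simp: continuous_map_def)
  \<comment> \<open>Associativity is carried to \<open>K\<close> one variable at a time, so that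
    separate continuity in the current variable suffices at each stage.\<close>
  have a1: "M (M (e x) (e y)) r = M (e x) (M (e y) r)" if "x \<in> carrier G" "y \<in> carrier G" "r \<in> topspace K" for x y r
  proof (rule uniq[OF _ _ _ that(3)])
    show "continuous_map K K (\<lambda>r. M (M (e x) (e y)) r)"
      by (intro Mr Mc sc'(6) that)
    show "continuous_map K K (\<lambda>r. M (e x) (M (e y) r))"
      using continuous_map_compose[OF Mr Mr, of "e y" "e x"] that by (simp add: o_def sc'(6))
  qed (simp add: that Me m_assoc)
  have a2: "M (M (e x) q) r = M (e x) (M q r)" if "x \<in> carrier G" "q \<in> topspace K" "r \<in> topspace K" for x q r
  proof (rule uniq[OF _ _ _ that(2)])
    show "continuous_map K K (\<lambda>q. M (M (e x) q) r)"
      using continuous_map_compose[OF Mr Ml, of "e x" r] that by (simp add: o_def sc'(6))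
    show "continuous_map K K (\<lambda>q. M (e x) (M q r))"
      using continuous_map_compose[OF Ml Mr, of r "e x"] that by (simp add: o_def sc'(6))
  qed (simp add: that a1)
  have assoc: "M (M p q) r = M p (M q r)" if "p \<in> topspace K" "q \<in> topspace K" "r \<in> topspace K" for p q r
  proof (rule uniq[OF _ _ _ that(1)])
    show "continuous_map K K (\<lambda>p. M (M p q) r)"
      using continuous_map_compose[OF Ml Ml, of q r] that by (simp add: o_def)
    show "continuous_map K K (\<lambda>p. M p (M q r))"
      by (intro Ml Mc that)
  qed (simp add: that a2)
  have one: "M (e \<one>) p = p" if "p \<in> topspace K" for p
  proof (rule uniq[OF _ _ _ that])
    show "continuous_map K K (\<lambda>p. M (e \<one>) p)" by (intro Mr sc'(6)) simp
  qed (simp_all add: Me)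
  have linv: "M (\<iota> p) p = e \<one>" if "p \<in> topspace K" for p
  proof (rule uniq[OF _ _ _ that])
    have "continuous_map K (prod_topology K K) (\<lambda>p. (\<iota> p, p))"
      using \<iota>(1) by (simp add: continuous_map_pairedI)
    from continuous_map_compose[OF this M] show "continuous_map K K (\<lambda>p. M (\<iota> p) p)" by (simp add: o_def)
  qed (use sc'(6) \<iota>(2) Me in auto)
  define H :: "'k monoid" where "H = \<lparr>carrier = topspace K, mult = M, one = e \<one>\<rparr>"
  have H: "group H"
  proof (rule groupI)
    show "\<And>x. x \<in> carrier H \<Longrightarrow> \<exists>y\<in>carrier H. y \<otimes>\<^bsub>H\<^esub> x = \<one>\<^bsub>H\<^esub>"
      using linv \<iota>c by (auto simp: H_def)
  qed (use Mc sc'(6) assoc one in \<open>auto simp: H_def\<close>)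
  have inv: "inv\<^bsub>H\<^esub> p = \<iota> p" if "p \<in> topspace K" for p
    by (rule group.inv_equality[OF H]) (use that linv \<iota>c in \<open>auto simp: H_def\<close>)
  have "continuous_map K K (\<lambda>p. inv\<^bsub>H\<^esub> p)"
    using continuous_map_eq[OF \<iota>(1)] inv by metis
  then have "topological_group K H"
    unfolding topological_group_def using H sc'(2) M by (simp add: H_def)
  moreover have "e \<in> hom G H"
    using sc'(6) Me by (auto simp: hom_def H_def)
  ultimately show ?thesis by blast
qed

end

section \<open>Existence of a Stone-Cech compactification\<close>

lemma homeomorphic_map_pullback_topology:
  assumes inj: "inj_on g A" and sub: "g ` A \<subseteq> topspace Y"
  shows "homeomorphic_map (pullback_topology A g Y) (subtopology Y (g ` A)) g"
proof (rule bijective_open_imp_homeomorphic_map)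
  have top: "topspace (pullback_topology A g Y) = A"
    using sub by (auto simp: topspace_pullback_topology)
  show "continuous_map (pullback_topology A g Y) (subtopology Y (g ` A)) g"
    using continuous_map_pullback[OF continuous_map_id, of A g Y] top
    by (auto simp: continuous_map_in_subtopology)
  show "open_map (pullback_topology A g Y) (subtopology Y (g ` A)) g"
    unfolding open_map_def openin_pullback_topology openin_subtopology
  proof (intro allI impI, elim exE conjE)
    fix S U assume U: "openin Y U" "S = g -` U \<inter> A"
    then have "g ` S = U \<inter> g ` A" by auto
    then show "\<exists>T. openin Y T \<and> g ` S = T \<inter> g ` A" using U by blast
  qed
  show "g ` topspace (pullback_topology A g Y) = topspace (subtopology Y (g ` A))"
    using top sub by auto
  show "inj_on g (topspace (pullback_topology A g Y))" using top inj by simp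
qed

lemma stone_cech_homeomorphic:
  assumes sc: "stone_cech X K e" and h: "homeomorphic_map K K' h"
  shows "stone_cech X K' (h \<circ> e)"
proof -
  note sc' = stone_cechD[OF sc]
  have hs: "K homeomorphic_space K'" using h homeomorphic_map_imp_homeomorphic_space by blast
  obtain h' where h': "homeomorphic_maps K K' h h'" using h homeomorphic_map_maps by blast
  have im: "h ` topspace K = topspace K'" using h homeomorphic_imp_surjective_map by blast
  show ?thesis
    unfolding stone_cech_def
  proof (intro conjI allI impI)
    show "compact_space K'" "Hausdorff_space K'"
      using sc' hs homeomorphic_compact_space homeomorphic_Hausdorff_space by blast+
    show "embedding_map X K' (h \<circ> e)"
      using embedding_map_compose[OF sc'(3)] h surjective_embedding_map by blast
    have "e ` topspace X \<subseteq> topspace K" using sc'(6) by blast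
    then have "K' closure_of (h ` e ` topspace X) = h ` (K closure_of (e ` topspace X))"
      by (rule homeomorphic_map_closure_of[OF h])
    then show "K' closure_of ((h \<circ> e) ` topspace X) = topspace K'"
      using sc'(7) im by (simp add: image_comp)
  next
    fix f :: "'a \<Rightarrow> real" assume f: "continuous_map X euclideanreal f \<and> bounded (f ` topspace X)"
    then obtain g where g: "continuous_map K euclideanreal g" "\<forall>x\<in>topspace X. g (e x) = f x"
      using sc'(8) by blast
    have "continuous_map K' euclideanreal (g \<circ> h')"
      using h' g(1) continuous_map_compose unfolding homeomorphic_maps_def by blast
    moreover have "(g \<circ> h') ((h \<circ> e) x) = f x" if "x \<in> topspace X" for x
      using h' g(2) sc'(6) that by (simp add: homeomorphic_maps_def)
    ultimately show "\<exists>g. continuous_map K' euclideanreal g \<and> (\<forall>x\<in>topspace X. g ((h \<circ> e) x) = f x)"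
      by blast
  qed
qed

lemma stone_cech_exists_function_space:
  fixes X :: "'a topology"
  assumes "tychonoff_space X"
  shows "\<exists>(K :: (('a \<Rightarrow> real) \<Rightarrow> real) topology) e. stone_cech X K e"
proof -
  define M where "M = mspace (submetric (cfunspace X (euclidean_metric :: real metric)) {f. f \<in> topspace X \<rightarrow> {0..1}})"
  define P where "P = product_topology (\<lambda>f :: 'a \<Rightarrow> real. top_of_set {0..1::real}) M"
  define E where "E x = (\<lambda>f\<in>M. f x)" for x :: 'a
  have emb: "embedding_map X P E"
    using completely_regular_space_cube_embedding_explicit[of X] assms
    by (simp add: M_def P_def E_def[abs_def] tychonoff_space_def)
  define S where "S = P closure_of (E ` topspace X)"
  define K where "K = subtopology P S"
  have ES: "E ` topspace X \<subseteq> S"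
    unfolding S_def using continuous_map_embedding[OF emb] by (intro closure_of_subset) (auto simp: continuous_map_def)
  have "compact_space P" "Hausdorff_space P"
    by (auto simp: P_def compact_space_product_topology Hausdorff_space_product_topology
        Hausdorff_space_subtopology compact_space_subtopology)
  then have K: "compact_space K" "Hausdorff_space K"
    unfolding K_def S_def
    by (auto simp: Hausdorff_space_subtopology intro!: compact_space_subtopology closedin_compact_space)
  have topK: "topspace K = S"
    unfolding K_def S_def using closure_of_subset_topspace[of P "E ` topspace X"] by auto
  have "stone_cech X K E"
    unfolding stone_cech_def
  proof (intro conjI allI impI)
    show "embedding_map X K E" unfolding K_def using emb ES by (simp add: embedding_map_in_subtopology)
    show "K closure_of E ` topspace X = topspace K"
      unfolding topK using ES by (simp add: K_def closure_of_subtopology S_def[symmetric] Int_absorb1)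
  next
    fix f :: "'a \<Rightarrow> real" assume f: "continuous_map X euclideanreal f \<and> bounded (f ` topspace X)"
    then obtain B where B: "\<And>x. x \<in> topspace X \<Longrightarrow> \<bar>f x\<bar> \<le> B"
      by (auto simp: bounded_real)
    \<comment> \<open>A strictly positive bound, so that the affine rescaling to the unit interval
      can divide by \<open>2 * b\<close>.\<close>
    define b where "b = max B 0 + 1"
    have b: "b > 0" "\<And>x. x \<in> topspace X \<Longrightarrow> \<bar>f x\<bar> \<le> b"
      using B by (fastforce simp: b_def)+
    \<comment> \<open>A rescaled copy of \<open>f\<close>, restricted to the space because the
      members of \<open>M\<close> are extensional functions. It is one coordinate of the cube, and
      undoing the scaling on that coordinate extends \<open>f\<close>.\<close>
    define h where "h = (\<lambda>x\<in>topspace X. (f x + b) / (2 * b))"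
    have h01: "h x \<in> {0..1}" if "x \<in> topspace X" for x
      using b(1) b(2)[OF that] that by (auto simp: h_def field_simps abs_le_iff)
    have "continuous_map X euclideanreal (\<lambda>x. (f x + b) / (2 * b))"
      using b(1) f by (intro continuous_map_real_divide continuous_map_add) auto
    then have "continuous_map X euclideanreal h"
      by (rule continuous_map_eq) (simp add: h_def)
    moreover have "bounded (h ` topspace X)"
      using h01 by (intro bounded_subset[OF bounded_closed_interval[of 0 1]]) auto
    ultimately have hM: "h \<in> M"
      using h01 by (auto simp: M_def h_def)
    have "continuous_map K (top_of_set {0..1}) (\<lambda>k. k h)"
      unfolding K_def P_def by (rule continuous_map_from_subtopology[OF continuous_map_product_projection[OF hM]])
    then have "continuous_map K euclideanreal (\<lambda>k. k h)"
      using continuous_map_into_fulltopology by blast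
    then have "continuous_map K euclideanreal (\<lambda>k. 2 * b * k h - b)"
      by (intro continuous_map_diff continuous_map_real_mult) auto
    moreover have "2 * b * E x h - b = f x" if "x \<in> topspace X" for x
      using that hM b(1) by (simp add: E_def h_def)
    ultimately show "\<exists>g. continuous_map K euclideanreal g \<and> (\<forall>x\<in>topspace X. g (E x) = f x)"
      by (intro exI[of _ "\<lambda>k. 2 * b * k h - b"]) auto
  qed (use K in auto)
  then show ?thesis by blast
qed

text \<open>A point of the compactification is determined by the subsets of the original space
  that accumulate at it, which brings the compactification down to a type of sets of sets.\<close>

lemma stone_cech_exists:
  fixes X :: "'a topology"
  assumes "tychonoff_space X"
  shows "\<exists>(K :: 'a set set topology) e. stone_cech X K e"
proof -
  obtain K :: "(('a \<Rightarrow> real) \<Rightarrow> real) topology" and e where sc: "stone_cech X K e"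
    using stone_cech_exists_function_space[OF assms] by blast
  note sc' = stone_cechD[OF sc]
  define \<rho> where "\<rho> p = {A. A \<subseteq> topspace X \<and> p \<in> K closure_of (e ` A)}" for p
  have inj: "inj_on \<rho> (topspace K)"
  proof (rule inj_onI, rule ccontr)
    fix p q assume pq: "p \<in> topspace K" "q \<in> topspace K" "\<rho> p = \<rho> q" "p \<noteq> q"
    obtain U V where UV: "openin K U" "openin K V" "p \<in> U" "q \<in> V" "disjnt U V"
      using sc'(2) pq unfolding Hausdorff_space_def by metis
    \<comment> \<open>The trace of a neighbourhood of \<open>p\<close> that misses a neighbourhood
      of \<open>q\<close>: it accumulates at \<open>p\<close> but not at \<open>q\<close>, so it
      distinguishes \<open>\<rho> p\<close> from \<open>\<rho> q\<close>.\<close>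
    define A where "A = {x \<in> topspace X. e x \<in> U}"
    have eA: "e ` A = U \<inter> e ` topspace X" by (auto simp: A_def)
    have "p \<in> K closure_of (U \<inter> e ` topspace X)"
      using openin_Int_closure_of_subset[OF UV(1), of "e ` topspace X"] sc'(7) UV(3) pq(1) by auto
    then have "A \<in> \<rho> p" by (auto simp: \<rho>_def eA) (simp add: A_def)
    then have "A \<in> \<rho> q" using pq(3) by simp
    then have "q \<in> K closure_of (e ` A)" by (simp add: \<rho>_def)
    then obtain y where "y \<in> e ` A" "y \<in> V" using UV(2,4) unfolding in_closure_of by blast
    then show False using UV(5) by (auto simp: A_def disjnt_iff)
  qed
  define r where "r = inv_into (topspace K) \<rho>"
  define K' where "K' = pullback_topology (\<rho> ` topspace K) r K"
  have rim: "r ` \<rho> ` topspace K = topspace K"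
    unfolding r_def using inj by (simp add: inv_into_image_cancel)
  have "inj_on r (\<rho> ` topspace K)"
    unfolding r_def by (rule inj_on_inv_into) simp
  then have "homeomorphic_map K' K r"
    using homeomorphic_map_pullback_topology[of r "\<rho> ` topspace K" K] rim by (simp add: K'_def)
  then obtain r' where "homeomorphic_maps K' K r r'" using homeomorphic_map_maps by blast
  then have "homeomorphic_map K K' r'" using homeomorphic_map_maps homeomorphic_maps_sym by blast
  from stone_cech_homeomorphic[OF sc this] show ?thesis by blast
qed

section \<open>Spaces made of disjoint open cells and one further point\<close>

lemma compact_imp_countably_compact_space: "compact_space X \<Longrightarrow> countably_compact_space X"
  unfolding countably_compact_space_def compact_space_alt by blast

text \<open>Points chosen outside \<open>U\<close> in infinitely many different cells would have a
  cluster point. It is not \<open>z\<close>, and the open cell around any other point contains at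
  most one of the chosen points.\<close>

lemma finite_cells_outside_nbhd:
  fixes C :: "'q \<Rightarrow> 'a set"
  assumes X: "countably_compact_space X"
    and disj: "\<And>p q. p \<in> Q \<Longrightarrow> q \<in> Q \<Longrightarrow> p \<noteq> q \<Longrightarrow> C p \<inter> C q = {}"
    and opn: "\<And>q. q \<in> Q \<Longrightarrow> openin X (C q)"
    and top: "topspace X = insert z (\<Union>q\<in>Q. C q)"
    and U: "openin X U" "z \<in> U"
  shows "finite {q \<in> Q. \<not> C q \<subseteq> U}"
proof (rule ccontr)
  assume "infinite {q \<in> Q. \<not> C q \<subseteq> U}"
  then obtain q :: "nat \<Rightarrow> 'q" where q: "inj q" "range q \<subseteq> {q \<in> Q. \<not> C q \<subseteq> U}"
    using infinite_countable_subset by blast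
  then have "\<forall>n. \<exists>x. x \<in> C (q n) - U" by blast
  then obtain s where s: "\<And>n. s n \<in> C (q n) - U" by metis
  have qQ: "q n \<in> Q" for n using q(2) by blast
  have "s n \<in> topspace X" for n using s[of n] qQ[of n] top by blast
  from countably_compact_cluster_point[of X s, OF X this]
  obtain x where x: "x \<in> topspace X" and cl: "\<And>U. openin X U \<Longrightarrow> x \<in> U \<Longrightarrow> infinite {n. s n \<in> U}"
    by blast
  have "x \<noteq> z"
  proof
    assume "x = z"
    with cl[OF U(1)] U(2) have "infinite {n. s n \<in> U}" by blast
    moreover have "{n. s n \<in> U} = {}" using s by blast
    ultimately show False by simp
  qed
  then obtain p where p: "p \<in> Q" "x \<in> C p" using x top by blast
  have inf: "infinite {n. s n \<in> C p}" using cl[OF opn[OF p(1)] p(2)] .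
  have eq: "q n = p" if "n \<in> {n. s n \<in> C p}" for n
    using disj[OF qQ p(1)] s[of n] that by blast
  obtain n where n: "n \<in> {n. s n \<in> C p}" by (rule infinite_natset_gt[OF inf])
  obtain n' where n': "n' \<in> {n. s n \<in> C p}" "n < n'" by (rule infinite_natset_gt[OF inf])
  show False using eq[OF n] eq[OF n'(1)] n'(2) q(1) by (metis injD less_irrefl)
qed

text \<open>Since only finitely many cells leave a given neighbourhood of \<open>z\<close>, continuity at \<open>z\<close> is
  automatic for a map that is finite-to-one on cells.\<close>

lemma continuous_map_cellwise:
  fixes C :: "'q \<Rightarrow> 'a set"
  assumes X: "countably_compact_space X"
    and disj: "\<And>p q. p \<in> Q \<Longrightarrow> q \<in> Q \<Longrightarrow> p \<noteq> q \<Longrightarrow> C p \<inter> C q = {}"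
    and opn: "\<And>q. q \<in> Q \<Longrightarrow> openin X (C q)" and cls: "\<And>q. q \<in> Q \<Longrightarrow> closedin X (C q)"
    and top: "topspace X = insert z (\<Union>q\<in>Q. C q)"
    and fz: "f z = z"
    and cont: "\<And>q. q \<in> Q \<Longrightarrow> continuous_map (subtopology X (C q)) X f"
    and cell: "\<And>q. q \<in> Q \<Longrightarrow> f ` C q \<subseteq> {z} \<or> r q \<in> Q \<and> f ` C q \<subseteq> C (r q)"
    and inj: "inj_on r {q \<in> Q. \<not> f ` C q \<subseteq> {z}}"
  shows "continuous_map X X f"
proof -
  have sub: "C q \<subseteq> topspace X" if "q \<in> Q" for q using top that by blast
  have fX: "f x \<in> topspace X" if "x \<in> topspace X" for x
  proof (cases "x = z")
    case False
    then have "x \<in> (\<Union>q\<in>Q. C q)" using that by (simp add: top)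
    then obtain q where q: "q \<in> Q" "x \<in> C q" by blast
    then have "f x = z \<or> r q \<in> Q \<and> f x \<in> C (r q)" using cell[OF q(1)] by blast
    then show ?thesis using top by auto
  qed (use fz that in simp)
  have pre: "openin X {x \<in> C q. f x \<in> W}" if "q \<in> Q" "openin X W" for q W
  proof -
    have "openin (subtopology X (C q)) {x \<in> topspace (subtopology X (C q)). f x \<in> W}"
      using openin_continuous_map_preimage[OF cont[OF that(1)] that(2)] .
    moreover have "topspace (subtopology X (C q)) = C q" using sub[OF that(1)] by auto
    ultimately have "openin (subtopology X (C q)) {x \<in> C q. f x \<in> W}" by (simp only:)
    then show ?thesis using opn[OF that(1)] by (rule openin_trans_full)
  qed
  have "openin X {x \<in> topspace X. f x \<in> W}" if W: "openin X W" for W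
  proof (cases "z \<in> W")
    case False
    have "{x \<in> topspace X. f x \<in> W} = (\<Union>q\<in>Q. {x \<in> C q. f x \<in> W})"
      using top fz False by auto
    moreover have "openin X (\<Union>q\<in>Q. {x \<in> C q. f x \<in> W})"
      using pre[OF _ W] by (intro openin_Union) blast
    ultimately show ?thesis by simp
  next
    case True
    \<comment> \<open>Only these cells can obstruct openness at \<open>z\<close>. Their targets
      under \<open>r\<close> leave \<open>W\<close> as well and are therefore finite in number, and
      injectivity of \<open>r\<close> makes \<open>Q1\<close> finite.\<close>
    define Q1 where "Q1 = {q \<in> Q. \<not> f ` C q \<subseteq> W}"
    have fin: "finite {q \<in> Q. \<not> C q \<subseteq> W}"
      by (rule finite_cells_outside_nbhd[OF X disj opn top W True])
    have 1: "Q1 \<subseteq> {q \<in> Q. \<not> f ` C q \<subseteq> {z}}" using True by (auto simp: Q1_def)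
    have "r ` Q1 \<subseteq> {q \<in> Q. \<not> C q \<subseteq> W}"
    proof
      fix p assume "p \<in> r ` Q1"
      then obtain q where q: "q \<in> Q" "\<not> f ` C q \<subseteq> W" "p = r q" by (auto simp: Q1_def)
      then have "r q \<in> Q" "f ` C q \<subseteq> C (r q)" using cell[OF q(1)] True by auto
      then show "p \<in> {q \<in> Q. \<not> C q \<subseteq> W}" using q by auto
    qed
    then have "finite (r ` Q1)" using fin finite_subset by blast
    then have "finite Q1" using inj_on_subset[OF inj 1] finite_imageD by blast
    have "closedin X {x \<in> C q. f x \<notin> W}" if q: "q \<in> Q" for q
    proof -
      have "{x \<in> C q. f x \<notin> W} = C q - {x \<in> C q. f x \<in> W}" by auto
      then show ?thesis using pre[OF q W] cls[OF q] by (simp add: closedin_diff)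
    qed
    then have "closedin X (\<Union>q\<in>Q1. {x \<in> C q. f x \<notin> W})"
      using \<open>finite Q1\<close> by (intro closedin_Union) (auto simp: Q1_def)
    moreover have "{x \<in> topspace X. f x \<in> W} = topspace X - (\<Union>q\<in>Q1. {x \<in> C q. f x \<notin> W})"
      using top fz True by (auto simp: Q1_def)
    ultimately show ?thesis by (simp add: openin_diff)
  qed
  then show ?thesis using fX by (auto simp: continuous_map_def)
qed

section \<open>Keeping zero out of the closure of a maximal subgroup\<close>

locale group_in_semigroup = group G for G (structure) +
  fixes X :: "'a topology" and m :: "'a \<Rightarrow> 'a \<Rightarrow> 'a" and z :: 'a
  assumes semitop: "semitopological_semigroup X m"
    and regular: "regular_space X"
    and countably_compact: "countably_compact_space X"
    and mult_eq: "x \<in> carrier G \<Longrightarrow> y \<in> carrier G \<Longrightarrow> m x y = x \<otimes> y"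
    and open_group: "openin X (carrier G)"
    and closed_group: "closedin X (insert z (carrier G))"
    and z: "z \<notin> carrier G" "m z z = z" "x \<in> carrier G \<Longrightarrow> m x z = z"
begin

lemma group_subset: "carrier G \<subseteq> topspace X"
  using open_group openin_subset by blast

lemma zX: "z \<in> topspace X"
  using closed_group closedin_subset by blast

lemma contL: "a \<in> topspace X \<Longrightarrow> continuous_map X X (m a)"
  using semitop by (simp add: semitopological_semigroup_def)

lemma contR: "a \<in> topspace X \<Longrightarrow> continuous_map X X (\<lambda>x. m x a)"
  using semitop by (simp add: semitopological_semigroup_def)

lemma closed_groupI:
  assumes "z \<notin> X closure_of (carrier G)"
  shows "closedin X (carrier G)"
proof -
  have "X closure_of (carrier G) \<subseteq> insert z (carrier G)"
    using closed_group by (intro closure_of_minimal) auto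
  then have "X closure_of (carrier G) \<subseteq> carrier G" using assms by blast
  then show ?thesis using group_subset closure_of_subset_eq by blast
qed

text \<open>Multiplication by \<open>inv f\<close> is continuous, undoes the translation and fixes
  \<open>z\<close>; it would carry \<open>z\<close> back into the closure of
  \<open>U\<close>.\<close>

lemma z_notin_closure_translate:
  assumes U: "U \<subseteq> carrier G" "z \<notin> X closure_of U" and f: "f \<in> carrier G"
  shows "z \<notin> X closure_of (m f ` U)"
proof
  assume "z \<in> X closure_of (m f ` U)"
  then have "m (inv f) z \<in> m (inv f) ` (X closure_of (m f ` U))" by blast
  moreover have "m (inv f) ` (X closure_of (m f ` U)) \<subseteq> X closure_of (m (inv f) ` m f ` U)"
    using f group_subset by (intro continuous_map_image_closure_subset contL) auto
  moreover have "m (inv f) ` m f ` U = U"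
  proof -
    have "m (inv f) (m f x) = x" if "x \<in> U" for x
      using that U f by (auto simp: mult_eq m_assoc[symmetric])
    then show ?thesis by (simp add: image_comp)
  qed
  ultimately show False using U f z by auto
qed

lemma small_nbhd_of_one:
  obtains U where "U \<subseteq> carrier G" "openin X U" "\<one> \<in> U" "X closure_of U \<subseteq> carrier G"
proof -
  obtain U where U: "openin X U" "\<one> \<in> U" "X closure_of U \<subseteq> carrier G"
    by (rule regular_space_shrink[OF regular open_group one_closed])
  then show thesis using that openin_subset_closure_of[OF U(1)] by blast
qed

text \<open>By regularity the unit has a neighbourhood whose closure avoids \<open>z\<close>. Its
  translates do so too, and finitely many of them exhaust the group, with closure commuting with
  finite unions.\<close>

lemma closed_if_left_precompact:
  assumes "left_precompact (subtopology X (carrier G)) m \<one>"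
  shows "closedin X (carrier G)"
proof (rule closed_groupI)
  obtain U where U: "U \<subseteq> carrier G" "openin X U" "\<one> \<in> U" "X closure_of U \<subseteq> carrier G"
    by (rule small_nbhd_of_one)
  have "openin (subtopology X (carrier G)) U" using U by (auto simp: openin_subtopology)
  then have "U \<subseteq> topspace (subtopology X (carrier G)) \<and>
      (\<exists>V. openin (subtopology X (carrier G)) V \<and> \<one> \<in> V \<and> V \<subseteq> U)"
    using U(3) openin_subset by blast
  from assms[unfolded left_precompact_def, rule_format, OF this]
  obtain F where F: "finite F" "F \<subseteq> carrier G" "(\<Union>f\<in>F. m f ` U) = carrier G"
    using group_subset by (auto simp: Int_absorb1)
  have "X closure_of (carrier G) = (\<Union>f\<in>F. X closure_of (m f ` U))"
    unfolding F(3)[symmetric] using F(1) by (simp add: closure_of_Union image_image)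
  then show "z \<notin> X closure_of (carrier G)"
    using z_notin_closure_translate[OF U(1)] U(4) z F(2) by blast
qed

text \<open>Closure does not commute with countable unions, so pseudocompactness steps in.
  Neighbourhoods \<open>W n\<close> of \<open>z\<close> are shrunk past one translate after another;
  if \<open>z\<close> were a limit point of the group, their traces would be non-empty, open and
  locally finite.\<close>

lemma closed_if_left_omega_precompact:
  assumes prec: "left_omega_precompact (subtopology X (carrier G)) m \<one>"
    and pseudo: "pseudocompact_space (subtopology X (carrier G))"
  shows "closedin X (carrier G)"
proof (rule closed_groupI, rule notI)
  assume zcl: "z \<in> X closure_of (carrier G)"
  obtain U where U: "U \<subseteq> carrier G" "openin X U" "\<one> \<in> U" "X closure_of U \<subseteq> carrier G"
    by (rule small_nbhd_of_one)
  have "openin (subtopology X (carrier G)) U" using U by (auto simp: openin_subtopology)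
  then have "U \<subseteq> topspace (subtopology X (carrier G)) \<and>
      (\<exists>V. openin (subtopology X (carrier G)) V \<and> \<one> \<in> V \<and> V \<subseteq> U)"
    using U(3) openin_subset by blast
  from prec[unfolded left_omega_precompact_def, rule_format, OF this]
  obtain F where F: "countable F" "F \<subseteq> carrier G" "(\<Union>f\<in>F. m f ` U) = carrier G"
    using group_subset by (auto simp: Int_absorb1)
  have "F \<noteq> {}" using F(3) one_closed by blast
  define c where "c = from_nat_into F"
  have c: "range c = F" unfolding c_def using F(1) \<open>F \<noteq> {}\<close> by (simp add: range_from_nat_into)
  define N where "N n = topspace X - X closure_of (m (c n) ` U)" for n
  have N: "openin X (N n)" "z \<in> N n" for n
    using z_notin_closure_translate[OF U(1), of "c n"] U(4) z(1) c F(2) zX by (auto simp: N_def)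
  define P where "P W \<longleftrightarrow> openin X W \<and> z \<in> W" for W
  have "\<exists>W. \<forall>n. P (W n) \<and> X closure_of (W (Suc n)) \<subseteq> W n \<inter> N n"
  proof (rule dependent_nat_choice)
    show "\<exists>W. P W" using zX openin_topspace by (auto simp: P_def)
  next
    fix W n assume "P W"
    then have "openin X (W \<inter> N n)" "z \<in> W \<inter> N n" using N by (auto simp: P_def)
    then obtain W' where "openin X W'" "z \<in> W'" "X closure_of W' \<subseteq> W \<inter> N n"
      by (rule regular_space_shrink[OF regular])
    then show "\<exists>W'. P W' \<and> X closure_of W' \<subseteq> W \<inter> N n" by (auto simp: P_def)
  qed
  then obtain W where "\<forall>n. P (W n) \<and> X closure_of (W (Suc n)) \<subseteq> W n \<inter> N n" ..
  then have W: "openin X (W n)" "z \<in> W n" "X closure_of (W (Suc n)) \<subseteq> W n \<inter> N n" for n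
    by (auto simp: P_def)
  have dec: "W (Suc n) \<subseteq> W n" for n
    using W(3)[of n] openin_subset_closure_of[OF W(1)[of "Suc n"]] by blast
  have mono: "m \<le> n \<Longrightarrow> W n \<subseteq> W m" for m n
    by (rule lift_Suc_antimono_le[of W]) (rule dec)
  have out: "\<exists>n. x \<notin> X closure_of (W n)" if x: "x \<in> carrier G" for x
  proof -
    obtain n where n: "x \<in> m (c n) ` U" using F(3) c x by blast
    have "m (c n) ` U \<subseteq> topspace X"
      using F(3) c group_subset by blast
    then have "x \<in> X closure_of (m (c n) ` U)" using n closure_of_subset by blast
    then have "x \<notin> X closure_of (W (Suc n))" using W(3)[of n] by (auto simp: N_def)
    then show ?thesis ..
  qed
  define \<A> where "\<A> = range (\<lambda>n. W n \<inter> carrier G)"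
  have ne: "W n \<inter> carrier G \<noteq> {}" for n
    using zcl W(1,2)[of n] unfolding in_closure_of by blast
  have "finite \<A>"
  proof (rule pseudo[unfolded pseudocompact_space_def, rule_format], intro conjI ballI)
    fix A assume "A \<in> \<A>"
    then obtain n where "A = W n \<inter> carrier G" by (auto simp: \<A>_def)
    then show "openin (subtopology X (carrier G)) A" "A \<noteq> {}"
      using W(1) ne by (auto simp: openin_subtopology)
  next
    show "locally_finite_family (subtopology X (carrier G)) \<A>"
      unfolding locally_finite_family_def
    proof
      fix x assume "x \<in> topspace (subtopology X (carrier G))"
      then have x: "x \<in> carrier G" by auto
      obtain n where n: "x \<notin> X closure_of (W n)" using out[OF x] by blast
      define O' where "O' = (topspace X - X closure_of (W n)) \<inter> carrier G"
      have "W k \<inter> O' = {}" if "n \<le> k" for k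
        using mono[OF that] openin_subset_closure_of[OF W(1)[of n]] by (auto simp: O'_def)
      then have "{A \<in> \<A>. A \<inter> O' \<noteq> {}} \<subseteq> (\<lambda>n. W n \<inter> carrier G) ` {..<n}"
        unfolding \<A>_def using not_le by blast
      then have "finite {A \<in> \<A>. A \<inter> O' \<noteq> {}}" by (rule finite_subset) simp
      moreover have "openin (subtopology X (carrier G)) O'"
        unfolding O'_def by (intro openin_subtopology_Int openin_diff) auto
      moreover have "x \<in> O'" using x n group_subset by (auto simp: O'_def)
      ultimately show "\<exists>V. openin (subtopology X (carrier G)) V \<and> x \<in> V \<and> finite {A \<in> \<A>. A \<inter> V \<noteq> {}}"
        by blast
    qed
  qed
  \<comment> \<open>As a set the traces are finite, so one of them recurs for infinitely many
    indices. As \<open>W\<close> decreases, its points would lie in every \<open>W n\<close>,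
    against \<open>out\<close>.\<close>
  then obtain n0 where n0: "infinite {n \<in> UNIV. W n \<inter> carrier G = W n0 \<inter> carrier G}"
    unfolding \<A>_def using pigeonhole_infinite[of "UNIV :: nat set" "\<lambda>n. W n \<inter> carrier G"] by auto
  obtain x where x: "x \<in> W n0" "x \<in> carrier G" using ne[of n0] by blast
  obtain n where n: "x \<notin> X closure_of (W n)" using out[OF x(2)] by blast
  obtain k where k: "k \<in> {n \<in> UNIV. W n \<inter> carrier G = W n0 \<inter> carrier G}" "n < k"
    by (rule infinite_natset_gt[OF n0])
  then have "x \<in> W k" using x by blast
  show False
    using n \<open>x \<in> W k\<close> mono[OF less_imp_le[OF k(2)]] openin_subset_closure_of[OF W(1)[of n]] by blast
qed

text \<open>Since \<open>m z z = z\<close> differs from the unit, joint continuity gives a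
  neighbourhood \<open>N\<close> of \<open>z\<close> in which no two group elements are mutually
  inverse. If \<open>z\<close> were a limit point, the game would yield quotients
  \<open>inv x \<otimes> y\<close> close to \<open>z\<close>, whose inverses
  \<open>inv y \<otimes> x\<close> must then avoid \<open>N\<close>.\<close>

lemma closed_if_topological_semigroup:
  assumes "topological_semigroup (subtopology X (insert z (carrier G))) m"
  shows "closedin X (carrier G)"
proof (rule closed_groupI, rule notI)
  assume zcl: "z \<in> X closure_of (carrier G)"
  let ?Y = "subtopology X (insert z (carrier G))"
  have topY: "topspace ?Y = insert z (carrier G)" using group_subset zX by auto
  have cont: "continuous_map (prod_topology ?Y ?Y) ?Y (\<lambda>(x, y). m x y)" and Haus: "Hausdorff_space ?Y"
    using assms by (auto simp: topological_semigroup_def)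
  have "closedin ?Y {\<one>}"
    by (rule closedin_Hausdorff_singleton[OF Haus]) (simp only: topY, simp)
  then have "openin ?Y (topspace ?Y - {\<one>})"
    by (rule openin_diff[OF openin_topspace])
  from openin_continuous_map_preimage[OF cont this]
  have op: "openin (prod_topology ?Y ?Y) {p \<in> topspace (prod_topology ?Y ?Y). (case p of (x, y) \<Rightarrow> m x y) \<in> topspace ?Y - {\<one>}}"
    (is "openin _ ?S") .
  have "(z, z) \<in> ?S" using z zX by auto
  then obtain A B where AB: "openin ?Y A" "openin ?Y B" "z \<in> A" "z \<in> B" "A \<times> B \<subseteq> ?S"
    using op[unfolded openin_prod_topology_alt, rule_format, of z z] by blast
  then obtain A' B' where A': "openin X A'" "A = A' \<inter> insert z (carrier G)"
     and B': "openin X B'" "B = B' \<inter> insert z (carrier G)"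
    by (auto simp: openin_subtopology)
  define N where "N = A' \<inter> B'"
  have N: "openin X N" "z \<in> N" using A' B' AB by (auto simp: N_def)
  have N1: "x \<otimes> y \<noteq> \<one>" if "x \<in> N" "y \<in> N" "x \<in> carrier G" "y \<in> carrier G" for x y
  proof -
    have "(x, y) \<in> A \<times> B" using that A' B' by (auto simp: N_def)
    then have "(x, y) \<in> ?S" using AB(5) by blast
    then show ?thesis using mult_eq[OF that(3,4)] by auto
  qed
  obtain V where V: "openin X V" "z \<in> V" "X closure_of V \<subseteq> N"
    by (rule regular_space_shrink[OF regular N])
  have VN: "V \<subseteq> N" using V(3) openin_subset_closure_of[OF V(1)] by blast
  have "X closure_of V \<inter> (topspace X - N) \<noteq> {}"
  proof (rule double_limit_game[of X X X m _ _
        "\<lambda>S R. \<exists>O'. openin X O' \<and> z \<in> O' \<and> R = O' \<inter> carrier G \<and> S = (\<lambda>x. inv x) ` R"])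
    show "\<exists>O'. openin X O' \<and> z \<in> O' \<and> carrier G = O' \<inter> carrier G \<and> (\<lambda>x. inv x) ` carrier G = (\<lambda>x. inv x) ` carrier G"
      using zX group_subset by (intro exI[of _ "topspace X"]) auto
    show "S \<subseteq> topspace X \<and> R \<subseteq> topspace X"
      if "\<exists>O'. openin X O' \<and> z \<in> O' \<and> R = O' \<inter> carrier G \<and> S = (\<lambda>x. inv x) ` R" for S R
      using that group_subset by auto
  next
    fix S R assume "\<exists>O'. openin X O' \<and> z \<in> O' \<and> R = O' \<inter> carrier G \<and> S = (\<lambda>x. inv x) ` R"
    then obtain O' where O': "openin X O'" "z \<in> O'" "R = O' \<inter> carrier G" "S = (\<lambda>x. inv x) ` R"
      by (elim exE conjE)
    obtain x where x: "x \<in> R" "x \<in> carrier G"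
      using zcl O'(1,2,3) unfolding in_closure_of by blast
    have ix: "inv x \<in> topspace X" using x group_subset by auto
    \<comment> \<open>Still a neighbourhood of \<open>z\<close>, because
      \<open>m (inv x) z = z\<close>. This is why the play can be continued with group elements
      arbitrarily close to \<open>z\<close>.\<close>
    define O1 where "O1 = O' \<inter> {y \<in> topspace X. m (inv x) y \<in> V}"
    define R1 where "R1 = O1 \<inter> carrier G"
    have "openin X O1"
      unfolding O1_def using O'(1) V(1) contL[OF ix] by (intro openin_Int openin_continuous_map_preimage) auto
    moreover have "z \<in> O1" using O'(2) V(2) zX z(3) x by (simp add: O1_def)
    moreover have R1: "R1 \<subseteq> R" using O'(3) by (auto simp: R1_def O1_def)
    moreover have "m (inv x) y \<in> X closure_of V" if "y \<in> R1" for y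
      using that openin_subset_closure_of[OF V(1)] by (auto simp: R1_def O1_def)
    moreover have "m (inv y) x \<in> topspace X - N" if y: "y \<in> R1" for y
    proof -
      have yc: "y \<in> carrier G" and "inv x \<otimes> y \<in> N"
        using y VN x by (auto simp: R1_def O1_def mult_eq)
      then have "inv y \<otimes> x \<notin> N"
        using N1[of "inv x \<otimes> y" "inv y \<otimes> x"] x by (auto simp: m_assoc[symmetric]) (simp add: m_assoc)
      then show ?thesis using yc x group_subset by (auto simp: mult_eq)
    qed
    ultimately show "\<exists>S' R' a b. (\<exists>O'. openin X O' \<and> z \<in> O' \<and> R' = O' \<inter> carrier G \<and> S' = (\<lambda>x. inv x) ` R')
        \<and> S' \<subseteq> S \<and> R' \<subseteq> R \<and> a \<in> S \<and> b \<in> R \<and> (\<forall>x'\<in>S'. m x' b \<in> topspace X - N) \<and> (\<forall>y'\<in>R'. m a y' \<in> X closure_of V)"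
      using x O'(4)
      by (intro exI[of _ "(\<lambda>x. inv x) ` R1"] exI[of _ R1] exI[of _ "inv x"] exI[of _ x] conjI exI[of _ O1])
         (auto simp: R1_def)
  qed (use countably_compact contL contR N in \<open>auto intro: closedin_diff\<close>)
  then show False using V(3) by blast
qed

end

section \<open>Algebra of orthogonal sums of Brandt semigroups\<close>

lemma osum_mult_simps [simp]:
  "osum_mult H None y = None"
  "osum_mult H x None = None"
  "osum_mult H (Some (i, a, g, b)) (Some (j, c, h, d)) =
     (if i = j \<and> b = c then Some (i, a, g \<otimes>\<^bsub>H i\<^esub> h, d) else None)"
  by (auto simp: osum_mult_def split: option.splits)

lemma osum_carrier_simps [simp]:
  "None \<in> osum_carrier I L H"
  "Some (i, a, g, b) \<in> osum_carrier I L H \<longleftrightarrow> i \<in> I \<and> a \<in> L i \<and> b \<in> L i \<and> g \<in> carrier (H i)"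
  by (auto simp: osum_carrier_def)

lemma osum_carrier_cases:
  assumes "x \<in> osum_carrier I L H"
  obtains "x = None" | i a g b where "x = Some (i, a, g, b)" "i \<in> I" "a \<in> L i" "b \<in> L i" "g \<in> carrier (H i)"
  using assms by (auto simp: osum_carrier_def)

lemma osum_mult_closed:
  assumes "\<And>i. i \<in> I \<Longrightarrow> group (H i)" "x \<in> osum_carrier I L H" "y \<in> osum_carrier I L H"
  shows "osum_mult H x y \<in> osum_carrier I L H"
  using assms(2,3)
  by (elim osum_carrier_cases) (auto simp: assms(1) group.is_monoid monoid.m_closed)

lemma osum_mult_assoc:
  assumes "\<And>i. i \<in> I \<Longrightarrow> group (H i)" "x \<in> osum_carrier I L H" "y \<in> osum_carrier I L H" "z \<in> osum_carrier I L H"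
  shows "osum_mult H (osum_mult H x y) z = osum_mult H x (osum_mult H y z)"
  using assms(2,3,4)
  by (elim osum_carrier_cases) (auto simp: assms(1) group.is_monoid monoid.m_assoc)

text \<open>For a non-zero element the equation \<open>x y x = x\<close> alone pins down
  \<open>y\<close>: the product does not vanish, which fixes the indices, and cancellation in the
  group fixes the middle component.\<close>

lemma osum_inverse_unique:
  assumes H: "\<And>i. i \<in> I \<Longrightarrow> group (H i)"
    and x: "i \<in> I" "a \<in> L i" "b \<in> L i" "g \<in> carrier (H i)"
    and y: "y \<in> osum_carrier I L H" "osum_mult H (osum_mult H (Some (i, a, g, b)) y) (Some (i, a, g, b)) = Some (i, a, g, b)"
  shows "y = Some (i, b, inv\<^bsub>H i\<^esub> g, a)"
proof -
  interpret group "H i" using H x(1) .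
  from y(1) show ?thesis
  proof (cases rule: osum_carrier_cases)
    case (2 j c h d)
    then have eq: "j = i" "c = b" "d = a" "g \<otimes>\<^bsub>H i\<^esub> h \<otimes>\<^bsub>H i\<^esub> g = g"
      using y(2) by (auto split: if_splits)
    then have hc: "h \<in> carrier (H i)" using 2 by simp
    then have "(g \<otimes>\<^bsub>H i\<^esub> h) \<otimes>\<^bsub>H i\<^esub> g = \<one>\<^bsub>H i\<^esub> \<otimes>\<^bsub>H i\<^esub> g" using eq(4) x(4) by simp
    then have "g \<otimes>\<^bsub>H i\<^esub> h = \<one>\<^bsub>H i\<^esub>" using hc x(4) by (simp add: right_cancel)
    then have "h = inv\<^bsub>H i\<^esub> g" using hc x(4) by (metis inv_comm inv_equality)
    then show ?thesis using 2 eq by simp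
  qed (use y(2) in simp)
qed

lemma osum_inverse_laws:
  assumes H: "group (H i)" and g: "g \<in> carrier (H i)"
  shows "osum_mult H (osum_mult H (Some (i, a, g, b)) (Some (i, b, inv\<^bsub>H i\<^esub> g, a))) (Some (i, a, g, b)) = Some (i, a, g, b)"
    and "osum_mult H (osum_mult H (Some (i, b, inv\<^bsub>H i\<^esub> g, a)) (Some (i, a, g, b))) (Some (i, b, inv\<^bsub>H i\<^esub> g, a)) = Some (i, b, inv\<^bsub>H i\<^esub> g, a)"
proof -
  interpret group "H i" by (rule H)
  show "osum_mult H (osum_mult H (Some (i, a, g, b)) (Some (i, b, inv\<^bsub>H i\<^esub> g, a))) (Some (i, a, g, b)) = Some (i, a, g, b)"
    "osum_mult H (osum_mult H (Some (i, b, inv\<^bsub>H i\<^esub> g, a)) (Some (i, a, g, b))) (Some (i, b, inv\<^bsub>H i\<^esub> g, a)) = Some (i, b, inv\<^bsub>H i\<^esub> g, a)"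
    using g by simp_all
qed

lemma primitive_inverse_osum:
  assumes H: "\<And>i. i \<in> I \<Longrightarrow> group (H i)"
  shows "primitive_inverse_semigroup (osum_carrier I L H) (osum_mult H)"
proof -
  let ?A = "osum_carrier I L H" and ?m = "osum_mult H"
  have sg: "semigroup_on ?A ?m"
    unfolding semigroup_on_def using osum_mult_closed[where I = I and H = H and L = L, OF H] osum_mult_assoc[where I = I and H = H and L = L, OF H] by simp
  have ex1: "\<exists>!y. y \<in> ?A \<and> ?m (?m x y) x = x \<and> ?m (?m y x) y = y" if "x \<in> ?A" for x
    using that
  proof (cases rule: osum_carrier_cases)
    case 1
    then show ?thesis by (intro ex1I[of _ None]) auto
  next
    case (2 i a g b)
    show ?thesis
    proof (rule ex1I[of _ "Some (i, b, inv\<^bsub>H i\<^esub> g, a)"])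
      show "Some (i, b, inv\<^bsub>H i\<^esub> g, a) \<in> ?A \<and> ?m (?m x (Some (i, b, inv\<^bsub>H i\<^esub> g, a))) x = x \<and>
          ?m (?m (Some (i, b, inv\<^bsub>H i\<^esub> g, a)) x) (Some (i, b, inv\<^bsub>H i\<^esub> g, a)) = Some (i, b, inv\<^bsub>H i\<^esub> g, a)"
        using 2 osum_inverse_laws[of H i g] H by (simp add: group.inv_closed)
    next
      fix y assume y: "y \<in> ?A \<and> ?m (?m x y) x = x \<and> ?m (?m y x) y = y"
      show "y = Some (i, b, inv\<^bsub>H i\<^esub> g, a)"
        by (rule osum_inverse_unique[where I = I and H = H and L = L, OF H]) (use 2 y in simp_all)
    qed
  qed
  \<comment> \<open>Non-zero idempotents are the units on the diagonal. If two of them have a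
    non-zero product, their indices agree, and this is primitivity.\<close>
  have idem: "\<exists>i a. x = Some (i, a, \<one>\<^bsub>H i\<^esub>, a) \<and> i \<in> I" if x: "x \<in> ?A" "?m x x = x" "x \<noteq> None" for x
    using x(1)
  proof (cases rule: osum_carrier_cases)
    case (2 i a g b)
    interpret group "H i" using H 2 by simp
    have "a = b" "g \<otimes>\<^bsub>H i\<^esub> g = g" using x(2) 2 by (auto split: if_splits)
    then have "g = \<one>\<^bsub>H i\<^esub>" using 2(5) by (metis l_cancel_one)
    then show ?thesis using 2 \<open>a = b\<close> by blast
  qed (use x in simp)
  have "is_zero ?A ?m None" by (simp add: is_zero_def)
  moreover have "f = e" if "e \<in> ?A" "f \<in> ?A" "?m e e = e" "e \<noteq> None" "?m f f = f" "f \<noteq> None" "?m e f = f" for e f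
    using idem[OF that(1,3,4)] idem[OF that(2,5,6)] that(7) by (auto split: if_splits)
  ultimately show ?thesis
    unfolding primitive_inverse_semigroup_def inverse_semigroup_def using sg ex1 by blast
qed

lemma osum_inverse:
  assumes H: "\<And>i. i \<in> I \<Longrightarrow> group (H i)"
    and x: "i \<in> I" "a \<in> L i" "b \<in> L i" "g \<in> carrier (H i)"
  shows "semigroup_inverse (osum_carrier I L H) (osum_mult H) (Some (i, a, g, b)) = Some (i, b, inv\<^bsub>H i\<^esub> g, a)"
  unfolding semigroup_inverse_def
proof (rule the_equality)
  show "Some (i, b, inv\<^bsub>H i\<^esub> g, a) \<in> osum_carrier I L H \<and>
     osum_mult H (osum_mult H (Some (i, a, g, b)) (Some (i, b, inv\<^bsub>H i\<^esub> g, a))) (Some (i, a, g, b)) = Some (i, a, g, b) \<and>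
     osum_mult H (osum_mult H (Some (i, b, inv\<^bsub>H i\<^esub> g, a)) (Some (i, a, g, b))) (Some (i, b, inv\<^bsub>H i\<^esub> g, a)) = Some (i, b, inv\<^bsub>H i\<^esub> g, a)"
    using x osum_inverse_laws[of H i g] H by (simp add: group.inv_closed)
next
  fix y assume y: "y \<in> osum_carrier I L H \<and>
     osum_mult H (osum_mult H (Some (i, a, g, b)) y) (Some (i, a, g, b)) = Some (i, a, g, b) \<and>
     osum_mult H (osum_mult H y (Some (i, a, g, b))) y = y"
  show "y = Some (i, b, inv\<^bsub>H i\<^esub> g, a)"
    by (rule osum_inverse_unique[where I = I and H = H and L = L, OF H]) (use x y in simp_all)
qed

lemma osum_inverse_None:
  "semigroup_inverse (osum_carrier I L H) (osum_mult H) None = None"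
  unfolding semigroup_inverse_def by (rule the_equality) auto

section \<open>Transport of the algebraic structure along an isomorphism\<close>

locale magma_isomorphism =
  fixes A :: "'a set" and m :: "'a \<Rightarrow> 'a \<Rightarrow> 'a" and B :: "'b set" and m' :: "'b \<Rightarrow> 'b \<Rightarrow> 'b" and f :: "'a \<Rightarrow> 'b"
  assumes bij: "bij_betw f A B"
    and hom: "x \<in> A \<Longrightarrow> y \<in> A \<Longrightarrow> f (m x y) = m' (f x) (f y)"
    and closed: "x \<in> A \<Longrightarrow> y \<in> A \<Longrightarrow> m x y \<in> A"
begin

lemma fB: "x \<in> A \<Longrightarrow> f x \<in> B"
  using bij by (auto simp: bij_betw_def)

lemma f_eq: "x \<in> A \<Longrightarrow> y \<in> A \<Longrightarrow> f x = f y \<longleftrightarrow> x = y"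
  using bij by (auto simp: bij_betw_def inj_on_def)

lemma ball_B: "(\<forall>y\<in>B. P y) \<longleftrightarrow> (\<forall>x\<in>A. P (f x))"
  using bij by (auto simp: bij_betw_def)

lemma inverse_iff:
  assumes "x \<in> A" "y \<in> A"
  shows "m' (m' (f x) (f y)) (f x) = f x \<and> m' (m' (f y) (f x)) (f y) = f y \<longleftrightarrow> m (m x y) x = x \<and> m (m y x) y = y"
  using assms by (simp add: hom[symmetric] closed f_eq)

lemma ex1_inverse:
  assumes x: "x \<in> A" and ex1: "\<exists>!y. y \<in> A \<and> m (m x y) x = x \<and> m (m y x) y = y"
  shows "\<exists>!y. y \<in> B \<and> m' (m' (f x) y) (f x) = f x \<and> m' (m' y (f x)) y = y"
    and "semigroup_inverse B m' (f x) = f (semigroup_inverse A m x)"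
proof -
  let ?y = "semigroup_inverse A m x"
  have y: "?y \<in> A \<and> m (m x ?y) x = x \<and> m (m ?y x) ?y = ?y"
    unfolding semigroup_inverse_def by (rule theI'[OF ex1])
  have 1: "f ?y \<in> B \<and> m' (m' (f x) (f ?y)) (f x) = f x \<and> m' (m' (f ?y) (f x)) (f ?y) = f ?y"
    using y x fB inverse_iff by blast
  have 2: "w = f ?y" if w: "w \<in> B \<and> m' (m' (f x) w) (f x) = f x \<and> m' (m' w (f x)) w = w" for w
  proof -
    obtain v where v: "v \<in> A" "w = f v" using w bij by (auto simp: bij_betw_def)
    then have "m (m x v) x = x \<and> m (m v x) v = v" using w inverse_iff[OF x v(1)] by simp
    then have "v = ?y" using ex1 y v(1) by blast
    then show ?thesis using v by simp
  qed
  show "\<exists>!y. y \<in> B \<and> m' (m' (f x) y) (f x) = f x \<and> m' (m' y (f x)) y = y"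
    using 1 2 by (rule ex1I)
  show "semigroup_inverse B m' (f x) = f ?y"
    unfolding semigroup_inverse_def[of B] using 1 2 by (rule the_equality)
qed

lemma semigroup_on_transport: "semigroup_on A m \<Longrightarrow> semigroup_on B m'"
  unfolding semigroup_on_def ball_B by (simp add: hom[symmetric] closed fB)

lemma primitive_inverse_transport:
  assumes "primitive_inverse_semigroup A m"
  shows "primitive_inverse_semigroup B m'"
proof -
  have sg: "semigroup_on A m" and ex1: "\<And>x. x \<in> A \<Longrightarrow> \<exists>!y. y \<in> A \<and> m (m x y) x = x \<and> m (m y x) y = y"
    using assms by (auto simp: primitive_inverse_semigroup_def inverse_semigroup_def)
  obtain z where z: "is_zero A m z"
     and prim: "\<forall>e\<in>A. \<forall>f\<in>A. m e e = e \<and> e \<noteq> z \<and> m f f = f \<and> f \<noteq> z \<and> m e f = f \<and> m f e = f \<longrightarrow> f = e"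
    using assms by (auto simp: primitive_inverse_semigroup_def)
  have zA: "z \<in> A" using z by (simp add: is_zero_def)
  have "is_zero B m' (f z)"
    using z unfolding is_zero_def ball_B by (simp add: hom[symmetric] fB)
  moreover have "\<forall>e\<in>B. \<forall>g\<in>B. m' e e = e \<and> e \<noteq> f z \<and> m' g g = g \<and> g \<noteq> f z \<and> m' e g = g \<and> m' g e = g \<longrightarrow> g = e"
    unfolding ball_B
  proof (intro ballI impI)
    fix e g assume eg: "e \<in> A" "g \<in> A"
    assume "m' (f e) (f e) = f e \<and> f e \<noteq> f z \<and> m' (f g) (f g) = f g \<and> f g \<noteq> f z \<and>
      m' (f e) (f g) = f g \<and> m' (f g) (f e) = f g"
    then have "m e e = e \<and> e \<noteq> z \<and> m g g = g \<and> g \<noteq> z \<and> m e g = g \<and> m g e = g"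
      using eg zA by (simp add: hom[symmetric] closed f_eq)
    then have "g = e" using prim eg by blast
    then show "f g = f e" by simp
  qed
  moreover have "\<forall>x\<in>B. \<exists>!y. y \<in> B \<and> m' (m' x y) x = x \<and> m' (m' y x) y = y"
    unfolding ball_B using ex1_inverse(1)[OF _ ex1] by blast
  ultimately show ?thesis
    using semigroup_on_transport[OF sg] unfolding primitive_inverse_semigroup_def inverse_semigroup_def by blast
qed

lemma semigroup_inverse_transport:
  assumes "inverse_semigroup A m" "x \<in> A"
  shows "semigroup_inverse B m' (f x) = f (semigroup_inverse A m x)"
  by (rule ex1_inverse(2)) (use assms in \<open>auto simp: inverse_semigroup_def\<close>)

end

section \<open>Primitive inverse semigroups over countably compact spaces\<close>

text \<open>An open cover of the pulled-back space comes from open sets of \<open>Y\<close>;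
  closedness of the image allows its complement to be added, giving a countable open cover of all of
  \<open>Y\<close>.\<close>

lemma countably_compact_space_pullback:
  assumes Y: "countably_compact_space Y" and cl: "closedin Y (g ` A)"
  shows "countably_compact_space (pullback_topology A g Y)"
  unfolding countably_compact_space_def
proof (intro allI impI)
  let ?T = "pullback_topology A g Y"
  fix \<U> assume \<U>: "countable \<U> \<and> (\<forall>U\<in>\<U>. openin ?T U) \<and> topspace ?T \<subseteq> \<Union>\<U>"
  have top: "topspace ?T = A" using closedin_subset[OF cl] by (auto simp: topspace_pullback_topology)
  have "\<forall>U\<in>\<U>. \<exists>V. openin Y V \<and> U = g -` V \<inter> A" using \<U> by (auto simp: openin_pullback_topology)
  then obtain v where v: "\<And>U. U \<in> \<U> \<Longrightarrow> openin Y (v U)" "\<And>U. U \<in> \<U> \<Longrightarrow> U = g -` v U \<inter> A" by metis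
  let ?\<V> = "insert (topspace Y - g ` A) (v ` \<U>)"
  have "topspace Y \<subseteq> \<Union>?\<V>"
  proof
    fix y assume y: "y \<in> topspace Y"
    show "y \<in> \<Union>?\<V>"
    proof (cases "y \<in> g ` A")
      case True
      then obtain a where a: "a \<in> A" "y = g a" by blast
      then have "a \<in> \<Union>\<U>" using \<U> top by blast
      then obtain U where U: "U \<in> \<U>" "a \<in> U" by blast
      then have "y \<in> v U" using v(2)[OF U(1)] a by blast
      then show ?thesis using U by blast
    qed (use y in blast)
  qed
  moreover have "countable ?\<V>" using \<U> by simp
  moreover have "\<forall>V\<in>?\<V>. openin Y V" using v(1) cl by auto
  ultimately obtain \<F> where \<F>: "finite \<F>" "\<F> \<subseteq> ?\<V>" "topspace Y \<subseteq> \<Union>\<F>"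
    using Y[unfolded countably_compact_space_def, rule_format, of ?\<V>] by blast
  have "finite (\<F> - {topspace Y - g ` A})" "\<F> - {topspace Y - g ` A} \<subseteq> v ` \<U>" using \<F> by auto
  then obtain \<G> where \<G>: "\<G> \<subseteq> \<U>" "finite \<G>" "\<F> - {topspace Y - g ` A} = v ` \<G>"
    using finite_subset_image[of "\<F> - {topspace Y - g ` A}" v \<U>] by auto
  have "A \<subseteq> \<Union>\<G>"
  proof
    fix a assume a: "a \<in> A"
    then have "g a \<in> topspace Y" using closedin_subset[OF cl] by blast
    then obtain F where F: "F \<in> \<F>" "g a \<in> F" using \<F>(3) by blast
    then have "F \<in> v ` \<G>" using a \<G>(3) by blast
    then obtain U where U: "U \<in> \<G>" "F = v U" by blast
    then show "a \<in> \<Union>\<G>" using v(2)[of U] F(2) a \<G>(1) by blast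
  qed
  then show "\<exists>\<F>. finite \<F> \<and> \<F> \<subseteq> \<U> \<and> topspace ?T \<subseteq> \<Union>\<F>"
    using \<G>(1,2) by (intro exI[of _ \<G>]) (simp add: top)
qed

lemma continuous_map_extend_clopen:
  assumes A: "openin X A" "closedin X A" and f: "continuous_map (subtopology X A) Y f" and c: "c \<in> topspace Y"
  shows "continuous_map X Y (\<lambda>x. if x \<in> A then f x else c)"
  unfolding continuous_map_def
proof (intro conjI allI impI)
  have AX: "A \<subseteq> topspace X" using A openin_subset by blast
  have fY: "f x \<in> topspace Y" if "x \<in> A" for x
    using f that AX by (auto simp: continuous_map_def)
  show "(\<lambda>x. if x \<in> A then f x else c) \<in> topspace X \<rightarrow> topspace Y"
    using fY c by auto
  fix W assume W: "openin Y W"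
  have "openin (subtopology X A) {x \<in> topspace (subtopology X A). f x \<in> W}"
    using f W by (rule openin_continuous_map_preimage)
  then have 1: "openin X {x \<in> topspace (subtopology X A). f x \<in> W}"
    using A(1) by (rule openin_trans_full)
  have 2: "openin X (if c \<in> W then topspace X - A else {})" using A(2) by auto
  have "{x \<in> topspace X. (if x \<in> A then f x else c) \<in> W}
      = {x \<in> topspace (subtopology X A). f x \<in> W} \<union> (if c \<in> W then topspace X - A else {})"
    using AX by auto
  then show "openin X {x \<in> topspace X. (if x \<in> A then f x else c) \<in> W}"
    using openin_Un[OF 1 2] by simp
qed

section \<open>Cells of the semigroup and the topology of its maximal subgroups\<close>

locale cc_primitive_semigroup =
  fixes X :: "'a topology" and m :: "'a \<Rightarrow> 'a \<Rightarrow> 'a"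
    and I :: "'i set" and L :: "'i \<Rightarrow> 'l set" and G :: "'i \<Rightarrow> 'g monoid"
    and \<phi> :: "('i \<times> 'l \<times> 'g \<times> 'l) option \<Rightarrow> 'a"
    and \<alpha> :: "'i \<Rightarrow> 'l"
  assumes semitop: "semitopological_semigroup X m"
    and reg: "regular_space X"
    and ccomp: "countably_compact_space X"
    and groups: "i \<in> I \<Longrightarrow> group (G i)"
    and phi_bij: "bij_betw \<phi> (osum_carrier I L G) (topspace X)"
    and phi_hom: "x \<in> osum_carrier I L G \<Longrightarrow> y \<in> osum_carrier I L G \<Longrightarrow>
                    \<phi> (osum_mult G x y) = m (\<phi> x) (\<phi> y)"
    and alpha_in: "i \<in> I \<Longrightarrow> \<alpha> i \<in> L i"
    and cases: "i \<in> I \<Longrightarrow>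
        left_precompact (subtopology X (\<phi> ` group_cell i (\<alpha> i) (\<alpha> i) G)) m
                        (\<phi> (Some (i, \<alpha> i, \<one>\<^bsub>G i\<^esub>, \<alpha> i)))
      \<or> (left_omega_precompact (subtopology X (\<phi> ` group_cell i (\<alpha> i) (\<alpha> i) G)) m
                        (\<phi> (Some (i, \<alpha> i, \<one>\<^bsub>G i\<^esub>, \<alpha> i)))
         \<and> pseudocompact_space (subtopology X (\<phi> ` group_cell i (\<alpha> i) (\<alpha> i) G)))
      \<or> topological_semigroup
          (subtopology X (\<phi> ` insert None (group_cell i (\<alpha> i) (\<alpha> i) G))) m"
begin

definition z :: 'a where "z = \<phi> None"

definition el :: "'i \<Rightarrow> 'l \<Rightarrow> 'g \<Rightarrow> 'l \<Rightarrow> 'a" where "el i a g b = \<phi> (Some (i, a, g, b))"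

definition cell :: "'i \<times> 'l \<times> 'l \<Rightarrow> 'a set" where
  "cell = (\<lambda>(i, a, b). \<phi> ` group_cell i a b G)"

definition Q :: "('i \<times> 'l \<times> 'l) set" where
  "Q = {(i, a, b). i \<in> I \<and> a \<in> L i \<and> b \<in> L i}"

definition corner :: "'i \<Rightarrow> 'l \<Rightarrow> 'l \<Rightarrow> 'a" where "corner i a b = el i a \<one>\<^bsub>G i\<^esub> b"

text \<open>Two-sided multiplication by corner units: the cell \<open>(i, a, b)\<close> moves onto
  \<open>(i, c, d)\<close> with the group component unchanged, and everything else collapses to
  \<open>z\<close>. It is continuous because it is a composition of two translations.\<close>

definition shift :: "'i \<Rightarrow> 'l \<Rightarrow> 'l \<Rightarrow> 'l \<Rightarrow> 'l \<Rightarrow> 'a \<Rightarrow> 'a" where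
  "shift i c a b d x = m (m (corner i c a) x) (corner i b d)"

lemma Q_iff [simp]: "(i, a, b) \<in> Q \<longleftrightarrow> i \<in> I \<and> a \<in> L i \<and> b \<in> L i"
  by (simp add: Q_def)

lemma cell_eq: "cell (i, a, b) = {el i a g b | g. g \<in> carrier (G i)}"
  by (auto simp: cell_def group_cell_def el_def)

lemma z_in: "z \<in> topspace X"
  unfolding z_def using phi_bij bij_betwE by fastforce

lemma el_in: "i \<in> I \<Longrightarrow> a \<in> L i \<Longrightarrow> b \<in> L i \<Longrightarrow> g \<in> carrier (G i) \<Longrightarrow> el i a g b \<in> topspace X"
  unfolding el_def using phi_bij bij_betwE by fastforce

lemma corner_in: "i \<in> I \<Longrightarrow> a \<in> L i \<Longrightarrow> b \<in> L i \<Longrightarrow> corner i a b \<in> topspace X"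
  unfolding corner_def by (intro el_in) (auto simp: groups group.is_monoid)

lemma X_cases:
  assumes "x \<in> topspace X"
  obtains "x = z" | i a g b where "x = el i a g b" "i \<in> I" "a \<in> L i" "b \<in> L i" "g \<in> carrier (G i)"
proof -
  obtain y where y: "y \<in> osum_carrier I L G" "x = \<phi> y"
    using assms phi_bij by (auto simp: bij_betw_def)
  from y(1) show thesis
    by (cases rule: osum_carrier_cases) (use y that in \<open>auto simp: z_def el_def\<close>)
qed

lemma el_mult:
  assumes "i \<in> I" "a \<in> L i" "b \<in> L i" "g \<in> carrier (G i)" "j \<in> I" "c \<in> L j" "d \<in> L j" "h \<in> carrier (G j)"
  shows "m (el i a g b) (el j c h d) = (if i = j \<and> b = c then el i a (g \<otimes>\<^bsub>G i\<^esub> h) d else z)"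
  using phi_hom[of "Some (i, a, g, b)" "Some (j, c, h, d)"] assms by (auto simp: el_def z_def)

lemma z_mult:
  assumes "x \<in> topspace X"
  shows "m z x = z" "m x z = z"
proof -
  obtain y where y: "y \<in> osum_carrier I L G" "x = \<phi> y"
    using assms phi_bij by (auto simp: bij_betw_def)
  show "m z x = z" "m x z = z"
    using phi_hom[of None y] phi_hom[of y None] y by (simp_all add: z_def)
qed

lemma el_eq_iff:
  assumes "i \<in> I" "a \<in> L i" "b \<in> L i" "g \<in> carrier (G i)" "j \<in> I" "c \<in> L j" "d \<in> L j" "h \<in> carrier (G j)"
  shows "el i a g b = el j c h d \<longleftrightarrow> i = j \<and> a = c \<and> g = h \<and> b = d"
  unfolding el_def
  using bij_betw_imp_inj_on[OF phi_bij, THEN inj_on_eq_iff, of "Some (i, a, g, b)" "Some (j, c, h, d)"] assms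
  by simp

lemma el_neq_z:
  assumes "i \<in> I" "a \<in> L i" "b \<in> L i" "g \<in> carrier (G i)"
  shows "el i a g b \<noteq> z"
  unfolding el_def z_def
  using bij_betw_imp_inj_on[OF phi_bij, THEN inj_on_eq_iff, of "Some (i, a, g, b)" None] assms
  by simp

lemma Hausdorff: "Hausdorff_space X"
  using semitop by (simp add: semitopological_semigroup_def)

lemma contL: "a \<in> topspace X \<Longrightarrow> continuous_map X X (m a)"
  using semitop by (simp add: semitopological_semigroup_def)

lemma contR: "a \<in> topspace X \<Longrightarrow> continuous_map X X (\<lambda>x. m x a)"
  using semitop by (simp add: semitopological_semigroup_def)

lemma cont_shift:
  assumes "i \<in> I" "a \<in> L i" "b \<in> L i" "c \<in> L i" "d \<in> L i"
  shows "continuous_map X X (shift i c a b d)"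
  using continuous_map_compose[OF contL[OF corner_in] contR[OF corner_in], of i c a i b d] assms
  by (simp add: o_def shift_def[abs_def])

lemma shift_el:
  assumes "i \<in> I" "a \<in> L i" "b \<in> L i" "c \<in> L i" "d \<in> L i" "g \<in> carrier (G i)"
  shows "shift i c a b d (el i a g b) = el i c g d"
proof -
  interpret group "G i" using groups assms(1) .
  show ?thesis using assms by (simp add: shift_def corner_def el_mult)
qed

lemma shift_outside:
  assumes "i \<in> I" "a \<in> L i" "b \<in> L i" "c \<in> L i" "d \<in> L i" "x \<in> topspace X" "x \<notin> cell (i, a, b)"
  shows "shift i c a b d x = z"
proof -
  interpret group "G i" using groups assms(1) .
  from assms(6) show ?thesis
  proof (cases rule: X_cases)
    case 1
    then show ?thesis using assms by (simp add: shift_def corner_in z_mult)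
  next
    case (2 j a' g b')
    show ?thesis
    proof (cases "j = i \<and> a' = a")
      case True
      then have "b' \<noteq> b" using 2 assms(7) by (auto simp: cell_eq)
      then show ?thesis using True 2 assms by (simp add: shift_def corner_def el_mult)
    next
      case False
      then have "m (corner i c a) x = z" using 2 assms unfolding corner_def by (subst 2, subst el_mult) auto
      then show ?thesis using assms by (simp add: shift_def corner_in z_mult)
    qed
  qed
qed

lemma cell_subset: "q \<in> Q \<Longrightarrow> cell q \<subseteq> topspace X"
  by (cases q) (auto simp: cell_eq el_in)

lemma shift_cell:
  assumes "i \<in> I" "a \<in> L i" "b \<in> L i" "c \<in> L i" "d \<in> L i"
  shows "shift i c a b d ` cell (i, a, b) = cell (i, c, d)"
proof -
  have "shift i c a b d ` cell (i, a, b) = (\<lambda>g. shift i c a b d (el i a g b)) ` carrier (G i)"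
    by (auto simp: cell_eq)
  also have "\<dots> = (\<lambda>g. el i c g d) ` carrier (G i)"
    using assms by (intro image_cong) (auto simp: shift_el)
  finally show ?thesis by (auto simp: cell_eq)
qed

lemma shift_shift:
  assumes "i \<in> I" "a \<in> L i" "b \<in> L i" "c \<in> L i" "d \<in> L i" "x \<in> cell (i, a, b)"
  shows "shift i a c d b (shift i c a b d x) = x"
  using assms by (auto simp: cell_eq shift_el)

lemma z_notin_cell: "q \<in> Q \<Longrightarrow> z \<notin> cell q"
  using el_neq_z by (cases q) (force simp: cell_eq)

lemma cell_disjoint: "p \<in> Q \<Longrightarrow> q \<in> Q \<Longrightarrow> p \<noteq> q \<Longrightarrow> cell p \<inter> cell q = {}"
  by (cases p, cases q) (auto simp: cell_eq el_eq_iff)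

lemma topspace_cells: "topspace X = insert z (\<Union>q\<in>Q. cell q)"
proof
  show "topspace X \<subseteq> insert z (\<Union>q\<in>Q. cell q)"
  proof
    fix x assume "x \<in> topspace X"
    then show "x \<in> insert z (\<Union>q\<in>Q. cell q)"
    proof (cases rule: X_cases)
      case (2 i a g b)
      then have "x \<in> cell (i, a, b)" "(i, a, b) \<in> Q" by (auto simp: cell_eq)
      then show ?thesis by blast
    qed simp
  qed
  show "insert z (\<Union>q\<in>Q. cell q) \<subseteq> topspace X" using z_in cell_subset by blast
qed

text \<open>With equal source and target the shift is a retraction onto the cell with zero. The cell
  is the preimage of the complement of \<open>z\<close>, and the cell with zero is the set of fixed
  points, which gives closedness in the next lemma.\<close>

lemma open_cell: "q \<in> Q \<Longrightarrow> openin X (cell q)"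
proof -
  assume q: "q \<in> Q"
  obtain i a b where i: "q = (i, a, b)" "i \<in> I" "a \<in> L i" "b \<in> L i" using q by (cases q) auto
  have "cell q = {x \<in> topspace X. shift i a a b b x \<in> topspace X - {z}}"
  proof (intro Set.set_eqI iffI)
    fix x assume "x \<in> cell q"
    then obtain g where g: "x = el i a g b" "g \<in> carrier (G i)" using i by (auto simp: cell_eq)
    then show "x \<in> {x \<in> topspace X. shift i a a b b x \<in> topspace X - {z}}"
      using i by (simp add: shift_el el_in el_neq_z)
  next
    fix x assume x: "x \<in> {x \<in> topspace X. shift i a a b b x \<in> topspace X - {z}}"
    then show "x \<in> cell q" using shift_outside[of i a b a b x] i by auto
  qed
  moreover have "openin X (topspace X - {z})"
    using closedin_Hausdorff_singleton[OF Hausdorff z_in] by blast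
  ultimately show ?thesis
    using openin_continuous_map_preimage[OF cont_shift[OF i(2,3,4,3,4)], of "topspace X - {z}"] by (simp only:)
qed

lemma closed_cell_zero: "q \<in> Q \<Longrightarrow> closedin X (insert z (cell q))"
proof -
  assume q: "q \<in> Q"
  obtain i a b where i: "q = (i, a, b)" "i \<in> I" "a \<in> L i" "b \<in> L i" using q by (cases q) auto
  have "insert z (cell q) = {x \<in> topspace X. shift i a a b b x = x}"
  proof (intro Set.set_eqI iffI)
    fix x assume x: "x \<in> insert z (cell q)"
    show "x \<in> {x \<in> topspace X. shift i a a b b x = x}"
    proof (cases "x = z")
      case True
      then show ?thesis using i z_in z_notin_cell[OF q] by (simp add: shift_outside)
    next
      case False
      then obtain g where g: "x = el i a g b" "g \<in> carrier (G i)" using i x by (auto simp: cell_eq)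
      then show ?thesis using i by (simp add: shift_el el_in)
    qed
  next
    fix x assume x: "x \<in> {x \<in> topspace X. shift i a a b b x = x}"
    then show "x \<in> insert z (cell q)" using shift_outside[of i a b a b x] i by auto
  qed
  moreover have "closedin X {x \<in> topspace X. shift i a a b b x = x}"
    using closedin_continuous_maps_eq[OF Hausdorff cont_shift[of i a b a b] continuous_map_id] i by simp
  ultimately show ?thesis by simp
qed

definition cell_group :: "'i \<Rightarrow> 'a monoid" where
  "cell_group i = \<lparr>carrier = cell (i, \<alpha> i, \<alpha> i), mult = m, one = corner i (\<alpha> i) (\<alpha> i)\<rparr>"

lemma closed_cell_alpha:
  assumes i: "i \<in> I"
  shows "closedin X (cell (i, \<alpha> i, \<alpha> i))"
proof -
  interpret Gi: group "G i" using groups i .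
  have a: "\<alpha> i \<in> L i" using alpha_in i .
  have q: "(i, \<alpha> i, \<alpha> i) \<in> Q" using i a by simp
  have "group (cell_group i)"
  proof (rule groupI)
    fix x assume "x \<in> carrier (cell_group i)"
    then obtain g where g: "x = el i (\<alpha> i) g (\<alpha> i)" "g \<in> carrier (G i)" by (auto simp: cell_group_def cell_eq)
    then show "\<exists>y\<in>carrier (cell_group i). y \<otimes>\<^bsub>cell_group i\<^esub> x = \<one>\<^bsub>cell_group i\<^esub>"
      using i a by (intro bexI[of _ "el i (\<alpha> i) (inv\<^bsub>G i\<^esub> g) (\<alpha> i)"]) (auto simp: cell_group_def corner_def el_mult cell_eq)
  qed (use i a in \<open>auto simp: cell_group_def cell_eq corner_def el_mult Gi.m_assoc\<close>)
  then interpret gs: group_in_semigroup "cell_group i" X m z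
  proof (rule group_in_semigroup.intro, unfold_locales)
    show "openin X (carrier (cell_group i))" "closedin X (insert z (carrier (cell_group i)))"
      using open_cell[OF q] closed_cell_zero[OF q] by (simp_all add: cell_group_def)
    show "z \<notin> carrier (cell_group i)" using z_notin_cell[OF q] by (simp add: cell_group_def)
    show "m z z = z" using z_mult z_in by blast
    show "m x z = z" if "x \<in> carrier (cell_group i)" for x
      using that cell_subset[OF q] z_mult by (auto simp: cell_group_def)
  qed (use semitop reg ccomp in \<open>auto simp: cell_group_def\<close>)
  have c: "carrier (cell_group i) = \<phi> ` group_cell i (\<alpha> i) (\<alpha> i) G" by (simp add: cell_group_def cell_def)
  have o: "\<one>\<^bsub>cell_group i\<^esub> = \<phi> (Some (i, \<alpha> i, \<one>\<^bsub>G i\<^esub>, \<alpha> i))" by (simp add: cell_group_def corner_def el_def)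
  have "closedin X (carrier (cell_group i))"
    using cases[OF i] gs.closed_if_left_precompact gs.closed_if_left_omega_precompact gs.closed_if_topological_semigroup
    unfolding c o image_insert z_def by blast
  then show ?thesis by (simp add: cell_group_def)
qed

text \<open>The hypotheses concern one diagonal cell per index \<open>i\<close>. Every other cell is
  the preimage of that one under a continuous shift, points outside being sent to
  \<open>z\<close>.\<close>

lemma closed_cell: "q \<in> Q \<Longrightarrow> closedin X (cell q)"
proof -
  assume q: "q \<in> Q"
  obtain i a b where i: "q = (i, a, b)" "i \<in> I" "a \<in> L i" "b \<in> L i" using q by (cases q) auto
  have al: "\<alpha> i \<in> L i" using alpha_in i by blast
  have "cell q = {x \<in> topspace X. shift i (\<alpha> i) a b (\<alpha> i) x \<in> cell (i, \<alpha> i, \<alpha> i)}"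
  proof (intro Set.set_eqI iffI)
    fix x assume "x \<in> cell q"
    then show "x \<in> {x \<in> topspace X. shift i (\<alpha> i) a b (\<alpha> i) x \<in> cell (i, \<alpha> i, \<alpha> i)}"
      using shift_cell[of i a b "\<alpha> i" "\<alpha> i"] i al cell_subset[OF q] by blast
  next
    fix x assume x: "x \<in> {x \<in> topspace X. shift i (\<alpha> i) a b (\<alpha> i) x \<in> cell (i, \<alpha> i, \<alpha> i)}"
    show "x \<in> cell q"
    proof (rule ccontr)
      assume "x \<notin> cell q"
      then have "shift i (\<alpha> i) a b (\<alpha> i) x = z"
        using shift_outside[of i a b "\<alpha> i" "\<alpha> i" x] i al x by simp
      then show False using x z_notin_cell[of "(i, \<alpha> i, \<alpha> i)"] i al by simp
    qed
  qed
  then show ?thesis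
    using closedin_continuous_map_preimage[OF cont_shift[OF i(2,3,4) al al] closed_cell_alpha[OF i(2)]]
    by (simp only:)
qed

definition T :: "'i \<Rightarrow> 'g topology" where
  "T i = pullback_topology (carrier (G i)) (\<lambda>g. \<phi> (Some (i, \<alpha> i, g, \<alpha> i))) X"

lemma T_eq: "T i = pullback_topology (carrier (G i)) (\<lambda>g. el i (\<alpha> i) g (\<alpha> i)) X"
  by (simp add: T_def el_def)

lemma el_image: "(\<lambda>g. el i a g b) ` carrier (G i) = cell (i, a, b)"
  by (auto simp: cell_eq)

lemma homeomorphic_T:
  assumes i: "i \<in> I"
  shows "homeomorphic_map (T i) (subtopology X (cell (i, \<alpha> i, \<alpha> i))) (\<lambda>g. el i (\<alpha> i) g (\<alpha> i))"
  unfolding T_eq el_image[symmetric]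
proof (rule homeomorphic_map_pullback_topology)
  show "inj_on (\<lambda>g. el i (\<alpha> i) g (\<alpha> i)) (carrier (G i))"
    using i alpha_in by (auto simp: inj_on_def el_eq_iff)
  show "(\<lambda>g. el i (\<alpha> i) g (\<alpha> i)) ` carrier (G i) \<subseteq> topspace X"
    using i alpha_in by (auto simp: el_in)
qed

lemma topspace_T:
  assumes i: "i \<in> I"
  shows "topspace (T i) = carrier (G i)"
  using i alpha_in el_in by (auto simp: T_eq topspace_pullback_topology)

lemma cc_group_T:
  assumes i: "i \<in> I"
  shows "cc_semitopological_group (G i) (T i)"
proof -
  interpret Gi: group "G i" using groups i .
  have a: "\<alpha> i \<in> L i" using alpha_in i .
  let ?f = "\<lambda>g. el i (\<alpha> i) g (\<alpha> i)"
  have hs: "T i homeomorphic_space subtopology X (cell (i, \<alpha> i, \<alpha> i))"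
    using homeomorphic_map_imp_homeomorphic_space[OF homeomorphic_T[OF i]] .
  have cont: "continuous_map (T i) (T i) h"
    if k: "continuous_map X X k" and h: "\<And>g. g \<in> carrier (G i) \<Longrightarrow> h g \<in> carrier (G i)"
      and eq: "\<And>g. g \<in> carrier (G i) \<Longrightarrow> ?f (h g) = k (?f g)" for h k
  proof -
    have "continuous_map (T i) X (k \<circ> ?f)"
      unfolding T_eq by (rule continuous_map_pullback[OF k])
    then have "continuous_map (T i) X (?f \<circ> h)"
      by (rule continuous_map_eq) (simp add: topspace_T[OF i] eq)
    then show ?thesis
      using h topspace_T[OF i] by (subst (2) T_eq) (auto intro!: continuous_map_pullback')
  qed
  show ?thesis
  proof
    show "topspace (T i) = carrier (G i)" by (rule topspace_T[OF i])
    show "regular_space (T i)"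
      using homeomorphic_regular_space[OF hs] regular_space_subtopology[OF reg] by blast
    show "Hausdorff_space (T i)"
      using homeomorphic_Hausdorff_space[OF hs] Hausdorff_space_subtopology[OF Hausdorff] by blast
    \<comment> \<open>Here closedness of the maximal subgroup is indispensable: an open subspace
      alone would not inherit countable compactness.\<close>
    show "countably_compact_space (T i)"
      unfolding T_eq
      by (rule countably_compact_space_pullback[OF ccomp]) (simp add: el_image closed_cell_alpha[OF i])
    fix g assume g: "g \<in> carrier (G i)"
    show "continuous_map (T i) (T i) (\<lambda>x. g \<otimes>\<^bsub>G i\<^esub> x)"
      by (rule cont[OF contL[OF el_in[OF i a a g]]]) (use i a g in \<open>simp_all add: el_mult\<close>)
    show "continuous_map (T i) (T i) (\<lambda>x. x \<otimes>\<^bsub>G i\<^esub> g)"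
      by (rule cont[OF contR[OF el_in[OF i a a g]]]) (use i a g in \<open>simp_all add: el_mult\<close>)
  qed
qed

lemma shift_homeomorphic:
  assumes "i \<in> I" "a \<in> L i" "b \<in> L i" "c \<in> L i" "d \<in> L i"
  shows "homeomorphic_maps (subtopology X (cell (i, a, b))) (subtopology X (cell (i, c, d)))
     (shift i c a b d) (shift i a c d b)"
proof -
  have 1: "continuous_map (subtopology X (cell (i, a, b))) (subtopology X (cell (i, c, d))) (shift i c a b d)"
    if "a \<in> L i" "b \<in> L i" "c \<in> L i" "d \<in> L i" for a b c d
    using that assms(1) shift_cell[of i a b c d]
    by (auto simp: continuous_map_in_subtopology intro!: continuous_map_from_subtopology cont_shift)
  show ?thesis
    unfolding homeomorphic_maps_def using assms by (auto intro!: 1 shift_shift)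
qed

lemma completely_regular_cell:
  assumes "q \<in> Q"
  shows "completely_regular_space (subtopology X (cell q))"
proof -
  obtain i a b where i: "q = (i, a, b)" "i \<in> I" "a \<in> L i" "b \<in> L i" using assms by (cases q) auto
  have hs: "T i homeomorphic_space subtopology X (cell (i, a, b))"
  proof (rule homeomorphic_space_trans)
    show "T i homeomorphic_space subtopology X (cell (i, \<alpha> i, \<alpha> i))"
      by (rule homeomorphic_map_imp_homeomorphic_space[OF homeomorphic_T[OF i(2)]])
    show "subtopology X (cell (i, \<alpha> i, \<alpha> i)) homeomorphic_space subtopology X (cell (i, a, b))"
      using shift_homeomorphic[of i "\<alpha> i" "\<alpha> i" a b] i alpha_in unfolding homeomorphic_space_def by blast
  qed
  show ?thesis
    using cc_semitopological_group.completely_regular[OF cc_group_T[OF i(2)]]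
    by (simp add: homeomorphic_completely_regular_space[OF hs] i(1))
qed

section \<open>Complete regularity of the whole semigroup\<close>

lemma tychonoff: "tychonoff_space X"
  unfolding tychonoff_space_def completely_regular_space_def
proof (intro conjI allI impI)
  show "Hausdorff_space X" by (rule Hausdorff)
  fix S x assume S: "closedin X S \<and> x \<in> topspace X - S"
  show "\<exists>f::'a \<Rightarrow> real. continuous_map X (top_of_set {0..1}) f \<and> f x = 0 \<and> f ` S \<subseteq> {1}"
  proof (cases "x = z")
    case True
    let ?F = "{q \<in> Q. \<not> cell q \<subseteq> topspace X - S}"
    have fin: "finite ?F"
      by (rule finite_cells_outside_nbhd[OF ccomp cell_disjoint open_cell topspace_cells])
         (use S True in auto)
    \<comment> \<open>Finitely many cells meet the closed set \<open>S\<close>, so their union is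
      clopen; its indicator separates \<open>S\<close> from zero.\<close>
    define A where "A = (\<Union>q\<in>?F. cell q)"
    have A: "openin X A" "closedin X A"
      unfolding A_def using fin open_cell closed_cell by (auto intro!: openin_Union closedin_Union)
    have "continuous_map X (top_of_set {0..1}) (\<lambda>x. if x \<in> A then 1 else (0::real))"
      by (rule continuous_map_extend_clopen[OF A]) auto
    moreover have "z \<notin> A" using z_notin_cell by (auto simp: A_def)
    moreover have "S \<subseteq> A"
    proof
      fix s assume s: "s \<in> S"
      then have "s \<in> topspace X" using S closedin_subset by blast
      then have "s \<in> (\<Union>q\<in>Q. cell q)" using s S True by (auto simp: topspace_cells)
      then obtain q where q: "q \<in> Q" "s \<in> cell q" by blast
      then have "q \<in> ?F" using s by blast
      then show "s \<in> A" unfolding A_def using q(2) by blast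
    qed
    ultimately show ?thesis
      using True by (intro exI[of _ "\<lambda>x. if x \<in> A then 1 else (0::real)"]) auto
  next
    case False
    then have "x \<in> (\<Union>q\<in>Q. cell q)" using S by (simp add: topspace_cells)
    then obtain q where q: "q \<in> Q" "x \<in> cell q" by blast
    have "closedin (subtopology X (cell q)) (cell q \<inter> S)"
      using S by (auto simp: closedin_subtopology)
    moreover have "x \<in> topspace (subtopology X (cell q)) - cell q \<inter> S" using S q by auto
    ultimately obtain f :: "'a \<Rightarrow> real" where f: "continuous_map (subtopology X (cell q)) (top_of_set {0..1}) f"
        "f x = 0" "f ` (cell q \<inter> S) \<subseteq> {1}"
      using completely_regular_cell[OF q(1)] unfolding completely_regular_space_def by blast
    \<comment> \<open>The value outside the clopen cell is 1, since the part of \<open>S\<close>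
      lying there must also be mapped to 1.\<close>
    have "continuous_map X (top_of_set {0..1}) (\<lambda>x. if x \<in> cell q then f x else 1)"
      by (rule continuous_map_extend_clopen[OF open_cell[OF q(1)] closed_cell[OF q(1)] f(1)]) simp
    then show ?thesis
      using f q by (intro exI[of _ "\<lambda>x. if x \<in> cell q then f x else 1"]) auto
  qed
qed

end

section \<open>Compactification of the orthogonal sum\<close>

text \<open>The indicator of \<open>A\<close> is continuous and bounded, so it extends to
  \<open>K\<close>. The extension is 1 on the closure of the image of \<open>A\<close> and 0 on the
  closure of the image of its complement; these two closures cover \<open>K\<close>.\<close>

lemma stone_cech_clopen:
  assumes sc: "stone_cech X K e" and A: "openin X A" "closedin X A"
  shows "openin K (K closure_of (e ` A))"
    and "x \<in> topspace X \<Longrightarrow> e x \<in> K closure_of (e ` A) \<longleftrightarrow> x \<in> A"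
proof -
  note sc' = stone_cechD[OF sc]
  have AX: "A \<subseteq> topspace X" using A openin_subset by blast
  have 1: "continuous_map X euclideanreal (\<lambda>x. if x \<in> A then 1 else 0)"
    by (rule continuous_map_extend_clopen[OF A]) auto
  have 2: "bounded ((\<lambda>x. if x \<in> A then 1 else (0::real)) ` topspace X)"
    by (rule bounded_subset[of "{0, 1}"]) auto
  from sc'(8)[OF 1 2] obtain u where u: "continuous_map K euclideanreal u"
      "\<And>x. x \<in> topspace X \<Longrightarrow> u (e x) = (if x \<in> A then 1 else 0)"
    by blast
  have on: "u p = c" if "p \<in> K closure_of (e ` B)" "B \<subseteq> topspace X" "\<And>x. x \<in> B \<Longrightarrow> u (e x) = c" for p B c
    using closure_of_dense_le[OF that(1) u(1), of c 0] that(3) by force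
  have un: "K closure_of (e ` A) \<union> K closure_of (e ` (topspace X - A)) = topspace K"
    using AX sc'(7) by (simp add: closure_of_Un[symmetric] image_Un[symmetric] Un_absorb1)
  have one: "u p = 1" if "p \<in> K closure_of (e ` A)" for p
    by (rule on[OF that AX]) (use AX u(2) in auto)
  have zero: "u p = 0" if "p \<in> K closure_of (e ` (topspace X - A))" for p
    by (rule on[OF that]) (use u(2) in auto)
  have "K closure_of (e ` A) = topspace K - K closure_of (e ` (topspace X - A))"
    using un one zero by fastforce
  then show "openin K (K closure_of (e ` A))" by (simp add: openin_diff)
  show "e x \<in> K closure_of (e ` A) \<longleftrightarrow> x \<in> A" if x: "x \<in> topspace X"
  proof
    assume "e x \<in> K closure_of (e ` A)"
    then have "u (e x) = 1" by (rule one)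
    then show "x \<in> A" using u(2)[OF x] by (auto split: if_splits)
  next
    assume "x \<in> A"
    moreover have "e ` A \<subseteq> K closure_of (e ` A)" using AX sc'(6) by (intro closure_of_subset) blast
    ultimately show "e x \<in> K closure_of (e ` A)" by blast
  qed
qed

section \<open>Closures of the cells in the compactification\<close>

locale cc_primitive_semigroup_stone_cech = cc_primitive_semigroup X m I L G \<phi> \<alpha>
  for X :: "'a topology" and m and I :: "'i set" and L :: "'i \<Rightarrow> 'l set" and G :: "'i \<Rightarrow> 'g monoid" and \<phi> \<alpha> +
  fixes K :: "'b topology" and e :: "'a \<Rightarrow> 'b"
  assumes sc: "stone_cech X K e"
begin

lemmas scD = stone_cechD[OF sc]

definition kcell :: "'i \<times> 'l \<times> 'l \<Rightarrow> 'b set" where "kcell q = K closure_of (e ` cell q)"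

definition zk :: 'b where "zk = e z"

lemma zk_in: "zk \<in> topspace K"
  unfolding zk_def by (rule scD(6)[OF z_in])

lemma K_countably_compact: "countably_compact_space K"
  by (rule compact_imp_countably_compact_space[OF scD(1)])

lemma closed_kcell: "closedin K (kcell q)"
  by (simp add: kcell_def)

lemma open_kcell:
  assumes "q \<in> Q"
  shows "openin K (kcell q)"
  unfolding kcell_def
  by (rule stone_cech_clopen(1)[OF sc open_cell[OF assms] closed_cell[OF assms]])

lemma e_kcell_iff:
  assumes "q \<in> Q" "x \<in> topspace X"
  shows "e x \<in> kcell q \<longleftrightarrow> x \<in> cell q"
  unfolding kcell_def
  by (rule stone_cech_clopen(2)[OF sc open_cell[OF assms(1)] closed_cell[OF assms(1)] assms(2)])

lemma kcell_subset: "kcell q \<subseteq> topspace K"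
  using closedin_subset[OF closed_kcell] .

lemma zk_notin_kcell: "q \<in> Q \<Longrightarrow> zk \<notin> kcell q"
  unfolding zk_def by (simp add: e_kcell_iff z_in z_notin_cell)

lemma kcell_disjoint:
  assumes "p \<in> Q" "q \<in> Q" "p \<noteq> q"
  shows "kcell p \<inter> kcell q = {}"
proof (rule ccontr)
  assume "kcell p \<inter> kcell q \<noteq> {}"
  then obtain k where k: "k \<in> kcell p \<inter> kcell q" by blast
  then have "k \<in> topspace K" using kcell_subset by blast
  then have "k \<in> K closure_of (e ` topspace X)" by (simp add: scD(7))
  moreover have "openin K (kcell p \<inter> kcell q)" using open_kcell assms by blast
  ultimately obtain y where "y \<in> e ` topspace X" "y \<in> kcell p \<inter> kcell q"
    using k unfolding in_closure_of by blast
  then obtain x where "x \<in> topspace X" "e x \<in> kcell p" "e x \<in> kcell q" by blast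
  then have "x \<in> cell p \<inter> cell q" using e_kcell_iff assms by simp
  then show False using cell_disjoint[OF assms] by simp
qed

text \<open>The closure of an infinite union could have further points. But only finitely many cells
  leave a neighbourhood of zero, so a point separated from \<open>zk\<close> is in the closure of a
  finite union of cells, and hence of a single one.\<close>

lemma topspace_kcells: "topspace K = insert zk (\<Union>q\<in>Q. kcell q)"
proof
  show "insert zk (\<Union>q\<in>Q. kcell q) \<subseteq> topspace K" using zk_in kcell_subset by blast
  show "topspace K \<subseteq> insert zk (\<Union>q\<in>Q. kcell q)"
  proof
    fix p assume p: "p \<in> topspace K"
    show "p \<in> insert zk (\<Union>q\<in>Q. kcell q)"
    proof (cases "p = zk")
      case False
      obtain U V where UV: "openin K U" "openin K V" "zk \<in> U" "p \<in> V" "disjnt U V"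
        using scD(2) False p zk_in unfolding Hausdorff_space_def by metis
      define W where "W = {x \<in> topspace X. e x \<in> U}"
      have W: "openin X W" unfolding W_def by (rule openin_continuous_map_preimage[OF scD(4) UV(1)])
      have zW: "z \<in> W" using UV(3) z_in by (simp add: W_def zk_def)
      define F where "F = {q \<in> Q. \<not> cell q \<subseteq> W}"
      have F: "finite F"
        unfolding F_def by (rule finite_cells_outside_nbhd[OF ccomp cell_disjoint open_cell topspace_cells W zW])
      have sub: "e ` topspace X \<subseteq> (topspace K - V) \<union> (\<Union>q\<in>F. kcell q)"
      proof
        fix y assume "y \<in> e ` topspace X"
        then obtain x where x: "x \<in> topspace X" "y = e x" by blast
        show "y \<in> (topspace K - V) \<union> (\<Union>q\<in>F. kcell q)"
        proof (cases "x \<in> W")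
          case True
          then show ?thesis using x UV(5) scD(6) by (auto simp: W_def disjnt_iff)
        next
          case False
          then have "x \<in> (\<Union>q\<in>Q. cell q)" using x(1) zW by (auto simp: topspace_cells)
          then obtain q where q: "q \<in> Q" "x \<in> cell q" by blast
          then have "q \<in> F" using False by (auto simp: F_def)
          moreover have "y \<in> kcell q" using q x e_kcell_iff[OF q(1) x(1)] by simp
          ultimately show ?thesis by blast
        qed
      qed
      have "closedin K ((topspace K - V) \<union> (\<Union>q\<in>F. kcell q))"
        using F UV(2) closed_kcell by (intro closedin_Un closedin_Union) auto
      from closure_of_minimal[OF sub this] have "p \<in> (topspace K - V) \<union> (\<Union>q\<in>F. kcell q)"
        using p unfolding scD(7) by blast
      then show ?thesis using UV(4) by (auto simp: F_def)
    qed simp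
  qed
qed

text \<open>At this stage \<open>K\<close> carries no multiplication, so the shifts cannot be
  defined by products with corner units. They are obtained as continuous extensions and used to
  build the multiplication.\<close>

definition kshift :: "'i \<Rightarrow> 'l \<Rightarrow> 'l \<Rightarrow> 'l \<Rightarrow> 'l \<Rightarrow> 'b \<Rightarrow> 'b" where
  "kshift i c a b d = (SOME F. continuous_map K K F \<and> (\<forall>x\<in>topspace X. F (e x) = e (shift i c a b d x)))"

lemma kshift:
  assumes "i \<in> I" "a \<in> L i" "b \<in> L i" "c \<in> L i" "d \<in> L i"
  shows "continuous_map K K (kshift i c a b d)"
    and "x \<in> topspace X \<Longrightarrow> kshift i c a b d (e x) = e (shift i c a b d x)"
proof -
  have "\<exists>F. continuous_map K K F \<and> (\<forall>x\<in>topspace X. F (e x) = (e \<circ> shift i c a b d) x)"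
    by (rule stone_cech_extension[OF sc scD(1,2) continuous_map_compose[OF cont_shift[OF assms] scD(4)]])
  then have "\<exists>F. continuous_map K K F \<and> (\<forall>x\<in>topspace X. F (e x) = e (shift i c a b d x))" by simp
  from someI_ex[OF this, folded kshift_def]
  show "continuous_map K K (kshift i c a b d)"
    and "x \<in> topspace X \<Longrightarrow> kshift i c a b d (e x) = e (shift i c a b d x)" by auto
qed

lemma kshift_kcell:
  assumes "i \<in> I" "a \<in> L i" "b \<in> L i" "c \<in> L i" "d \<in> L i" "p \<in> kcell (i, a, b)"
  shows "kshift i c a b d p \<in> kcell (i, c, d)"
proof -
  have "kshift i c a b d ` (K closure_of (e ` cell (i, a, b))) \<subseteq> K closure_of (kshift i c a b d ` e ` cell (i, a, b))"
    by (rule continuous_map_image_closure_subset[OF kshift(1)[OF assms(1-5)]])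
  moreover have "kshift i c a b d ` e ` cell (i, a, b) = (e \<circ> shift i c a b d) ` cell (i, a, b)"
    unfolding image_image
    by (rule image_cong) (use kshift(2)[OF assms(1-5)] cell_subset[of "(i, a, b)"] assms in auto)
  moreover have "\<dots> = e ` cell (i, c, d)"
    unfolding image_comp[symmetric] shift_cell[OF assms(1-5)] ..
  ultimately show ?thesis using assms(6) unfolding kcell_def by auto
qed

lemma kshift_kshift:
  assumes "i \<in> I" "a \<in> L i" "b \<in> L i" "c \<in> L i" "d \<in> L i" "p \<in> kcell (i, a, b)"
  shows "kshift i a c d b (kshift i c a b d p) = p"
proof -
  have "(kshift i a c d b \<circ> kshift i c a b d) p = id p"
  proof (rule forall_in_closure_of_eq[of p K "e ` cell (i, a, b)" K])
    show "p \<in> K closure_of e ` cell (i, a, b)" using assms(6) by (simp add: kcell_def)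
    show "continuous_map K K (kshift i a c d b \<circ> kshift i c a b d)"
      by (rule continuous_map_compose[OF kshift(1)[OF assms(1-5)] kshift(1)]) (use assms in auto)
    fix y assume "y \<in> e ` cell (i, a, b)"
    then obtain x where x: "x \<in> cell (i, a, b)" "y = e x" by blast
    have xX: "x \<in> topspace X" using x cell_subset[of "(i, a, b)"] assms by auto
    have sX: "shift i c a b d x \<in> topspace X"
      using shift_cell[OF assms(1-5)] cell_subset[of "(i, c, d)"] x assms by auto
    show "(kshift i a c d b \<circ> kshift i c a b d) y = id y"
      using x xX sX assms by (simp add: kshift(2) shift_shift)
  qed (use scD(2) in auto)
  then show ?thesis by simp
qed

lemma kshift_cell_continuous:
  assumes "i \<in> I" "a \<in> L i" "b \<in> L i" "c \<in> L i" "d \<in> L i"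
  shows "continuous_map (subtopology K (kcell (i, a, b))) (subtopology K (kcell (i, c, d))) (kshift i c a b d)"
  using kshift(1)[OF assms] kshift_kcell[OF assms]
  by (auto simp: continuous_map_in_subtopology intro: continuous_map_from_subtopology)

text \<open>The compactification of the group \<open>G i\<close>, realised inside \<open>K\<close>
  as the closure of its diagonal cell; all group components of the new semigroup thus have the
  element type of \<open>K\<close>.\<close>

definition TH :: "'i \<Rightarrow> 'b topology" where "TH i = subtopology K (kcell (i, \<alpha> i, \<alpha> i))"

definition j :: "'i \<Rightarrow> 'g \<Rightarrow> 'b" where "j i g = e (el i (\<alpha> i) g (\<alpha> i))"

lemma topspace_TH: "topspace (TH i) = kcell (i, \<alpha> i, \<alpha> i)"
  unfolding TH_def using kcell_subset by (simp add: Int_absorb1)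

lemma compact_TH: "compact_space (TH i)"
  unfolding TH_def
  by (rule compact_space_subtopology[OF closedin_compact_space[OF scD(1) closed_kcell]])

text \<open>A bounded continuous function on the clopen cell extends by 0 to \<open>X\<close> and
  from there to \<open>K\<close>. Restricting it to the closure of the cell gives the extension
  required.\<close>

lemma stone_cech_TH:
  assumes i: "i \<in> I"
  shows "stone_cech (T i) (TH i) (j i)"
proof -
  have a: "\<alpha> i \<in> L i" using alpha_in i .
  let ?c = "cell (i, \<alpha> i, \<alpha> i)" and ?f = "\<lambda>g. el i (\<alpha> i) g (\<alpha> i)"
  have q: "(i, \<alpha> i, \<alpha> i) \<in> Q" using i a by simp
  have cX: "?c \<subseteq> topspace X" by (rule cell_subset[OF q])
  have jim: "j i ` topspace (T i) = e ` ?c"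
    unfolding topspace_T[OF i] el_image[symmetric] by (auto simp: j_def)
  have sub: "e ` ?c \<subseteq> kcell (i, \<alpha> i, \<alpha> i)"
    unfolding kcell_def using scD(6) cX by (intro closure_of_subset) auto
  have embf: "embedding_map (T i) X ?f"
    unfolding embedding_map_def topspace_T[OF i] el_image by (rule homeomorphic_T[OF i])
  have embj: "embedding_map (T i) K (j i)"
    using embedding_map_compose[OF embf scD(3)] by (simp add: o_def j_def[abs_def])
  obtain f' where f': "homeomorphic_maps (T i) (subtopology X ?c) ?f f'"
    using homeomorphic_T[OF i] homeomorphic_map_maps by blast
  show ?thesis
    unfolding stone_cech_def
  proof (intro conjI allI impI)
    show "compact_space (TH i)" by (rule compact_TH)
    show "Hausdorff_space (TH i)" unfolding TH_def by (rule Hausdorff_space_subtopology[OF scD(2)])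
    show "embedding_map (T i) (TH i) (j i)"
      unfolding TH_def embedding_map_in_subtopology jim using embj sub by simp
    show "TH i closure_of j i ` topspace (T i) = topspace (TH i)"
      unfolding jim topspace_TH
      using sub by (simp add: TH_def closure_of_subtopology kcell_def Int_absorb1)
  next
    fix f :: "'g \<Rightarrow> real" assume f: "continuous_map (T i) euclideanreal f \<and> bounded (f ` topspace (T i))"
    have "continuous_map (subtopology X ?c) euclideanreal (f \<circ> f')"
      using f f' continuous_map_compose unfolding homeomorphic_maps_def by blast
    then have cont: "continuous_map X euclideanreal (\<lambda>x. if x \<in> ?c then (f \<circ> f') x else 0)"
      by (rule continuous_map_extend_clopen[OF open_cell[OF q] closed_cell[OF q]]) simp
    have f'T: "f' x \<in> topspace (T i)" if "x \<in> ?c" for x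
      using f' that cX by (auto simp: homeomorphic_maps_def continuous_map_def Pi_iff)
    have "bounded (insert 0 (f ` topspace (T i)))" using f by simp
    then have "bounded ((\<lambda>x. if x \<in> ?c then (f \<circ> f') x else 0) ` topspace X)"
      by (rule bounded_subset) (use f'T in auto)
    then obtain g where g: "continuous_map K euclideanreal g"
        "\<And>x. x \<in> topspace X \<Longrightarrow> g (e x) = (if x \<in> ?c then (f \<circ> f') x else 0)"
      using scD(8)[OF cont] by blast
    have "continuous_map (TH i) euclideanreal g"
      unfolding TH_def by (rule continuous_map_from_subtopology[OF g(1)])
    moreover have "g (j i x) = f x" if x: "x \<in> topspace (T i)" for x
    proof -
      have c: "?f x \<in> ?c" using x topspace_T[OF i] by (auto simp: cell_eq)
      moreover have "f' (?f x) = x" using f' x by (simp add: homeomorphic_maps_def)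
      ultimately show ?thesis using g(2)[of "?f x"] cX by (auto simp: j_def)
    qed
    ultimately show "\<exists>g. continuous_map (TH i) euclideanreal g \<and> (\<forall>x\<in>topspace (T i). g (j i x) = f x)"
      by blast
  qed
qed

lemma exists_group_structure:
  "\<exists>H :: 'i \<Rightarrow> 'b monoid. \<forall>i\<in>I. topological_group (TH i) (H i) \<and> j i \<in> hom (G i) (H i)"
proof (rule bchoice, intro ballI)
  fix i assume i: "i \<in> I"
  show "\<exists>H :: 'b monoid. topological_group (TH i) H \<and> j i \<in> hom (G i) H"
    by (rule cc_semitopological_group.stone_cech_topological_group[OF cc_group_T[OF i] stone_cech_TH[OF i]])
qed

end

section \<open>The multiplication on the compactification and its continuity\<close>

locale cc_primitive_semigroup_compactification =
  cc_primitive_semigroup_stone_cech X m I L G \<phi> \<alpha> K e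
  for X :: "'a topology" and m and I :: "'i set" and L :: "'i \<Rightarrow> 'l set" and G :: "'i \<Rightarrow> 'g monoid" and \<phi> \<alpha>
    and K :: "'b topology" and e +
  fixes H :: "'i \<Rightarrow> 'b monoid"
  assumes H_group: "i \<in> I \<Longrightarrow> topological_group (TH i) (H i)"
    and j_hom: "i \<in> I \<Longrightarrow> j i \<in> hom (G i) (H i)"
begin

lemma groupH: "i \<in> I \<Longrightarrow> group (H i)"
  using H_group by (simp add: topological_group_def)

lemma carrier_H: "i \<in> I \<Longrightarrow> carrier (H i) = kcell (i, \<alpha> i, \<alpha> i)"
  using H_group[of i] topspace_TH[of i] by (simp add: topological_group_def)

text \<open>The point \<open>(a, h, b)\<close> of the Brandt semigroup with index \<open>i\<close>
  over the compactified group: the diagonal cell is shifted to position \<open>(a, b)\<close>. The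
  inverse map \<open>coord\<close> shifts back.\<close>

definition pel :: "'i \<Rightarrow> 'l \<Rightarrow> 'b \<Rightarrow> 'l \<Rightarrow> 'b" where
  "pel i a h b = kshift i a (\<alpha> i) (\<alpha> i) b h"

definition coord :: "'i \<Rightarrow> 'l \<Rightarrow> 'l \<Rightarrow> 'b \<Rightarrow> 'b" where
  "coord i a b p = kshift i (\<alpha> i) a b (\<alpha> i) p"

definition \<Psi> :: "('i \<times> 'l \<times> 'b \<times> 'l) option \<Rightarrow> 'b" where
  "\<Psi> x = (case x of None \<Rightarrow> zk | Some (i, a, h, b) \<Rightarrow> pel i a h b)"

lemma \<Psi>_simps [simp]: "\<Psi> None = zk" "\<Psi> (Some (i, a, h, b)) = pel i a h b"
  by (simp_all add: \<Psi>_def)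

lemma pel_kcell: "i \<in> I \<Longrightarrow> a \<in> L i \<Longrightarrow> b \<in> L i \<Longrightarrow> h \<in> carrier (H i) \<Longrightarrow> pel i a h b \<in> kcell (i, a, b)"
  unfolding pel_def using alpha_in by (intro kshift_kcell) (auto simp: carrier_H)

lemma coord_carrier: "i \<in> I \<Longrightarrow> a \<in> L i \<Longrightarrow> b \<in> L i \<Longrightarrow> p \<in> kcell (i, a, b) \<Longrightarrow> coord i a b p \<in> carrier (H i)"
  unfolding coord_def using alpha_in by (simp add: carrier_H kshift_kcell)

lemma coord_pel: "i \<in> I \<Longrightarrow> a \<in> L i \<Longrightarrow> b \<in> L i \<Longrightarrow> h \<in> carrier (H i) \<Longrightarrow> coord i a b (pel i a h b) = h"
  unfolding coord_def pel_def using alpha_in by (simp add: carrier_H kshift_kshift)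

lemma pel_coord: "i \<in> I \<Longrightarrow> a \<in> L i \<Longrightarrow> b \<in> L i \<Longrightarrow> p \<in> kcell (i, a, b) \<Longrightarrow> pel i a (coord i a b p) b = p"
  unfolding coord_def pel_def using alpha_in by (simp add: kshift_kshift)

lemma kcell_eq:
  assumes "i \<in> I" "a \<in> L i" "b \<in> L i"
  shows "kcell (i, a, b) = (\<lambda>h. pel i a h b) ` carrier (H i)"
proof
  show "kcell (i, a, b) \<subseteq> (\<lambda>h. pel i a h b) ` carrier (H i)"
  proof
    fix p assume "p \<in> kcell (i, a, b)"
    then show "p \<in> (\<lambda>h. pel i a h b) ` carrier (H i)"
      using assms by (intro image_eqI[of _ _ "coord i a b p"]) (simp_all add: pel_coord coord_carrier)
  qed
  show "(\<lambda>h. pel i a h b) ` carrier (H i) \<subseteq> kcell (i, a, b)"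
    using assms by (simp add: image_subset_iff pel_kcell)
qed

lemma pel_eq_iff:
  assumes "i \<in> I" "a \<in> L i" "b \<in> L i" "g \<in> carrier (H i)" "k \<in> I" "c \<in> L k" "d \<in> L k" "h \<in> carrier (H k)"
  shows "pel i a g b = pel k c h d \<longleftrightarrow> i = k \<and> a = c \<and> g = h \<and> b = d"
proof
  assume eq: "pel i a g b = pel k c h d"
  have "pel i a g b \<in> kcell (i, a, b)" "pel k c h d \<in> kcell (k, c, d)" using assms pel_kcell by blast+
  then have "kcell (i, a, b) \<inter> kcell (k, c, d) \<noteq> {}" using eq by auto
  then have "(i, a, b) = (k, c, d)" using kcell_disjoint[of "(i, a, b)" "(k, c, d)"] assms by auto
  then show "i = k \<and> a = c \<and> g = h \<and> b = d" using eq coord_pel assms by (metis prod.inject)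
qed simp

lemma pel_neq_zk: "i \<in> I \<Longrightarrow> a \<in> L i \<Longrightarrow> b \<in> L i \<Longrightarrow> h \<in> carrier (H i) \<Longrightarrow> pel i a h b \<noteq> zk"
  using pel_kcell[of i a b h] zk_notin_kcell[of "(i, a, b)"] by auto

lemma pel_in: "i \<in> I \<Longrightarrow> a \<in> L i \<Longrightarrow> b \<in> L i \<Longrightarrow> h \<in> carrier (H i) \<Longrightarrow> pel i a h b \<in> topspace K"
  using pel_kcell kcell_subset by blast

lemma \<Psi>_bij: "bij_betw \<Psi> (osum_carrier I L H) (topspace K)"
  unfolding bij_betw_def
proof
  show "inj_on \<Psi> (osum_carrier I L H)"
  proof (rule inj_onI)
    fix x y assume x: "x \<in> osum_carrier I L H" and y: "y \<in> osum_carrier I L H" and "\<Psi> x = \<Psi> y"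
    then show "x = y"
      using pel_neq_zk pel_neq_zk[symmetric]
      by (elim osum_carrier_cases) (simp_all add: pel_eq_iff)
  qed
  show "\<Psi> ` osum_carrier I L H = topspace K"
  proof
    show "\<Psi> ` osum_carrier I L H \<subseteq> topspace K"
    proof
      fix p assume "p \<in> \<Psi> ` osum_carrier I L H"
      then obtain x where x: "x \<in> osum_carrier I L H" "p = \<Psi> x" by blast
      from x(1) show "p \<in> topspace K"
        by (cases rule: osum_carrier_cases) (use x zk_in pel_in in auto)
    qed
    show "topspace K \<subseteq> \<Psi> ` osum_carrier I L H"
    proof
      fix p assume p: "p \<in> topspace K"
      show "p \<in> \<Psi> ` osum_carrier I L H"
      proof (cases "p = zk")
        case True
        then show ?thesis by (intro image_eqI[of _ _ None]) auto
      next
        case False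
        then have "p \<in> (\<Union>q\<in>Q. kcell q)" using p by (simp add: topspace_kcells)
        then obtain i a b where q: "i \<in> I" "a \<in> L i" "b \<in> L i" "p \<in> kcell (i, a, b)" by auto
        then show ?thesis
          using pel_coord coord_carrier by (intro image_eqI[of _ _ "Some (i, a, coord i a b p, b)"]) auto
      qed
    qed
  qed
qed

lemma j_carrier: "i \<in> I \<Longrightarrow> g \<in> carrier (G i) \<Longrightarrow> j i g \<in> carrier (H i)"
  using j_hom by (auto simp: hom_def)

lemma osum_map_simps [simp]: "osum_map j None = None" "osum_map j (Some (i, a, g, b)) = Some (i, a, j i g, b)"
  by (simp_all add: osum_map_def)

lemma osum_map_in: "x \<in> osum_carrier I L G \<Longrightarrow> osum_map j x \<in> osum_carrier I L H"
  by (cases x rule: osum_carrier_cases) (auto simp: j_carrier)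

lemma osum_map_mult:
  assumes "x \<in> osum_carrier I L G" "y \<in> osum_carrier I L G"
  shows "osum_map j (osum_mult G x y) = osum_mult H (osum_map j x) (osum_map j y)"
  using assms j_hom by (elim osum_carrier_cases) (auto simp: hom_def)

lemma e_phi:
  assumes "x \<in> osum_carrier I L G"
  shows "e (\<phi> x) = \<Psi> (osum_map j x)"
  using assms
proof (cases rule: osum_carrier_cases)
  case (2 i a g b)
  have "pel i a (j i g) b = e (shift i a (\<alpha> i) (\<alpha> i) b (el i (\<alpha> i) g (\<alpha> i)))"
    unfolding pel_def j_def using 2 alpha_in by (intro kshift(2)) (auto simp: el_in)
  then show ?thesis using 2 alpha_in by (simp add: shift_el) (simp add: el_def)
qed (simp add: zk_def z_def)

text \<open>The product is carried over from the orthogonal sum along \<open>\<Psi>\<close>.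
  Associativity, inverses and primitivity then come from the algebraic model, and separate
  continuity is what remains to be shown.\<close>

definition mK :: "'b \<Rightarrow> 'b \<Rightarrow> 'b" where
  "mK p q = \<Psi> (osum_mult H (inv_into (osum_carrier I L H) \<Psi> p) (inv_into (osum_carrier I L H) \<Psi> q))"

lemma \<Psi>_mult:
  assumes "x \<in> osum_carrier I L H" "y \<in> osum_carrier I L H"
  shows "\<Psi> (osum_mult H x y) = mK (\<Psi> x) (\<Psi> y)"
  using assms bij_betw_imp_inj_on[OF \<Psi>_bij] by (simp add: mK_def)

sublocale iso: magma_isomorphism "osum_carrier I L H" "osum_mult H" "topspace K" mK \<Psi>
  by unfold_locales (rule \<Psi>_bij \<Psi>_mult osum_mult_closed[OF groupH]; assumption)+

lemma mK_pel:
  assumes "i \<in> I" "a \<in> L i" "b \<in> L i" "g \<in> carrier (H i)" "k \<in> I" "c \<in> L k" "d \<in> L k" "h \<in> carrier (H k)"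
  shows "mK (pel i a g b) (pel k c h d) = (if i = k \<and> b = c then pel i a (g \<otimes>\<^bsub>H i\<^esub> h) d else zk)"
  using \<Psi>_mult[of "Some (i, a, g, b)" "Some (k, c, h, d)"] assms by auto

lemma mK_zk:
  assumes "p \<in> topspace K"
  shows "mK zk p = zk" "mK p zk = zk"
proof -
  obtain x where x: "x \<in> osum_carrier I L H" "p = \<Psi> x" using assms \<Psi>_bij by (auto simp: bij_betw_def)
  show "mK zk p = zk" "mK p zk = zk"
    using \<Psi>_mult[of None x] \<Psi>_mult[of x None] x by simp_all
qed

lemma e_mult:
  assumes "x \<in> topspace X" "y \<in> topspace X"
  shows "e (m x y) = mK (e x) (e y)"
proof -
  have "x \<in> \<phi> ` osum_carrier I L G" "y \<in> \<phi> ` osum_carrier I L G"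
    using assms bij_betw_imp_surj_on[OF phi_bij] by simp_all
  then obtain u v where uv: "u \<in> osum_carrier I L G" "x = \<phi> u" "v \<in> osum_carrier I L G" "y = \<phi> v"
    by blast
  have "e (m x y) = e (\<phi> (osum_mult G u v))" using uv phi_hom by simp
  also have "\<dots> = \<Psi> (osum_mult H (osum_map j u) (osum_map j v))"
    using uv osum_mult_closed[where I = I and H = G and L = L, OF groups] by (simp add: e_phi osum_map_mult)
  also have "\<dots> = mK (e x) (e y)"
    using uv by (simp add: \<Psi>_mult osum_map_in e_phi)
  finally show ?thesis .
qed

lemma primitive_inverse_K: "primitive_inverse_semigroup (topspace K) mK"
  by (rule iso.primitive_inverse_transport[OF primitive_inverse_osum[OF groupH]])

lemma inverse_osum: "inverse_semigroup (osum_carrier I L H) (osum_mult H)"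
  using primitive_inverse_osum[where I = I and H = H and L = L, OF groupH] by (simp add: primitive_inverse_semigroup_def)

lemma inverse_pel:
  assumes "i \<in> I" "a \<in> L i" "b \<in> L i" "h \<in> carrier (H i)"
  shows "semigroup_inverse (topspace K) mK (pel i a h b) = pel i b (inv\<^bsub>H i\<^esub> h) a"
  using iso.semigroup_inverse_transport[OF inverse_osum, of "Some (i, a, h, b)"]
    osum_inverse[where I = I and H = H and L = L, OF groupH assms] assms by simp

lemma inverse_zk: "semigroup_inverse (topspace K) mK zk = zk"
  using iso.semigroup_inverse_transport[OF inverse_osum, of None] by (simp add: osum_inverse_None)

lemma coord_continuous:
  assumes "i \<in> I" "a \<in> L i" "b \<in> L i"
  shows "continuous_map (subtopology K (kcell (i, a, b))) (TH i) (coord i a b)"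
  unfolding TH_def coord_def[abs_def] using assms alpha_in by (intro kshift_cell_continuous) auto

lemma pel_continuous:
  assumes "i \<in> I" "a \<in> L i" "b \<in> L i"
  shows "continuous_map (TH i) (subtopology K (kcell (i, a, b))) (\<lambda>h. pel i a h b)"
  unfolding TH_def pel_def[abs_def] using assms alpha_in by (intro kshift_cell_continuous) auto

lemma homeomorphic_pel:
  assumes "i \<in> I" "a \<in> L i" "b \<in> L i"
  shows "homeomorphic_map (TH i) (subtopology K (kcell (i, a, b))) (\<lambda>h. pel i a h b)"
proof -
  have "homeomorphic_maps (TH i) (subtopology K (kcell (i, a, b))) (\<lambda>h. pel i a h b) (coord i a b)"
    unfolding homeomorphic_maps_def
  proof (intro conjI ballI coord_continuous pel_continuous assms)
    fix h assume "h \<in> topspace (TH i)"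
    then show "coord i a b (pel i a h b) = h"
      using assms by (simp add: coord_pel topspace_TH carrier_H)
  next
    fix p assume "p \<in> topspace (subtopology K (kcell (i, a, b)))"
    then show "pel i a (coord i a b p) b = p"
      using assms by (simp add: pel_coord)
  qed
  then show ?thesis using homeomorphic_map_maps by blast
qed

lemma continuous_map_on_kcell:
  assumes "i \<in> I" "a \<in> L i" "b \<in> L i" "c \<in> L i" "d \<in> L i"
    and t: "continuous_map (TH i) (TH i) t"
    and f: "\<And>h. h \<in> carrier (H i) \<Longrightarrow> f (pel i a h b) = pel i c (t h) d"
  shows "continuous_map (subtopology K (kcell (i, a, b))) K f"
proof -
  have "continuous_map (subtopology K (kcell (i, a, b))) (subtopology K (kcell (i, c, d)))
      ((\<lambda>h. pel i c h d) \<circ> (t \<circ> coord i a b))"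
    by (rule continuous_map_compose[OF continuous_map_compose[OF coord_continuous[OF assms(1-3)] t]
          pel_continuous[OF assms(1,4,5)]])
  then have "continuous_map (subtopology K (kcell (i, a, b))) (subtopology K (kcell (i, c, d))) f"
  proof (rule continuous_map_eq)
    fix p assume "p \<in> topspace (subtopology K (kcell (i, a, b)))"
    then have p: "p \<in> kcell (i, a, b)" by simp
    show "((\<lambda>h. pel i c h d) \<circ> (t \<circ> coord i a b)) p = f p"
      using f[OF coord_carrier[OF assms(1-3) p]] pel_coord[OF assms(1-3) p] by simp
  qed
  then show ?thesis by (rule continuous_map_into_fulltopology)
qed

text \<open>The common shape of translations and inversion: cells outside \<open>M\<close> collapse
  to zero, while on cells in \<open>M\<close> the two outer indices change by \<open>r\<close> and
  \<open>r'\<close> and the group component by a continuous \<open>t\<close>. Injectivity on cells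
  takes care of continuity at zero.\<close>

lemma continuous_map_kcellwise:
  assumes fz: "f zk = zk"
    and off: "\<And>l c d h. (l, c, d) \<in> Q - M \<Longrightarrow> h \<in> carrier (H l) \<Longrightarrow> f (pel l c h d) = zk"
    and on: "\<And>l c d h. (l, c, d) \<in> Q \<inter> M \<Longrightarrow> h \<in> carrier (H l) \<Longrightarrow>
        f (pel l c h d) = pel l (r c d) (t l h) (r' c d)"
    and r: "\<And>l c d. (l, c, d) \<in> Q \<inter> M \<Longrightarrow> r c d \<in> L l \<and> r' c d \<in> L l \<and> continuous_map (TH l) (TH l) (t l)"
    and inj: "inj_on (\<lambda>(l, c, d). (l, r c d, r' c d)) M"
  shows "continuous_map K K f"
proof (rule continuous_map_cellwise[OF K_countably_compact kcell_disjoint open_kcell closed_kcell topspace_kcells,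
      where r = "\<lambda>(l, c, d). (l, r c d, r' c d)"])
  have zero: "f p = zk" if "q \<in> Q - M" "p \<in> kcell q" for p q
    using that off by (cases q) (auto simp: kcell_eq)
  show "f zk = zk" by (rule fz)
  show "continuous_map (subtopology K (kcell q)) K f" if q: "q \<in> Q" for q
  proof (cases "q \<in> M")
    case True
    obtain l c d where lcd: "q = (l, c, d)" by (cases q)
    then have m: "(l, c, d) \<in> Q \<inter> M" using q True by simp
    then have ld: "l \<in> I" "c \<in> L l" "d \<in> L l" by auto
    show ?thesis
      unfolding lcd
      by (rule continuous_map_on_kcell[OF ld, where c = "r c d" and d = "r' c d" and t = "t l"])
         (use r[OF m] on[OF m] in simp_all)
  next
    case False
    show ?thesis
    proof (rule continuous_map_eq)
      show "continuous_map (subtopology K (kcell q)) K (\<lambda>_. zk)" using zk_in by simp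
    qed (use zero[of q] q False in auto)
  qed
  show "f ` kcell q \<subseteq> {zk} \<or> (case q of (l, c, d) \<Rightarrow> (l, r c d, r' c d)) \<in> Q \<and>
      f ` kcell q \<subseteq> kcell (case q of (l, c, d) \<Rightarrow> (l, r c d, r' c d))" if q: "q \<in> Q" for q
  proof (cases "q \<in> M")
    case True
    obtain l c d where lcd: "q = (l, c, d)" by (cases q)
    have t: "t l h \<in> carrier (H l)" if "h \<in> carrier (H l)" for h
      using r[of l c d] q True that lcd by (auto simp: continuous_map_def topspace_TH carrier_H)
    have "f ` kcell (l, c, d) \<subseteq> kcell (l, r c d, r' c d)"
      using q True lcd on[of l c d] r[of l c d] t by (auto simp: kcell_eq)
    then show ?thesis using q True lcd r[of l c d] by simp
  next
    case False
    then show ?thesis using zero[of q] q by blast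
  qed
  have "{q \<in> Q. \<not> f ` kcell q \<subseteq> {zk}} \<subseteq> M" using zero by blast
  then show "inj_on (\<lambda>(l, c, d). (l, r c d, r' c d)) {q \<in> Q. \<not> f ` kcell q \<subseteq> {zk}}"
    by (rule inj_on_subset[OF inj])
qed

lemma H_lmult_continuous: "i \<in> I \<Longrightarrow> h \<in> carrier (H i) \<Longrightarrow> continuous_map (TH i) (TH i) (\<lambda>x. h \<otimes>\<^bsub>H i\<^esub> x)"
  using continuous_map_pairwise2[of "TH i" "TH i" "TH i" "mult (H i)" h] H_group[of i]
  by (simp add: topological_group_def)

lemma H_rmult_continuous: "i \<in> I \<Longrightarrow> h \<in> carrier (H i) \<Longrightarrow> continuous_map (TH i) (TH i) (\<lambda>x. x \<otimes>\<^bsub>H i\<^esub> h)"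
  using continuous_map_pairwise1[of "TH i" "TH i" "TH i" "mult (H i)" h] H_group[of i]
  by (simp add: topological_group_def)

lemma H_mult_closed: "i \<in> I \<Longrightarrow> g \<in> carrier (H i) \<Longrightarrow> h \<in> carrier (H i) \<Longrightarrow> g \<otimes>\<^bsub>H i\<^esub> h \<in> carrier (H i)"
  using groupH by (simp add: group.is_monoid monoid.m_closed)

lemma K_cases:
  assumes "p \<in> topspace K"
  obtains "p = zk" | i a h b where "p = pel i a h b" "i \<in> I" "a \<in> L i" "b \<in> L i" "h \<in> carrier (H i)"
proof -
  obtain x where x: "x \<in> osum_carrier I L H" "p = \<Psi> x" using assms \<Psi>_bij by (auto simp: bij_betw_def)
  from x(1) show thesis
    by (cases rule: osum_carrier_cases) (use x that in auto)
qed

lemma mK_continuous_left: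
  assumes k: "k \<in> topspace K"
  shows "continuous_map K K (\<lambda>p. mK k p)"
  using k
proof (cases rule: K_cases)
  case 1
  have "continuous_map K K (\<lambda>_. zk)" using zk_in by simp
  then show ?thesis by (rule continuous_map_eq) (simp add: 1 mK_zk)
next
  case (2 i a h b)
  \<comment> \<open>Left multiplication by \<open>(a, h, b)\<close> annihilates every cell except
    those of index \<open>i\<close> in row \<open>b\<close>, which move to row \<open>a\<close> with
    the column kept; hence distinct surviving cells have distinct images.\<close>
  show ?thesis
    by (rule continuous_map_kcellwise[where M = "{i} \<times> {b} \<times> UNIV" and r = "\<lambda>c d. a" and r' = "\<lambda>c d. d"
          and t = "\<lambda>l x. h \<otimes>\<^bsub>H l\<^esub> x"])
       (use k 2 in \<open>auto simp: mK_zk mK_pel H_lmult_continuous inj_on_def\<close>)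
qed

lemma mK_continuous_right:
  assumes k: "k \<in> topspace K"
  shows "continuous_map K K (\<lambda>p. mK p k)"
  using k
proof (cases rule: K_cases)
  case 1
  have "continuous_map K K (\<lambda>_. zk)" using zk_in by simp
  then show ?thesis by (rule continuous_map_eq) (simp add: 1 mK_zk)
next
  case (2 i a h b)
  \<comment> \<open>Symmetrically, only the cells of index \<open>i\<close> in column
    \<open>a\<close> survive, and they move to column \<open>b\<close> with the row kept.\<close>
  show ?thesis
    by (rule continuous_map_kcellwise[where M = "{i} \<times> UNIV \<times> {a}" and r = "\<lambda>c d. c" and r' = "\<lambda>c d. b"
          and t = "\<lambda>l x. x \<otimes>\<^bsub>H l\<^esub> h"])
       (use k 2 in \<open>auto simp: mK_zk mK_pel H_rmult_continuous inj_on_def\<close>)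
qed

text \<open>Inversion exchanges the two outer indices, an injection on cells, and inverts the group
  component, which is continuous because each \<open>H i\<close> is a topological group.\<close>

lemma inverse_continuous: "continuous_map K K (semigroup_inverse (topspace K) mK)"
  by (rule continuous_map_kcellwise[where M = UNIV and r = "\<lambda>c d. d" and r' = "\<lambda>c d. c" and t = "\<lambda>l. m_inv (H l)"])
     (use H_group in \<open>auto simp: inverse_zk inverse_pel topological_group_def inj_on_def\<close>)

lemma semitopological_K: "semitopological_semigroup K mK"
  unfolding semitopological_semigroup_def
  using scD(2) primitive_inverse_K mK_continuous_left mK_continuous_right
  by (simp add: primitive_inverse_semigroup_def inverse_semigroup_def)

lemma \<Psi>_group_cell: "i \<in> I \<Longrightarrow> a \<in> L i \<Longrightarrow> b \<in> L i \<Longrightarrow> \<Psi> ` group_cell i a b H = kcell (i, a, b)"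
proof -
  have "group_cell i a b H = (\<lambda>h. Some (i, a, h, b)) ` carrier (H i)" by (auto simp: group_cell_def)
  then show "i \<in> I \<Longrightarrow> a \<in> L i \<Longrightarrow> b \<in> L i \<Longrightarrow> \<Psi> ` group_cell i a b H = kcell (i, a, b)"
    by (simp add: kcell_eq image_image)
qed

text \<open>Described as the complement of all cells with another index. Cells being open, each
  Brandt summand is then closed in \<open>K\<close>, and so compact.\<close>

lemma \<Psi>_brandt_part:
  assumes i: "i \<in> I"
  shows "\<Psi> ` brandt_part i L H = topspace K - (\<Union>q\<in>{q \<in> Q. fst q \<noteq> i}. kcell q)"
proof (intro Set.set_eqI iffI)
  fix p assume "p \<in> \<Psi> ` brandt_part i L H"
  then consider "p = zk" | a h b where "p = pel i a h b" "a \<in> L i" "b \<in> L i" "h \<in> carrier (H i)"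
    by (auto simp: brandt_part_def)
  then show "p \<in> topspace K - (\<Union>q\<in>{q \<in> Q. fst q \<noteq> i}. kcell q)"
  proof cases
    case 1
    then show ?thesis using zk_in zk_notin_kcell by blast
  next
    case 2
    then have p: "p \<in> kcell (i, a, b)" and iq: "(i, a, b) \<in> Q" using i pel_kcell by auto
    have "p \<notin> kcell q" if "q \<in> Q" "fst q \<noteq> i" for q
      using kcell_disjoint[OF iq that(1)] p that(2) by (cases "q = (i, a, b)") auto
    then show ?thesis using p kcell_subset by blast
  qed
next
  fix p assume p: "p \<in> topspace K - (\<Union>q\<in>{q \<in> Q. fst q \<noteq> i}. kcell q)"
  then have "p \<in> topspace K" by blast
  then show "p \<in> \<Psi> ` brandt_part i L H"
  proof (cases rule: K_cases)
    case 1
    then show ?thesis by (intro image_eqI[of _ _ None]) (auto simp: brandt_part_def)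
  next
    case (2 l a h b)
    then have "p \<in> kcell (l, a, b)" "(l, a, b) \<in> Q" using pel_kcell by auto
    then have "l = i" using p by force
    then show ?thesis
      using 2 by (intro image_eqI[of _ _ "Some (i, a, h, b)"]) (auto simp: brandt_part_def)
  qed
qed

lemma closed_brandt_part:
  assumes "i \<in> I"
  shows "closedin K (\<Psi> ` brandt_part i L H)"
  unfolding \<Psi>_brandt_part[OF assms]
  by (intro closedin_diff closedin_topspace openin_Union) (auto simp: open_kcell)

lemma semitopological_brandt_part:
  assumes i: "i \<in> I"
  shows "semitopological_semigroup (subtopology K (\<Psi> ` brandt_part i L H)) mK"
proof -
  let ?B = "\<Psi> ` brandt_part i L H"
  have BK: "?B \<subseteq> topspace K" using closedin_subset[OF closed_brandt_part[OF i]] .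
  have top: "topspace (subtopology K ?B) = ?B" using BK by auto
  have sub: "brandt_part i L H \<subseteq> osum_carrier I L H"
    using i by (auto simp: brandt_part_def)
  have closed: "mK p q \<in> ?B" if pq: "p \<in> ?B" "q \<in> ?B" for p q
  proof -
    obtain x y where x: "x \<in> brandt_part i L H" "p = \<Psi> x" and y: "y \<in> brandt_part i L H" "q = \<Psi> y"
      using pq by blast
    have iff: "None \<in> brandt_part i L H" "Some (k, a, h, b) \<in> brandt_part i L H \<longleftrightarrow>
        k = i \<and> a \<in> L i \<and> b \<in> L i \<and> h \<in> carrier (H i)" for k a h b
      by (auto simp: brandt_part_def)
    have "osum_mult H x y \<in> brandt_part i L H"
      by (cases x; cases y) (use x(1) y(1) H_mult_closed[OF i] in \<open>auto simp: iff\<close>)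
    moreover have "mK p q = \<Psi> (osum_mult H x y)" using \<Psi>_mult[OF subsetD[OF sub x(1)] subsetD[OF sub y(1)]] x(2) y(2) by simp
    ultimately show ?thesis by blast
  qed
  have assoc: "mK (mK p q) r = mK p (mK q r)" if "p \<in> ?B" "q \<in> ?B" "r \<in> ?B" for p q r
  proof -
    have "semigroup_on (topspace K) mK"
      using semitopological_K by (simp add: semitopological_semigroup_def)
    then show ?thesis
      using subsetD[OF BK that(1)] subsetD[OF BK that(2)] subsetD[OF BK that(3)]
      unfolding semigroup_on_def by blast
  qed
  show ?thesis
    unfolding semitopological_semigroup_def top
  proof (intro conjI ballI)
    show "Hausdorff_space (subtopology K ?B)" by (rule Hausdorff_space_subtopology[OF scD(2)])
    show "semigroup_on ?B mK" unfolding semigroup_on_def using closed assoc by simp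
    fix k assume k: "k \<in> ?B"
    then have kK: "k \<in> topspace K" using BK by blast
    show "continuous_map (subtopology K ?B) (subtopology K ?B) (\<lambda>x. mK k x)"
      using continuous_map_from_subtopology[OF mK_continuous_left[OF kK], of ?B] closed[OF k]
      by (simp add: continuous_map_in_subtopology image_subset_iff Pi_iff)
    show "continuous_map (subtopology K ?B) (subtopology K ?B) (\<lambda>x. mK x k)"
      using continuous_map_from_subtopology[OF mK_continuous_right[OF kK], of ?B] closed[OF _ k]
      by (simp add: continuous_map_in_subtopology image_subset_iff Pi_iff)
  qed
qed

end

text \<open>The structure is asserted for every Stone-Cech compactification over an arbitrary type
  \<open>'b\<close>. The existence clause at type \<open>'a set set\<close> ensures that this is not
  vacuous at that type; \<open>e\<close> being part of a compactification, it is already an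
  embedding, so compatibility with the products is what makes it a topological isomorphism onto its
  image.\<close>

theorem theorem4p3:
  fixes X :: "'a topology" and m :: "'a \<Rightarrow> 'a \<Rightarrow> 'a"
    and I :: "'i set" and L :: "'i \<Rightarrow> 'l set" and G :: "'i \<Rightarrow> 'g monoid"
    and \<phi> :: "('i \<times> 'l \<times> 'g \<times> 'l) option \<Rightarrow> 'a"
    and \<alpha> :: "'i \<Rightarrow> 'l"
  assumes semitop: "semitopological_semigroup X m"
    and reg: "regular_space X"
    and ccomp: "countably_compact_space X"
    and groups: "\<And>i. i \<in> I \<Longrightarrow> group (G i)"
    and card_pos: "\<And>i. i \<in> I \<Longrightarrow> L i \<noteq> {}"
    and phi_bij: "bij_betw \<phi> (osum_carrier I L G) (topspace X)"
    and phi_hom: "\<And>x y. x \<in> osum_carrier I L G \<Longrightarrow> y \<in> osum_carrier I L G \<Longrightarrow>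
                    \<phi> (osum_mult G x y) = m (\<phi> x) (\<phi> y)"
    and alpha_in: "\<And>i. i \<in> I \<Longrightarrow> \<alpha> i \<in> L i"
    and cases: "\<And>i. i \<in> I \<Longrightarrow>
        left_precompact (subtopology X (\<phi> ` group_cell i (\<alpha> i) (\<alpha> i) G)) m
                        (\<phi> (Some (i, \<alpha> i, \<one>\<^bsub>G i\<^esub>, \<alpha> i)))
      \<or> (left_omega_precompact (subtopology X (\<phi> ` group_cell i (\<alpha> i) (\<alpha> i) G)) m
                        (\<phi> (Some (i, \<alpha> i, \<one>\<^bsub>G i\<^esub>, \<alpha> i)))
         \<and> pseudocompact_space (subtopology X (\<phi> ` group_cell i (\<alpha> i) (\<alpha> i) G)))
      \<or> topological_semigroup
          (subtopology X (\<phi> ` insert None (group_cell i (\<alpha> i) (\<alpha> i) G))) m"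
  shows "tychonoff_space X
    \<and> (\<exists>(K :: 'a set set topology) e. stone_cech X K e)
    \<and> (\<forall>(K :: 'b topology) e. stone_cech X K e \<longrightarrow>
        (\<exists>mK. semitopological_semigroup K mK
           \<and> primitive_inverse_semigroup (topspace K) mK
           \<and> continuous_map K K (semigroup_inverse (topspace K) mK)
           \<and> (\<forall>x\<in>topspace X. \<forall>y\<in>topspace X. e (m x y) = mK (e x) (e y))
           \<and> (\<exists>(H :: 'i \<Rightarrow> 'b monoid) TH j \<Psi>.
                (\<forall>i\<in>I. topological_group (TH i) (H i) \<and> compact_space (TH i)
                   \<and> j i \<in> hom (G i) (H i)
                   \<and> stone_cech (pullback_topology (carrier (G i))
                                    (\<lambda>g. \<phi> (Some (i, \<alpha> i, g, \<alpha> i))) X) (TH i) (j i))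
              \<and> bij_betw \<Psi> (osum_carrier I L H) (topspace K)
              \<and> (\<forall>x\<in>osum_carrier I L H. \<forall>y\<in>osum_carrier I L H.
                    \<Psi> (osum_mult H x y) = mK (\<Psi> x) (\<Psi> y))
              \<and> (\<forall>x\<in>osum_carrier I L G. e (\<phi> x) = \<Psi> (osum_map j x))
              \<and> (\<forall>i\<in>I. compact_space (subtopology K (\<Psi> ` brandt_part i L H))
                   \<and> semitopological_semigroup (subtopology K (\<Psi> ` brandt_part i L H)) mK
                   \<and> (\<forall>a\<in>L i. homeomorphic_map (TH i)
                        (subtopology K (\<Psi> ` group_cell i a a H))
                        (\<lambda>h. \<Psi> (Some (i, a, h, a))))))))"
proof -
  interpret S: cc_primitive_semigroup X m I L G \<phi> \<alpha>
    by (rule cc_primitive_semigroup.intro) (fact semitop reg ccomp groups phi_bij phi_hom alpha_in cases)+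
  show ?thesis
  proof (intro conjI allI impI, goal_cases)
    case 1
    show ?case by (rule S.tychonoff)
  next
    case 2
    show ?case by (rule stone_cech_exists[OF S.tychonoff])
  next
    case (3 K e)
    then have sc: "stone_cech X K e" .
    interpret SC: cc_primitive_semigroup_stone_cech X m I L G \<phi> \<alpha> K e
      by unfold_locales (fact sc)
    obtain H :: "'i \<Rightarrow> 'b monoid" where
      H: "\<forall>i\<in>I. topological_group (SC.TH i) (H i) \<and> SC.j i \<in> hom (G i) (H i)"
      using SC.exists_group_structure by (elim exE)
    interpret C: cc_primitive_semigroup_compactification X m I L G \<phi> \<alpha> K e H
      by unfold_locales (use H in simp_all)
    show ?case
    proof (intro exI[of _ C.mK] exI[of _ H] exI[of _ SC.TH] exI[of _ SC.j] exI[of _ C.\<Psi>] conjI ballI)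
      fix i assume i: "i \<in> I"
      show "topological_group (SC.TH i) (H i)" "SC.j i \<in> hom (G i) (H i)" using H i by simp_all
      show "compact_space (SC.TH i)" by (rule SC.compact_TH)
      show "stone_cech (pullback_topology (carrier (G i)) (\<lambda>g. \<phi> (Some (i, \<alpha> i, g, \<alpha> i))) X) (SC.TH i) (SC.j i)"
        using SC.stone_cech_TH[OF i] by (simp only: S.T_def)
      show "compact_space (subtopology K (C.\<Psi> ` brandt_part i L H))"
        by (rule compact_space_subtopology[OF closedin_compact_space[OF SC.scD(1) C.closed_brandt_part[OF i]]])
      show "semitopological_semigroup (subtopology K (C.\<Psi> ` brandt_part i L H)) C.mK"
        by (rule C.semitopological_brandt_part[OF i])
      fix a assume a: "a \<in> L i"
      show "homeomorphic_map (SC.TH i) (subtopology K (C.\<Psi> ` group_cell i a a H)) (\<lambda>h. C.\<Psi> (Some (i, a, h, a)))"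
        using C.homeomorphic_pel[OF i a a] by (simp add: C.\<Psi>_group_cell[OF i a a])
    qed (simp_all add: C.semitopological_K C.primitive_inverse_K C.inverse_continuous C.e_mult C.\<Psi>_bij C.\<Psi>_mult C.e_phi)
  qed
qed

end
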